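(* Let $f_j(x)=\rho_jx+c_j$, $0<\rho_j<1$, $c_j\in\mathbb R^d$ $(1\le j\le m)$ be a self-similar IFS on $\mathbb R^d$ satisfying the strong open set condition, with attractor $J$ whose convex hull $\mathrm{Co}(J)$ has dimension $d$, and let $(\widetilde J,\widetilde g)$ be the associated dynamical system described in the context. Let $\Phi$ be the additive potential on $(\widetilde J,\widetilde g)$ associated with $\mathrm{id}_J$, i.e. $\phi_n(x)=\sum_{k=0}^{n-1}\widetilde g^kx$, and let $\mathcal D_\Phi(\alpha)=\dim_H\{x\in\widetilde J:\lim_{n\to\infty}\phi_n(x)/n=\alpha\}$ for $\alpha\in L_\Phi=\mathrm{Co}(J)$. Let $$\mathcal F(\widetilde J,\widetilde g)=\Big\{x\in\widetilde J:\lim_{n\to\infty}\frac1n\sum_{k=0}^{n-1}\widetilde g^kx=x\Big\}.$$ Then $\mathcal F(\widetilde J,\widetilde g)$ is dense in $J$ and $$\dim_H\mathcal F(\widetilde J,\widetilde g)=\sup\{\mathcal D_\Phi(\alpha):\alpha\in J\}.$$ Moreover, if a point at which $\mathcal D_\Phi$ attains its maximum (over $L_\Phi$) belongs to $J$, then $\mathcal F(\widetilde J,\widetilde g)$ is of full Hausdorff dimension, i.e. $\dim_H\mathcal F(\widetilde J,\widetilde g)=\dim_HJ$.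
   Context: The attractor $J$ is the unique nonempty compact set with $J=\bigcup_{j=1}^mf_j(J)$. The strong open set condition (SOSC) for an open set $W$: $W$ is nonempty, $f_i(W)\subset W$, $f_i(W)\cap f_j(W)=\emptyset$ for $i\neq j$, and $W\cap J\ne\emptyset$. Here $\mathrm{Co}(J)=\Delta$ is the convex hull of the fixed points of the $f_j$, a convex polyhedron. Fix $W$ as in the SOSC and let $V=W\cap\mathrm{int}(\Delta)$, a bounded open set for which the SOSC also holds. Let $\Sigma_m=\{1,\dots,m\}^{\mathbb N}$ with shift $T$; for a finite word $w=w_1\cdots w_n$ let $f_w=f_{w_1}\circ\cdots\circ f_{w_n}$ (identity for the empty word); let $\chi:\Sigma_m\to J$, $\chi(x)$ the unique point of $\bigcap_{n\ge1}f_{x_1\cdots x_n}(\overline V)$. Put $\widetilde Z_\infty=\bigcup_wf_w(\partial V)$ (union over all finite words), $Z_\infty=\chi^{-1}(\widetilde Z_\infty)$, $\widetilde J=J\setminus\widetilde Z_\infty$. Then $\chi:\Sigma_m\setminus Z_\infty\to\widetilde J$ is a bijection, $T(\Sigma_m\setminus Z_\infty)\subset\Sigma_m\setminus Z_\infty$, and $\widetilde g=\chi\circ T\circ\chi^{-1}:\widetilde J\to\widetilde J$. $L_\Phi$ denotes the set of $\alpha\in\mathbb R^d$ for which $\{x\in\widetilde J:\phi_n(x)/n\to\alpha\}$ is nonempty. *)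

theory Defs
  imports "HOL-Analysis.Analysis"
begin

subsection \<open>Hausdorff measure and dimension\<close>

(* The weight of a covering set. The case distinction gives 0^0 = 1 for nonempty sets and
   weight 0 to the empty set, so that the 0-dimensional measure is counting measure
   (powr alone would give 0 powr 0 = 0). *)
definition hausdorff_weight :: "real \<Rightarrow> 'a::metric_space set \<Rightarrow> ennreal" where
  "hausdorff_weight s U =
     (if U = {} then 0 else if s = 0 then 1 else ennreal (diameter U powr s))"

(* Boundedness is required explicitly since diameter is unspecified for unbounded sets.
   Finite covers are included because the U i may be empty. *)
definition hausdorff_premeasure :: "real \<Rightarrow> real \<Rightarrow> 'a::metric_space set \<Rightarrow> ennreal" where
  "hausdorff_premeasure s \<delta> A =
     (INF U \<in> {U :: nat \<Rightarrow> 'a set.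
                 A \<subseteq> (\<Union>i. U i) \<and> (\<forall>i. bounded (U i) \<and> diameter (U i) \<le> \<delta>)}.
        (\<Sum>i. hausdorff_weight s (U i)))"

definition hausdorff_measure :: "real \<Rightarrow> 'a::metric_space set \<Rightarrow> ennreal" where
  "hausdorff_measure s A = (SUP \<delta> \<in> {0<..}. hausdorff_premeasure s \<delta> A)"

definition hausdorff_dim :: "'a::metric_space set \<Rightarrow> ennreal" where
  "hausdorff_dim A = (INF s \<in> {s. 0 \<le> s \<and> hausdorff_measure s A = 0}. ennreal s)"

subsection \<open>Iterated function systems\<close>

(* An IFS f_1, ..., f_m is a function f of which only the values on {1..m} are used. *)

definition ifs_attractor :: "nat \<Rightarrow> (nat \<Rightarrow> 'a::euclidean_space \<Rightarrow> 'a) \<Rightarrow> 'a set \<Rightarrow> bool" where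
  "ifs_attractor m f J \<longleftrightarrow> compact J \<and> J \<noteq> {} \<and> J = (\<Union>j\<in>{1..m}. f j ` J)"

definition strong_open_set_condition ::
    "nat \<Rightarrow> (nat \<Rightarrow> 'a::euclidean_space \<Rightarrow> 'a) \<Rightarrow> 'a set \<Rightarrow> 'a set \<Rightarrow> bool" where
  "strong_open_set_condition m f J W \<longleftrightarrow>
     open W \<and> W \<noteq> {} \<and>
     (\<forall>i\<in>{1..m}. f i ` W \<subseteq> W) \<and>
     (\<forall>i\<in>{1..m}. \<forall>j\<in>{1..m}. i \<noteq> j \<longrightarrow> f i ` W \<inter> f j ` W = {}) \<and>
     W \<inter> J \<noteq> {}"

fun ifs_word :: "(nat \<Rightarrow> 'a \<Rightarrow> 'a) \<Rightarrow> nat list \<Rightarrow> 'a \<Rightarrow> 'a" where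
  "ifs_word f [] = id"
| "ifs_word f (j # w) = f j \<circ> ifs_word f w"

subsection \<open>Symbolic coding and the induced dynamical system\<close>

(* Sequences are indexed from 0, so x 0 is the first symbol x_1. *)

definition symbol_space :: "nat \<Rightarrow> (nat \<Rightarrow> nat) set" where
  "symbol_space m = {x. \<forall>k. x k \<in> {1..m}}"

definition shift :: "(nat \<Rightarrow> nat) \<Rightarrow> (nat \<Rightarrow> nat)" where
  "shift x = (\<lambda>k. x (Suc k))"

definition coding ::
    "(nat \<Rightarrow> 'a::euclidean_space \<Rightarrow> 'a) \<Rightarrow> 'a set \<Rightarrow> (nat \<Rightarrow> nat) \<Rightarrow> 'a" where
  "coding f V x = (THE z. z \<in> (\<Inter>n\<in>{1..}. ifs_word f (map x [0..<n]) ` closure V))"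

definition exceptional_points ::
    "nat \<Rightarrow> (nat \<Rightarrow> 'a::euclidean_space \<Rightarrow> 'a) \<Rightarrow> 'a set \<Rightarrow> 'a set" where
  "exceptional_points m f V = (\<Union>w\<in>lists {1..m}. ifs_word f w ` frontier V)"

definition exceptional_codes ::
    "nat \<Rightarrow> (nat \<Rightarrow> 'a::euclidean_space \<Rightarrow> 'a) \<Rightarrow> 'a set \<Rightarrow> (nat \<Rightarrow> nat) set" where
  "exceptional_codes m f V = {x \<in> symbol_space m. coding f V x \<in> exceptional_points m f V}"

definition regular_part ::
    "nat \<Rightarrow> (nat \<Rightarrow> 'a::euclidean_space \<Rightarrow> 'a) \<Rightarrow> 'a set \<Rightarrow> 'a set \<Rightarrow> 'a set" where
  "regular_part m f V J = J - exceptional_points m f V"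

definition induced_map ::
    "nat \<Rightarrow> (nat \<Rightarrow> 'a::euclidean_space \<Rightarrow> 'a) \<Rightarrow> 'a set \<Rightarrow> 'a \<Rightarrow> 'a" where
  "induced_map m f V =
     coding f V \<circ> shift \<circ> inv_into (symbol_space m - exceptional_codes m f V) (coding f V)"

subsection \<open>Birkhoff averages of the identity\<close>

definition birkhoff_sum :: "('a \<Rightarrow> 'a::real_normed_vector) \<Rightarrow> nat \<Rightarrow> 'a \<Rightarrow> 'a" where
  "birkhoff_sum g n x = (\<Sum>k<n. (g ^^ k) x)"

definition level_set ::
    "'a::real_normed_vector set \<Rightarrow> ('a \<Rightarrow> 'a) \<Rightarrow> 'a \<Rightarrow> 'a set" where
  "level_set X g \<alpha> = {x \<in> X. (\<lambda>n. (1 / real n) *\<^sub>R birkhoff_sum g n x) \<longlonglongrightarrow> \<alpha>}"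

definition limit_averages :: "'a::real_normed_vector set \<Rightarrow> ('a \<Rightarrow> 'a) \<Rightarrow> 'a set" where
  "limit_averages X g = {\<alpha>. level_set X g \<alpha> \<noteq> {}}"

definition dim_spectrum ::
    "'a::real_normed_vector set \<Rightarrow> ('a \<Rightarrow> 'a) \<Rightarrow> 'a \<Rightarrow> ennreal" where
  "dim_spectrum X g \<alpha> = hausdorff_dim (level_set X g \<alpha>)"

definition asymptotic_fixed_points :: "'a::real_normed_vector set \<Rightarrow> ('a \<Rightarrow> 'a) \<Rightarrow> 'a set" where
  "asymptotic_fixed_points X g =
     {x \<in> X. (\<lambda>n. (1 / real n) *\<^sub>R (\<Sum>k<n. (g ^^ k) x)) \<longlonglongrightarrow> x}"

end

theory Submission
  imports Defs "HOL-Library.Sublist"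
begin

text \<open>The proof is elementary: it counts finite words, with the contraction ratio of a word to the power
\<open>s\<close> as its weight, and uses neither invariant measures nor a variational principle.

Up to a bounded error a Birkhoff sum of the identity along an orbit depends only on the word that the
orbit follows, because the effect of changing the tail of a code is bounded by a geometric series
(\<open>word_sum_append\<close>, \<open>word_sum_pre\<close>). Call a target \<open>\<alpha>\<close> \<^emph>\<open>rich\<close> at the exponent \<open>s\<close> if, for every tolerance and for
arbitrarily large \<open>n\<close>, the words of length \<open>n\<close> whose average is within the tolerance of \<open>\<alpha>\<close> have total
weight at least 1. Three upper bounds show that a dimension above \<open>s\<close> forces richness at \<open>s\<close>. The
level set of \<open>\<alpha>\<close> is covered by the cylinders of the words with average near \<open>\<alpha>\<close>, so if it is
that large then \<open>\<alpha>\<close> is rich. The asymptotic fixed points have averages that converge into the compact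
set \<open>J\<close>, so finitely many such covers suffice, and some \<open>\<alpha> \<in> J\<close> is rich
(\<open>dim_le_if_not_rich\<close>). If \<open>J\<close> itself is that large, the total weight of all words of length \<open>n\<close>
grows exponentially, and since finitely many small balls cover the hull \<open>\<Delta>\<close> of \<open>J\<close>, the pigeonhole
principle gives a rich \<open>\<alpha> \<in> \<Delta>\<close> (\<open>exists_rich_below_dim\<close>).

Conversely, richness of \<open>\<alpha>\<close> at \<open>s\<close> produces large sets. Words with average near \<open>\<alpha>\<close> are concatenated
with a small proportion of powers of single letters, whose averages are the fixed points of the maps,
that is, points that span \<open>\<Delta>\<close>. As \<open>\<Delta>\<close> is a polytope, every target \<open>\<beta> \<in> \<Delta>\<close> close to \<open>\<alpha>\<close> is hit in
this way at any exponent \<open>t < s\<close> (\<open>reach_near_rich\<close>). The blocks also end in a fixed word \<open>u\<close> whose map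
sends the closure of \<open>V\<close> into \<open>V\<close>; a code in which \<open>u\<close> recurs is not exceptional
(\<open>regular_if_inner_word_recurs\<close>). Infinite concatenations of blocks of slowly growing length,
with tolerances that tend to 0, then form a set of codes that carries a mass distribution of
exponent \<open>t\<close>, and the target of each block may depend on the blocks before it
(\<open>codes_with_moving_target\<close>). With the constant target \<open>\<alpha>\<close> this bounds the dimension of the level set
from below. With the target set to the point coded so far, started in a cylinder around \<open>\<alpha> \<in> J\<close> so
small that all targets stay close to \<open>\<alpha>\<close>, the averages converge to the coded point itself, and this
bounds the dimension of the set of asymptotic fixed points from below. Exponent 0 gives the
statements on nonemptiness and density: every \<open>\<alpha> \<in> \<Delta>\<close> is a limit of averages, and every cylinder of
\<open>J\<close> contains an asymptotic fixed point.

So both sides of the dimension formula exceed \<open>s\<close> for essentially the same reason, namely that some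
\<open>\<alpha> \<in> J\<close> is rich at \<open>s\<close>; and if the spectrum attains its maximum in \<open>J\<close>, richness anywhere in \<open>\<Delta>\<close>
is enough, which is what the dimension of \<open>J\<close> provides.\<close>

section \<open>Hausdorff measure and dimension\<close>

lemma hausdorff_premeasure_mono:
  "A \<subseteq> B \<Longrightarrow> hausdorff_premeasure s \<delta> A \<le> hausdorff_premeasure s \<delta> B"
  unfolding hausdorff_premeasure_def by (rule INF_superset_mono) auto

lemma hausdorff_measure_mono:
  "A \<subseteq> B \<Longrightarrow> hausdorff_measure s A \<le> hausdorff_measure s B"
  unfolding hausdorff_measure_def by (rule SUP_mono') (rule hausdorff_premeasure_mono)

lemma hausdorff_null_subset:
  "A \<subseteq> B \<Longrightarrow> hausdorff_measure s B = 0 \<Longrightarrow> hausdorff_measure s A = 0"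
  using hausdorff_measure_mono[of A B s] by simp

lemma hausdorff_dim_mono: "A \<subseteq> B \<Longrightarrow> hausdorff_dim A \<le> hausdorff_dim B"
  unfolding hausdorff_dim_def
  by (rule INF_superset_mono) (auto intro: hausdorff_null_subset)

lemma hausdorff_measure_eq_0_iff:
  "hausdorff_measure s A = 0 \<longleftrightarrow> (\<forall>\<delta>>0. hausdorff_premeasure s \<delta> A = 0)"
  unfolding hausdorff_measure_def bot_ennreal[symmetric] by (auto simp: SUP_bot_conv)

text \<open>Cover the \<open>k\<close>-th set at cost \<open>e / 2 ^ (k + 1)\<close> and enumerate all the
covering sets together.\<close>

lemma hausdorff_null_UN:
  fixes A :: "nat \<Rightarrow> 'a::metric_space set"
  assumes null: "\<And>k. hausdorff_measure s (A k) = 0"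
  shows "hausdorff_measure s (\<Union>k. A k) = 0"
  unfolding hausdorff_measure_eq_0_iff
proof (intro allI impI)
  fix \<delta> :: real assume "\<delta> > 0"
  have "hausdorff_premeasure s \<delta> (\<Union>k. A k) \<le> 0 + ennreal e" if "0 < e" for e :: real
  proof -
    have "\<exists>U. A k \<subseteq> (\<Union>i. U i) \<and> (\<forall>i. bounded (U i) \<and> diameter (U i) \<le> \<delta>) \<and>
        (\<Sum>i. hausdorff_weight s (U i)) < ennreal (e * (1 / 2) ^ Suc k)" for k
    proof -
      have "hausdorff_premeasure s \<delta> (A k) < ennreal (e * (1 / 2) ^ Suc k)"
        using null[of k] \<open>\<delta> > 0\<close> \<open>0 < e\<close> by (simp add: hausdorff_measure_eq_0_iff)
      then show ?thesis
        unfolding hausdorff_premeasure_def INF_less_iff by auto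
    qed
    then obtain U where U: "\<And>k. A k \<subseteq> (\<Union>i. U k i)"
        "\<And>k i. bounded (U k i) \<and> diameter (U k i) \<le> \<delta>"
        "\<And>k. (\<Sum>i. hausdorff_weight s (U k i)) < ennreal (e * (1 / 2) ^ Suc k)"
      by metis
    define U' where "U' n = (case prod_decode n of (k, i) \<Rightarrow> U k i)" for n
    have "hausdorff_premeasure s \<delta> (\<Union>k. A k) \<le> (\<Sum>n. hausdorff_weight s (U' n))"
      unfolding hausdorff_premeasure_def
    proof (rule INF_lower, safe)
      fix x k assume "x \<in> A k"
      then obtain i where "x \<in> U k i" using U(1) by blast
      then have "x \<in> U' (prod_encode (k, i))" by (simp add: U'_def)
      then show "x \<in> (\<Union>i. U' i)" by blast
    qed (use U(2) in \<open>auto simp: U'_def split: prod.split\<close>)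
    also have "\<dots> = (\<Sum>k. \<Sum>i. hausdorff_weight s (U k i))"
      using suminf_ennreal_2dimen[of "\<lambda>k. \<Sum>i. hausdorff_weight s (U k i)"
          "\<lambda>(k, i). hausdorff_weight s (U k i)"]
      by (simp add: U'_def case_prod_unfold)
    also have "\<dots> \<le> (\<Sum>k. ennreal (e * (1 / 2) ^ Suc k))"
      by (intro suminf_le) (use U(3) in \<open>auto intro: less_imp_le\<close>)
    also have "\<dots> = ennreal e"
      by (rule suminf_ennreal_eq) (use \<open>0 < e\<close> sums_mult[OF power_half_series, of e] in auto)
    finally show ?thesis by simp
  qed
  then have "hausdorff_premeasure s \<delta> (\<Union>k. A k) \<le> 0"
    using ennreal_le_epsilon[of 0 "hausdorff_premeasure s \<delta> (\<Union>k. A k)"] by auto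
  then show "hausdorff_premeasure s \<delta> (\<Union>k. A k) = 0" by simp
qed

lemma hausdorff_premeasure_finite_cover:
  fixes U :: "'i \<Rightarrow> 'a::metric_space set"
  assumes "finite I" "A \<subseteq> (\<Union>i\<in>I. U i)" "0 \<le> \<delta>"
    and U: "\<And>i. i \<in> I \<Longrightarrow> bounded (U i) \<and> diameter (U i) \<le> \<delta>"
  shows "hausdorff_premeasure s \<delta> A \<le> (\<Sum>i\<in>I. hausdorff_weight s (U i))"
proof -
  obtain h where h: "bij_betw h {..<card I} I"
    using \<open>finite I\<close> by (metis atLeast0LessThan ex_bij_betw_nat_finite)
  define U' where "U' n = (if n < card I then U (h n) else {})" for n
  have hI: "h n \<in> I" if "n < card I" for n
    using h that by (auto dest: bij_betwE)
  have "hausdorff_premeasure s \<delta> A \<le> (\<Sum>n. hausdorff_weight s (U' n))"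
    unfolding hausdorff_premeasure_def
  proof (rule INF_lower, safe)
    fix x assume "x \<in> A"
    then obtain i where "i \<in> I" "x \<in> U i" using assms(2) by blast
    moreover then obtain n where "n < card I" "h n = i"
      using h by (metis bij_betw_iff_bijections lessThan_iff)
    ultimately have "x \<in> U' n" by (simp add: U'_def)
    then show "x \<in> (\<Union>i. U' i)" by blast
  qed (use U hI \<open>0 \<le> \<delta>\<close> in \<open>auto simp: U'_def\<close>)
  also have "\<dots> = (\<Sum>n<card I. hausdorff_weight s (U' n))"
    by (rule suminf_finite) (auto simp: U'_def hausdorff_weight_def)
  also have "\<dots> = (\<Sum>n<card I. hausdorff_weight s (U (h n)))"
    by (rule sum.cong) (auto simp: U'_def)
  also have "\<dots> = (\<Sum>i\<in>I. hausdorff_weight s (U i))"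
    by (rule sum.reindex_bij_betw[OF h])
  finally show ?thesis .
qed

lemma hausdorff_dim_geI:
  assumes "\<And>t. 0 \<le> t \<Longrightarrow> t < s \<Longrightarrow> hausdorff_measure t A \<noteq> 0"
  shows "ennreal s \<le> hausdorff_dim A"
  unfolding hausdorff_dim_def
  by (rule INF_greatest) (use assms in \<open>auto intro!: ennreal_leI leI\<close>)

lemma hausdorff_dim_leI:
  assumes "0 \<le> s" "\<And>t. s < t \<Longrightarrow> hausdorff_measure t A = 0"
  shows "hausdorff_dim A \<le> ennreal s"
proof (rule ennreal_le_epsilon)
  fix e :: real assume "0 < e"
  then have "hausdorff_dim A \<le> ennreal (s + e)"
    unfolding hausdorff_dim_def using assms by (intro INF_lower) auto
  then show "hausdorff_dim A \<le> ennreal s + ennreal e"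
    using \<open>0 < e\<close> assms(1) by (simp add: ennreal_plus)
qed

text \<open>At exponent 0 every nonempty covering set costs 1. This supplies the
exponent 0 in lower bounds for dimensions, since the mass distributions below give information only
about positive exponents.\<close>

lemma hausdorff_measure_0_eq_0_iff:
  "hausdorff_measure 0 A = 0 \<longleftrightarrow> A = {}"
proof
  assume "hausdorff_measure 0 A = 0"
  then have "hausdorff_premeasure 0 1 A < 1"
    by (simp add: hausdorff_measure_eq_0_iff)
  then obtain U where U: "A \<subseteq> (\<Union>i. U i)" "(\<Sum>i. hausdorff_weight 0 (U i)) < 1"
    unfolding hausdorff_premeasure_def INF_less_iff by auto
  have "U i = {}" for i
  proof (rule ccontr)
    assume "U i \<noteq> {}"
    then have "1 \<le> (\<Sum>j\<in>{i}. hausdorff_weight 0 (U j))" by (simp add: hausdorff_weight_def)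
    also have "\<dots> \<le> (\<Sum>i. hausdorff_weight 0 (U i))" by (rule sum_le_suminf) auto
    finally show False using U(2) by auto
  qed
  then show "A = {}" using U(1) by auto
next
  assume "A = {}"
  then have "hausdorff_premeasure 0 \<delta> A \<le> 0" if "0 < \<delta>" for \<delta>
    using hausdorff_premeasure_finite_cover[of "{}" A _ \<delta> 0] that by simp
  then show "hausdorff_measure 0 A = 0" by (simp add: hausdorff_measure_eq_0_iff)
qed

lemma hausdorff_null_countable_UN:
  fixes A :: "'i \<Rightarrow> 'a::metric_space set"
  assumes "countable I" "\<And>i. i \<in> I \<Longrightarrow> hausdorff_measure s (A i) = 0"
  shows "hausdorff_measure s (\<Union>i\<in>I. A i) = 0"
proof (cases "I = {}")
  case False
  have "hausdorff_measure s (\<Union>k. A (from_nat_into I k)) = 0"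
    by (rule hausdorff_null_UN) (simp add: assms(2) from_nat_into False)
  moreover have "(\<Union>k. A (from_nat_into I k)) = (\<Union>i\<in>I. A i)"
    using range_from_nat_into[OF False assms(1)] by (metis image_image)
  ultimately show ?thesis by simp
next
  case True
  have "hausdorff_premeasure s \<delta> ({} :: 'a set) \<le> 0" if "0 < \<delta>" for \<delta> :: real
    using hausdorff_premeasure_finite_cover[of "{}" "{} :: 'a set" "\<lambda>_. {}" \<delta> s] that by simp
  then show ?thesis by (simp add: True hausdorff_measure_eq_0_iff)
qed

text \<open>Comparisons of dimensions reduce to real exponents below the left-hand
side, the form in which weights of words can be used.\<close>

lemma ennreal_le_by_reals:
  fixes x y :: ennreal
  assumes "\<And>s. 0 \<le> s \<Longrightarrow> ennreal s < x \<Longrightarrow> ennreal s \<le> y"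
  shows "x \<le> y"
proof (rule dense_le)
  fix z assume "z < x"
  then have "z = ennreal (enn2real z)" by (metis ennreal_enn2real_if less_top_ennreal not_less_iff_gr_or_eq top.not_eq_extremum)
  then show "z \<le> y" using assms[of "enn2real z"] \<open>z < x\<close> by simp
qed

section \<open>Sums, tolerances and prefixes\<close>

lemma sum_UN_le:
  fixes g :: "'b \<Rightarrow> real"
  assumes "finite T" "\<And>i. i \<in> T \<Longrightarrow> finite (A i)" "\<And>x. 0 \<le> g x"
  shows "sum g (\<Union>i\<in>T. A i) \<le> (\<Sum>i\<in>T. sum g (A i))"
  using assms(1,2)
proof (induction T)
  case (insert i T)
  have "sum g (\<Union>i\<in>insert i T. A i) = sum g (A i) + sum g (\<Union>i\<in>T. A i) - sum g (A i \<inter> (\<Union>i\<in>T. A i))"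
    using insert by (simp add: sum_Un)
  also have "\<dots> \<le> sum g (A i) + sum g (\<Union>i\<in>T. A i)" by (simp add: sum_nonneg assms(3))
  finally show ?case using insert by auto
qed simp

lemma norm_add3_le:
  fixes x y z :: "'a::real_normed_vector"
  shows "norm (x + y + z) \<le> norm x + norm y + norm z"
  using norm_triangle_ineq[of "x + y" z] norm_triangle_ineq[of x y] by linarith

text \<open>If each fixed tolerance is eventually good, a null sequence of
tolerances is eventually good as well: take slightly more than the infimum of the tolerances that are
good at \<open>n\<close>. This lets the tolerance of a block shrink with its length.\<close>

lemma diagonal_tolerance:
  fixes G :: "nat \<Rightarrow> real \<Rightarrow> bool"
  assumes mono: "\<And>n x y. G n x \<Longrightarrow> x \<le> y \<Longrightarrow> G n y"
    and ev: "\<And>x. 0 < x \<Longrightarrow> \<exists>N. \<forall>n\<ge>N. G n x"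
  obtains e N where "e \<longlonglongrightarrow> (0::real)" "\<And>n. N \<le> n \<Longrightarrow> G n (e n)"
proof -
  define T where "T n = {x. 0 < x \<and> G n x}" for n
  define e where "e n = Inf (T n) + 1 / real (Suc n)" for n
  have bdd: "bdd_below (T n)" for n by (rule bdd_belowI[of _ 0]) (simp add: T_def)
  obtain N where N: "\<And>n. N \<le> n \<Longrightarrow> G n 1" using ev[of 1] by auto
  then have ne: "T n \<noteq> {}" if "N \<le> n" for n
    using that by (auto simp: T_def intro!: exI[of _ 1])
  show ?thesis
  proof (rule that)
    fix n assume n: "N \<le> n"
    have "Inf (T n) < e n" by (simp add: e_def)
    then obtain x where "x \<in> T n" "x < e n" using cInf_lessD[OF ne[OF n]] by blast
    then show "G n (e n)" using mono[of n x "e n"] by (simp add: T_def)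
  next
    show "e \<longlonglongrightarrow> 0"
    proof (rule LIMSEQ_I)
      fix \<eta> :: real assume \<eta>: "0 < \<eta>"
      obtain N1 where N1: "\<And>n. N1 \<le> n \<Longrightarrow> G n (\<eta> / 2)" using ev[of "\<eta> / 2"] \<eta> by auto
      obtain N2 where N2: "inverse (real (Suc N2)) < \<eta> / 2" using reals_Archimedean[of "\<eta> / 2"] \<eta> by auto
      show "\<exists>n0. \<forall>n\<ge>n0. norm (e n - 0) < \<eta>"
      proof (intro exI allI impI)
        fix n assume n: "max N (max N1 N2) \<le> n"
        have "\<eta> / 2 \<in> T n" using N1[of n] n \<eta> by (simp add: T_def)
        then have "Inf (T n) \<le> \<eta> / 2" using bdd by (rule cInf_lower)
        moreover have "0 \<le> Inf (T n)" using ne[of n] n by (intro cInf_greatest) (auto simp: T_def)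
        moreover have "1 / real (Suc n) \<le> inverse (real (Suc N2))"
          using n by (simp add: field_simps)
        ultimately show "norm (e n - 0) < \<eta>" using N2 by (simp add: e_def)
      qed
    qed
  qed
qed

lemma prefix_same_lengthD: "prefix xs ys \<Longrightarrow> length xs = length ys \<Longrightarrow> xs = ys"
  by (auto simp: prefix_def)

lemma bounded_imp_dist_le:
  fixes X :: "'a::metric_space set"
  assumes "bounded X"
  obtains D where "0 < D" "\<And>x y. x \<in> X \<Longrightarrow> y \<in> X \<Longrightarrow> dist x y \<le> D"
proof -
  obtain D where "\<forall>x\<in>X. \<forall>y\<in>X. dist x y \<le> D"
    using assms unfolding bounded_two_points by auto
  then show ?thesis by (intro that[of "max D 1"]) force+
qed

lemma strict_mono_interval:
  fixes L :: "nat \<Rightarrow> nat"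
  assumes "strict_mono L" "L k0 \<le> n"
  obtains k where "k0 \<le> k" "L k \<le> n" "n < L (Suc k)"
proof -
  have fin: "finite {k. L k \<le> n}"
    by (rule finite_subset[of _ "{..n}"])
       (use strict_mono_imp_increasing[OF assms(1)] in \<open>auto intro: order_trans\<close>)
  let ?k = "Max {k. L k \<le> n}"
  have "?k \<in> {k. L k \<le> n}" using assms(2) by (intro Max_in[OF fin]) auto
  moreover have "k0 \<le> ?k" using assms(2) by (intro Max_ge[OF fin]) auto
  moreover have "n < L (Suc ?k)" using Max_ge[OF fin, of "Suc ?k"] by (auto simp: not_le[symmetric])
  ultimately show ?thesis using that by simp
qed

section \<open>Words, codes and the induced map\<close>

text \<open>The set \<open>V\<close> is an arbitrary bounded open set with the strong open set condition; being bounded makes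
the maps contract its closure to the coded points. The main theorem uses the locale twice, for
different sets \<open>V\<close>.\<close>

locale homothetic_ifs =
  fixes m :: nat
    and \<rho> :: "nat \<Rightarrow> real"
    and c :: "nat \<Rightarrow> 'a::euclidean_space"
    and f :: "nat \<Rightarrow> 'a \<Rightarrow> 'a"
    and J V :: "'a set"
  assumes ratio: "\<And>j. j \<in> {1..m} \<Longrightarrow> 0 < \<rho> j \<and> \<rho> j < 1"
    and maps: "\<And>j x. j \<in> {1..m} \<Longrightarrow> f j x = \<rho> j *\<^sub>R x + c j"
    and attractor: "ifs_attractor m f J"
    and sosc: "strong_open_set_condition m f J V"
    and bounded_V: "bounded V"
begin

abbreviation F :: "nat list \<Rightarrow> 'a \<Rightarrow> 'a" where
  "F \<equiv> ifs_word f"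

definition r :: "nat list \<Rightarrow> real" where
  "r z = (\<Prod>j\<leftarrow>z. \<rho> j)"

definition words :: "nat \<Rightarrow> nat list set" where
  "words n = {z. set z \<subseteq> {1..m} \<and> length z = n}"

definition r_max :: real where "r_max = Max (\<rho> ` {1..m})"
definition r_min :: real where "r_min = Min (\<rho> ` {1..m})"

lemma finite_words [simp]: "finite (words n)"
  unfolding words_def by (rule finite_lists_length_eq) simp

lemma wordsI: "set z \<subseteq> {1..m} \<Longrightarrow> z \<in> words (length z)"
  by (simp add: words_def)

lemma words_0 [simp]: "words 0 = {[]}"
  by (auto simp: words_def)

lemma words_append: "z \<in> words n \<Longrightarrow> w \<in> words k \<Longrightarrow> z @ w \<in> words (n + k)"
  by (auto simp: words_def)

lemma r_Nil [simp]: "r [] = 1" and r_Cons [simp]: "r (j # z) = \<rho> j * r z"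
  by (simp_all add: r_def)

lemma r_append: "r (z @ w) = r z * r w"
  by (simp add: r_def)

lemma J: "compact J" "J \<noteq> {}" "J = (\<Union>j\<in>{1..m}. f j ` J)"
  using attractor by (auto simp: ifs_attractor_def)

lemma f_J: "j \<in> {1..m} \<Longrightarrow> f j ` J \<subseteq> J"
  by (subst (2) J(3)) blast

lemma V: "open V" "V \<noteq> {}" "V \<inter> J \<noteq> {}"
  using sosc by (auto simp: strong_open_set_condition_def)

lemma f_V: "i \<in> {1..m} \<Longrightarrow> f i ` V \<subseteq> V"
  using sosc by (auto simp: strong_open_set_condition_def)

lemma f_disjoint: "i \<in> {1..m} \<Longrightarrow> j \<in> {1..m} \<Longrightarrow> i \<noteq> j \<Longrightarrow> f i ` V \<inter> f j ` V = {}"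
  using sosc by (auto simp: strong_open_set_condition_def)

lemma m_pos: "1 \<le> m"
proof (rule ccontr)
  assume "\<not> 1 \<le> m"
  then have "J = {}" using J(3) by simp
  then show False using J(2) by simp
qed

lemma r_max: "j \<in> {1..m} \<Longrightarrow> \<rho> j \<le> r_max" "0 < r_max" "r_max < 1"
  and r_min: "j \<in> {1..m} \<Longrightarrow> r_min \<le> \<rho> j" "0 < r_min" "r_min < 1"
proof -
  have ne: "finite (\<rho> ` {1..m})" "\<rho> ` {1..m} \<noteq> {}" using m_pos by auto
  show "j \<in> {1..m} \<Longrightarrow> \<rho> j \<le> r_max" "j \<in> {1..m} \<Longrightarrow> r_min \<le> \<rho> j"
    unfolding r_max_def r_min_def using ne by auto
  obtain i where "i \<in> {1..m}" "r_max = \<rho> i" using Max_in[OF ne] unfolding r_max_def by auto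
  then show "0 < r_max" "r_max < 1" using ratio by auto
  obtain i where "i \<in> {1..m}" "r_min = \<rho> i" using Min_in[OF ne] unfolding r_min_def by auto
  then show "0 < r_min" "r_min < 1" using ratio by auto
qed

lemma r_pos: "set z \<subseteq> {1..m} \<Longrightarrow> 0 < r z"
  by (induction z) (use ratio in auto)

lemma r_le_power: "set z \<subseteq> {1..m} \<Longrightarrow> r z \<le> r_max ^ length z"
proof (induction z)
  case (Cons j z)
  then have "\<rho> j \<le> r_max" "r z \<le> r_max ^ length z" "0 \<le> r z"
    using r_max(1)[of j] r_pos[of z] by auto
  then show ?case using r_max(2) by (simp add: mult_mono)
qed simp

lemma r_ge_power: "set z \<subseteq> {1..m} \<Longrightarrow> r_min ^ length z \<le> r z"
proof (induction z)
  case (Cons j z)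
  then have "r_min \<le> \<rho> j" "r_min ^ length z \<le> r z" "0 \<le> \<rho> j"
    using r_min(1)[of j] ratio[of j] by auto
  then show ?case using r_min(2) by (simp add: mult_mono)
qed simp

lemma r_le_1: "set z \<subseteq> {1..m} \<Longrightarrow> r z \<le> 1"
  using r_le_power[of z] r_max(2,3) by (meson less_imp_le order_trans power_le_one)

lemma F_append: "F (z @ w) x = F z (F w x)"
  by (induction z) auto

lemma F_append_image: "F (z @ w) ` X = F z ` F w ` X"
  by (auto simp: F_append image_image)

lemma F_diff: "set z \<subseteq> {1..m} \<Longrightarrow> F z x - F z y = r z *\<^sub>R (x - y)"
  by (induction z arbitrary: x y) (auto simp: maps simp flip: scaleR_diff_right)

lemma dist_F: "set z \<subseteq> {1..m} \<Longrightarrow> dist (F z x) (F z y) = r z * dist x y"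
  using F_diff[of z x y] r_pos[of z] by (simp add: dist_norm)

lemma inj_F: "set z \<subseteq> {1..m} \<Longrightarrow> inj (F z)"
  using dist_F r_pos by (metis dist_eq_0_iff injI mult_eq_0_iff order_less_irrefl)

lemma F_affine:
  assumes "set z \<subseteq> {1..m}" shows "F z = (\<lambda>x. F z 0 + r z *\<^sub>R x)"
proof
  fix x
  have "F z x - F z 0 = r z *\<^sub>R x" using F_diff[OF assms, of x 0] by simp
  then show "F z x = F z 0 + r z *\<^sub>R x" unfolding diff_eq_eq by (simp add: add.commute)
qed

lemma continuous_F: "set z \<subseteq> {1..m} \<Longrightarrow> continuous_on X (F z)"
  by (subst F_affine) (auto intro!: continuous_intros)

lemma F_image_subset:
  assumes "set z \<subseteq> {1..m}" "\<And>j. j \<in> {1..m} \<Longrightarrow> f j ` X \<subseteq> X"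
  shows "F z ` X \<subseteq> X"
  using assms(1)
proof (induction z)
  case (Cons j z)
  then have "F z ` X \<subseteq> X" "j \<in> {1..m}" by auto
  then show ?case using assms(2)[of j] by (auto simp: image_comp[symmetric])
qed auto

lemma F_J: "set z \<subseteq> {1..m} \<Longrightarrow> F z ` J \<subseteq> J"
  by (rule F_image_subset) (use f_J in auto)

lemma F_V: "set z \<subseteq> {1..m} \<Longrightarrow> F z ` V \<subseteq> V"
  by (rule F_image_subset) (use f_V in auto)

lemma F_closure: "set z \<subseteq> {1..m} \<Longrightarrow> F z ` closure X \<subseteq> closure (F z ` X)"
  by (rule image_closure_subset[OF continuous_F]) (use closure_subset in blast)+

lemma F_closure_V: "set z \<subseteq> {1..m} \<Longrightarrow> F z ` closure V \<subseteq> closure V"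
  using F_closure[of z V] F_V[of z] closure_mono by blast

lemma open_F:
  assumes z: "set z \<subseteq> {1..m}" and "open U" shows "open (F z ` U)"
proof -
  have "open ((\<lambda>x. F z 0 + x) ` (\<lambda>x. r z *\<^sub>R x) ` U)"
    using assms r_pos[OF z] by (intro open_translation open_scaling) auto
  also have "(\<lambda>x. F z 0 + x) ` (\<lambda>x. r z *\<^sub>R x) ` U = F z ` U"
    by (subst (2) F_affine[OF z]) (simp add: image_image)
  finally show ?thesis .
qed

text \<open>Neither word is an initial piece of the other, so they differ at some first letter. The maps of the
common part are injective and the images of \<open>V\<close> under different single maps are disjoint.\<close>

lemma F_V_disjoint:
  assumes "set z \<subseteq> {1..m}" "set w \<subseteq> {1..m}" "\<not> prefix z w" "\<not> prefix w z"
  shows "F z ` V \<inter> F w ` V = {}"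
  using assms
proof (induction z arbitrary: w)
  case (Cons i z)
  then obtain j w' where w: "w = j # w'" by (cases w) auto
  show ?case
  proof (cases "i = j")
    case True
    then have "F z ` V \<inter> F w' ` V = {}"
      using Cons.prems w by (intro Cons.IH) auto
    moreover have "inj (f i)" using inj_F[of "[i]"] Cons.prems by simp
    ultimately show ?thesis
      using True by (auto simp: w inj_eq)
  next
    case False
    have "f i ` V \<inter> f j ` V = {}" using Cons.prems w False by (intro f_disjoint) auto
    moreover have "F z ` V \<subseteq> V" "F w' ` V \<subseteq> V" using Cons.prems w F_V by auto
    ultimately have "f i ` F z ` V \<inter> f j ` F w' ` V = {}" by blast
    then show ?thesis by (simp add: w image_comp)
  qed
qed auto

lemma dist_J_bound: obtains D where "0 < D" "\<And>x y. x \<in> J \<Longrightarrow> y \<in> J \<Longrightarrow> dist x y \<le> D"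
  using bounded_imp_dist_le[OF compact_imp_bounded[OF J(1)]] by metis

lemma dist_closure_V_bound:
  obtains D where "0 < D" "\<And>x y. x \<in> closure V \<Longrightarrow> y \<in> closure V \<Longrightarrow> dist x y \<le> D"
  using bounded_imp_dist_le[OF bounded_closure[OF bounded_V]] by metis

lemma J_words_cover: "J = (\<Union>z\<in>words n. F z ` J)"
proof (induction n)
  case (Suc n)
  have "J \<subseteq> (\<Union>z\<in>words (Suc n). F z ` J)"
  proof
    fix x assume "x \<in> J"
    then obtain j y where j: "j \<in> {1..m}" "x = f j y" "y \<in> J" using J(3) by blast
    then obtain z y' where "z \<in> words n" "y' \<in> J" "y = F z y'" using Suc by blast
    then have "j # z \<in> words (Suc n)" "x = F (j # z) y'" using j by (auto simp: words_def)
    then show "x \<in> (\<Union>z\<in>words (Suc n). F z ` J)" using \<open>y' \<in> J\<close> by blast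
  qed
  moreover have "(\<Union>z\<in>words (Suc n). F z ` J) \<subseteq> J" using F_J by (auto simp: words_def)
  ultimately show ?case by blast
qed auto

lemma pow_r_max_tendsto: "(\<lambda>n. r_max ^ n * D) \<longlonglongrightarrow> 0"
  using tendsto_mult_left_zero[OF LIMSEQ_realpow_zero, of r_max D] r_max by auto

lemma pow_r_max_less:
  assumes "0 < e" obtains n where "\<And>k. n \<le> k \<Longrightarrow> r_max ^ k * D < e"
  using order_tendstoD(2)[OF pow_r_max_tendsto[of D] assms] by (auto simp: eventually_sequentially)

text \<open>Images of one point of \<open>V \<inter> J\<close> under long words are dense in \<open>J\<close>, and they stay in \<open>V\<close>.\<close>

lemma J_subset_closure_V: "J \<subseteq> closure V"
proof
  fix x assume x: "x \<in> J"
  obtain D where D: "0 < D" "\<And>x y. x \<in> J \<Longrightarrow> y \<in> J \<Longrightarrow> dist x y \<le> D" using dist_J_bound by blast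
  obtain y0 where y0: "y0 \<in> V" "y0 \<in> J" using V(3) by auto
  show "x \<in> closure V"
    unfolding closure_approachable
  proof (intro allI impI)
    fix e :: real assume "0 < e"
    then obtain n where n: "r_max ^ n * D < e" using pow_r_max_less by blast
    obtain z y where z: "z \<in> words n" "y \<in> J" "x = F z y" using J_words_cover[of n] x by blast
    have "dist (F z y0) x = r z * dist y0 y" using z dist_F by (auto simp: words_def)
    also have "\<dots> \<le> r_max ^ n * D"
      using z y0 D r_le_power[of z] r_max by (intro mult_mono) (auto simp: words_def)
    finally have "dist (F z y0) x < e" using n by simp
    moreover have "F z y0 \<in> V" using F_V z y0 by (auto simp: words_def)
    ultimately show "\<exists>y\<in>V. dist y x < e" by blast
  qed
qed

subsection \<open>Coding\<close>

abbreviation \<Sigma> :: "(nat \<Rightarrow> nat) set" where "\<Sigma> \<equiv> symbol_space m"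

abbreviation \<pi> :: "(nat \<Rightarrow> nat) \<Rightarrow> 'a" where "\<pi> \<equiv> coding f V"

definition pre :: "(nat \<Rightarrow> nat) \<Rightarrow> nat \<Rightarrow> nat list" where
  "pre \<omega> n = map \<omega> [0..<n]"

definition sh :: "nat \<Rightarrow> (nat \<Rightarrow> nat) \<Rightarrow> nat \<Rightarrow> nat" where
  "sh n \<omega> = (\<lambda>k. \<omega> (k + n))"

lemma pre_0 [simp]: "pre \<omega> 0 = []" and length_pre [simp]: "length (pre \<omega> n) = n"
  by (simp_all add: pre_def)

lemma sh_0 [simp]: "sh 0 \<omega> = \<omega>" and sh_sh: "sh n (sh k \<omega>) = sh (n + k) \<omega>"
  by (auto simp: sh_def ac_simps)

lemma shift_eq_sh: "shift \<omega> = sh 1 \<omega>"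
  by (simp add: shift_def sh_def)

lemma sh_in [intro]: "\<omega> \<in> \<Sigma> \<Longrightarrow> sh n \<omega> \<in> \<Sigma>"
  by (auto simp: symbol_space_def sh_def)

lemma pre_in: "\<omega> \<in> \<Sigma> \<Longrightarrow> set (pre \<omega> n) \<subseteq> {1..m}"
  by (auto simp: symbol_space_def pre_def simp del: atLeastAtMost_iff)

lemma pre_words: "\<omega> \<in> \<Sigma> \<Longrightarrow> pre \<omega> n \<in> words n"
  using pre_in by (simp add: words_def)

lemma pre_add: "pre \<omega> (n + k) = pre \<omega> n @ pre (sh n \<omega>) k"
  by (rule nth_equalityI) (auto simp: pre_def sh_def nth_append)

lemma take_pre: "n \<le> k \<Longrightarrow> take n (pre \<omega> k) = pre \<omega> n"
  using pre_add[of \<omega> n "k - n"] by simp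

lemma drop_pre: "n \<le> k \<Longrightarrow> drop n (pre \<omega> k) = pre (sh n \<omega>) (k - n)"
  using pre_add[of \<omega> n "k - n"] by simp

lemma F_pre_antimono:
  assumes "\<omega> \<in> \<Sigma>" "n \<le> k" "\<And>z. set z \<subseteq> {1..m} \<Longrightarrow> F z ` X \<subseteq> X"
  shows "F (pre \<omega> k) ` X \<subseteq> F (pre \<omega> n) ` X"
proof -
  have "F (pre \<omega> k) ` X = F (pre \<omega> n) ` F (pre (sh n \<omega>) (k - n)) ` X"
    using pre_add[of \<omega> n "k - n"] \<open>n \<le> k\<close> F_append_image by simp
  then show ?thesis using assms(3)[OF pre_in[OF sh_in[OF assms(1)]]] by (metis image_mono)
qed

lemma coding_in_closure_V_unique:
  assumes "\<omega> \<in> \<Sigma>"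
    and x: "\<And>n. 1 \<le> n \<Longrightarrow> x \<in> F (pre \<omega> n) ` closure V"
    and y: "\<And>n. 1 \<le> n \<Longrightarrow> y \<in> F (pre \<omega> n) ` closure V"
  shows "x = y"
proof -
  obtain D where D: "0 < D" "\<And>x y. x \<in> closure V \<Longrightarrow> y \<in> closure V \<Longrightarrow> dist x y \<le> D"
    using dist_closure_V_bound by blast
  have "dist x y \<le> r_max ^ n * D" if n: "1 \<le> n" for n
  proof -
    obtain x' y' where xy: "x' \<in> closure V" "y' \<in> closure V" "x = F (pre \<omega> n) x'" "y = F (pre \<omega> n) y'"
      using x[OF n] y[OF n] by auto
    have "dist x y = r (pre \<omega> n) * dist x' y'" using xy dist_F[OF pre_in[OF assms(1)]] by simp
    also have "\<dots> \<le> r_max ^ n * D"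
      using r_le_power[OF pre_in[OF assms(1)], of n] r_max D xy by (intro mult_mono) auto
    finally show ?thesis .
  qed
  then have "dist x y \<le> 0"
    by (intro tendsto_lowerbound[OF pow_r_max_tendsto[of D]]) (auto simp: eventually_sequentially)
  then show ?thesis by simp
qed

lemma coding_eqI:
  assumes "\<omega> \<in> \<Sigma>" "\<And>n. 1 \<le> n \<Longrightarrow> x \<in> F (pre \<omega> n) ` closure V"
  shows "\<pi> \<omega> = x"
  unfolding coding_def
proof (rule the_equality)
  fix y assume "y \<in> (\<Inter>n\<in>{1..}. F (map \<omega> [0..<n]) ` closure V)"
  then show "y = x"
    by (intro coding_in_closure_V_unique[OF assms(1)]) (use assms(2) in \<open>auto simp: pre_def\<close>)
qed (use assms in \<open>auto simp: pre_def\<close>)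

text \<open>The nested compact sets \<open>F (pre \<omega> n) ` J\<close> have a common point, which lies in the images of the closure
of \<open>V\<close> too, so it is the coded point.\<close>

lemma coding_in_F_J:
  assumes "\<omega> \<in> \<Sigma>"
  shows "\<pi> \<omega> \<in> F (pre \<omega> n) ` J"
proof -
  have "\<Inter>(range (\<lambda>n. F (pre \<omega> n) ` J)) \<noteq> {}"
  proof (rule compact_nest)
    show "compact (F (pre \<omega> n) ` J)" "F (pre \<omega> n) ` J \<noteq> {}" for n
      using J by (auto intro!: compact_continuous_image continuous_F pre_in assms)
    show "n \<le> k \<Longrightarrow> F (pre \<omega> k) ` J \<subseteq> F (pre \<omega> n) ` J" for n k
      by (rule F_pre_antimono) (use assms F_J in auto)
  qed
  then obtain x where x: "\<And>n. x \<in> F (pre \<omega> n) ` J" by auto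
  then have "\<pi> \<omega> = x"
    by (intro coding_eqI[OF assms]) (use J_subset_closure_V in blast)
  then show ?thesis using x by simp
qed

lemma coding_in_J: "\<omega> \<in> \<Sigma> \<Longrightarrow> \<pi> \<omega> \<in> J"
  using coding_in_F_J[of \<omega> 0] by simp

lemma coding_in_closure_V: "\<omega> \<in> \<Sigma> \<Longrightarrow> \<pi> \<omega> \<in> closure V"
  using coding_in_J J_subset_closure_V by blast

lemma coding_pre_sh:
  assumes "\<omega> \<in> \<Sigma>"
  shows "\<pi> \<omega> = F (pre \<omega> n) (\<pi> (sh n \<omega>))"
proof (rule coding_eqI[OF assms])
  fix k :: nat
  let ?x = "F (pre \<omega> n) (\<pi> (sh n \<omega>))"
  show "?x \<in> F (pre \<omega> k) ` closure V"
  proof (cases "n \<le> k")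
    case True
    have "?x \<in> F (pre \<omega> n) ` F (pre (sh n \<omega>) (k - n)) ` J"
      using coding_in_F_J[OF sh_in[OF assms]] by blast
    then have "?x \<in> F (pre \<omega> k) ` J"
      using pre_add[of \<omega> n "k - n"] True by (simp flip: F_append_image)
    then show ?thesis using J_subset_closure_V by blast
  next
    case False
    have "?x \<in> F (pre \<omega> n) ` closure V"
      using coding_in_closure_V[OF sh_in[OF assms]] by blast
    then show ?thesis
      using F_pre_antimono[OF assms, of k n "closure V"] False F_closure_V by auto
  qed
qed

lemma coding_surj:
  assumes "x \<in> J" obtains \<omega> where "\<omega> \<in> \<Sigma>" "\<pi> \<omega> = x"
proof -
  have "\<forall>x\<in>J. \<exists>j y. j \<in> {1..m} \<and> y \<in> J \<and> x = f j y" using J(3) by blast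
  then obtain j y where jy: "\<And>x. x \<in> J \<Longrightarrow> j x \<in> {1..m} \<and> y x \<in> J \<and> x = f (j x) (y x)" by metis
  define \<omega> where "\<omega> = (\<lambda>n. j ((y ^^ n) x))"
  have yJ: "(y ^^ n) x \<in> J" for n by (induction n) (use assms jy in auto)
  have \<omega>: "\<omega> \<in> \<Sigma>" using jy yJ unfolding \<omega>_def symbol_space_def by blast
  have "x = F (pre \<omega> n) ((y ^^ n) x)" for n
  proof (induction n)
    case (Suc n)
    have "x = F (pre \<omega> n) (f (\<omega> n) ((y ^^ Suc n) x))" using Suc jy[OF yJ[of n]] by (simp add: \<omega>_def)
    then show ?case by (simp add: pre_def F_append)
  qed (simp add: pre_def)
  then have "\<pi> \<omega> = x"
    by (intro coding_eqI[OF \<omega>]) (use yJ J_subset_closure_V in blast)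
  with \<omega> show ?thesis by (rule that)
qed

subsection \<open>Regular codes\<close>

definition regular_codes :: "(nat \<Rightarrow> nat) set" where
  "regular_codes = \<Sigma> - exceptional_codes m f V"

lemma regular_codes_subset: "regular_codes \<subseteq> \<Sigma>" by (auto simp: regular_codes_def)

lemma regular_codes_iff: "\<omega> \<in> regular_codes \<longleftrightarrow> \<omega> \<in> \<Sigma> \<and> (\<forall>w. set w \<subseteq> {1..m} \<longrightarrow> \<pi> \<omega> \<notin> F w ` frontier V)"
  unfolding regular_codes_def exceptional_codes_def exceptional_points_def by (auto simp: lists_eq_set)

lemma regular_part_eq: "regular_part m f V J = \<pi> ` regular_codes"
proof
  show "regular_part m f V J \<subseteq> \<pi> ` regular_codes"
  proof
    fix x assume x: "x \<in> regular_part m f V J"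
    then obtain \<omega> where "\<omega> \<in> \<Sigma>" "\<pi> \<omega> = x" using coding_surj by (auto simp: regular_part_def)
    with x show "x \<in> \<pi> ` regular_codes" by (auto simp: regular_part_def regular_codes_def exceptional_codes_def)
  qed
qed (auto simp: regular_part_def regular_codes_def exceptional_codes_def coding_in_J)

text \<open>A point of the image of the closure of \<open>V\<close> that avoids the image of the
frontier lies in the image of \<open>V\<close>. Hence the coded point of a regular code determines the code.\<close>

lemma regular_codes_coding_in_F_V:
  assumes "\<omega> \<in> regular_codes" shows "\<pi> \<omega> \<in> F (pre \<omega> n) ` V"
proof -
  have \<omega>: "\<omega> \<in> \<Sigma>" using assms regular_codes_subset by auto
  obtain y where y: "y \<in> closure V" "\<pi> \<omega> = F (pre \<omega> n) y"
    using coding_in_F_J[OF \<omega>, of n] J_subset_closure_V by auto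
  have "y \<notin> frontier V" using assms y pre_in[OF \<omega>] unfolding regular_codes_iff by blast
  then have "y \<in> V" using y V(1) by (auto simp: frontier_def interior_open)
  then show ?thesis using y by blast
qed

lemma inj_on_coding: "inj_on \<pi> regular_codes"
proof (rule inj_onI)
  fix \<omega> \<omega>' assume regular_codes: "\<omega> \<in> regular_codes" "\<omega>' \<in> regular_codes" and eq: "\<pi> \<omega> = \<pi> \<omega>'"
  have "pre \<omega> n = pre \<omega>' n" for n
  proof (rule ccontr)
    assume "pre \<omega> n \<noteq> pre \<omega>' n"
    then have "\<not> prefix (pre \<omega> n) (pre \<omega>' n)" "\<not> prefix (pre \<omega>' n) (pre \<omega> n)"
      by (auto dest: prefix_same_lengthD)
    then have "F (pre \<omega> n) ` V \<inter> F (pre \<omega>' n) ` V = {}"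
      using regular_codes regular_codes_subset by (intro F_V_disjoint pre_in) auto
    then show False using regular_codes_coding_in_F_V[OF regular_codes(1), of n] regular_codes_coding_in_F_V[OF regular_codes(2), of n] eq by auto
  qed
  then have "\<omega> n = \<omega>' n" for n
    by (metis (no_types, lifting) add_0 lessI length_pre nth_map nth_upt pre_def length_upt diff_zero)
  then show "\<omega> = \<omega>'" by auto
qed

lemma regular_codes_sh: "\<omega> \<in> regular_codes \<Longrightarrow> sh n \<omega> \<in> regular_codes"
proof -
  assume regular_codes: "\<omega> \<in> regular_codes"
  then have \<omega>: "\<omega> \<in> \<Sigma>" using regular_codes_subset by auto
  have False if "set w \<subseteq> {1..m}" "\<pi> (sh n \<omega>) \<in> F w ` frontier V" for w
  proof -
    have "\<pi> \<omega> \<in> F (pre \<omega> n @ w) ` frontier V"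
      using that coding_pre_sh[OF \<omega>, of n] by (simp add: F_append_image)
    moreover have "set (pre \<omega> n @ w) \<subseteq> {1..m}" using that pre_in[OF \<omega>] by simp
    ultimately show False using regular_codes unfolding regular_codes_iff by blast
  qed
  then show ?thesis using \<omega> by (auto simp: regular_codes_iff)
qed

lemma induced_map_coding: "\<omega> \<in> regular_codes \<Longrightarrow> induced_map m f V (\<pi> \<omega>) = \<pi> (sh 1 \<omega>)"
  using inv_into_f_f[OF inj_on_coding] by (simp add: induced_map_def regular_codes_def[symmetric] shift_eq_sh)

lemma induced_map_funpow_coding: "\<omega> \<in> regular_codes \<Longrightarrow> (induced_map m f V ^^ n) (\<pi> \<omega>) = \<pi> (sh n \<omega>)"
  by (induction n) (auto simp: induced_map_coding regular_codes_sh sh_sh)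

definition orbit_sum :: "nat \<Rightarrow> (nat \<Rightarrow> nat) \<Rightarrow> 'a" where
  "orbit_sum n \<omega> = (\<Sum>k<n. \<pi> (sh k \<omega>))"

lemma birkhoff_sum_coding: "\<omega> \<in> regular_codes \<Longrightarrow> birkhoff_sum (induced_map m f V) n (\<pi> \<omega>) = orbit_sum n \<omega>"
  by (simp add: birkhoff_sum_def orbit_sum_def induced_map_funpow_coding)

text \<open>A long initial word of a code of a point of \<open>V \<inter> J\<close> maps the closure of \<open>V\<close> to a small neighbourhood
of that point.\<close>

lemma inner_word_exists:
  obtains u where "set u \<subseteq> {1..m}" "F u ` closure V \<subseteq> V"
proof -
  obtain y where y: "y \<in> V" "y \<in> J" using V(3) by auto
  obtain e where e: "e > 0" "ball y e \<subseteq> V" using V(1) y openE by blast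
  obtain \<omega> where \<omega>: "\<omega> \<in> \<Sigma>" "\<pi> \<omega> = y" using coding_surj y by blast
  obtain D where D: "0 < D" "\<And>x y. x \<in> closure V \<Longrightarrow> y \<in> closure V \<Longrightarrow> dist x y \<le> D"
    using dist_closure_V_bound by blast
  obtain n where n: "r_max ^ n * D < e" using pow_r_max_less[OF e(1)] by blast
  obtain y' where y': "y' \<in> closure V" "y = F (pre \<omega> n) y'"
    using coding_in_F_J[OF \<omega>(1), of n] \<omega>(2) J_subset_closure_V by auto
  have "F (pre \<omega> n) ` closure V \<subseteq> ball y e"
  proof
    fix x assume "x \<in> F (pre \<omega> n) ` closure V"
    then obtain x' where x': "x' \<in> closure V" "x = F (pre \<omega> n) x'" by auto
    have "dist y x = r (pre \<omega> n) * dist y' x'" using x' y' dist_F[OF pre_in[OF \<omega>(1)]] by simp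
    also have "\<dots> \<le> r_max ^ n * D"
      using r_le_power[OF pre_in[OF \<omega>(1)], of n] r_max D x' y' by (intro mult_mono) auto
    finally show "x \<in> ball y e" using n by simp
  qed
  then show ?thesis
    using that[of "pre \<omega> n"] e pre_in[OF \<omega>(1)] by (meson subset_trans)
qed

text \<open>Each shifted code meets \<open>u\<close> again, so its point lies in an image of \<open>F u ` closure V\<close>, hence in the
open set \<open>V\<close>. So the coded point lies in \<open>F (pre \<omega> n) ` V\<close> for every \<open>n\<close>. That set is disjoint from the
image of the frontier under the same word by injectivity, and from the closed images under the other
words of length \<open>n\<close> because it is open.\<close>

lemma regular_if_inner_word_recurs:
  assumes \<omega>: "\<omega> \<in> \<Sigma>" and u: "set u \<subseteq> {1..m}" "F u ` closure V \<subseteq> V"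
    and rec: "\<And>n. \<exists>i\<ge>n. \<exists>w. pre \<omega> i = w @ u \<and> n \<le> length w"
  shows "\<omega> \<in> regular_codes"
proof -
  have inV: "\<pi> (sh n \<omega>) \<in> V" for n
  proof -
    obtain i w where i: "i \<ge> n" "pre \<omega> i = w @ u" "n \<le> length w" using rec by blast
    have "pre (sh n \<omega>) (i - n) = drop n w @ u"
      using drop_pre[OF i(1), of \<omega>] i by simp
    moreover have "\<pi> (sh n \<omega>) \<in> F (pre (sh n \<omega>) (i - n)) ` closure V"
      using coding_in_F_J[OF sh_in[OF \<omega>]] J_subset_closure_V by blast
    ultimately have "\<pi> (sh n \<omega>) \<in> F (drop n w) ` F u ` closure V" by (simp add: F_append_image)
    moreover have "set (drop n w) \<subseteq> {1..m}"
      using pre_in[OF \<omega>, of i] i(2) set_drop_subset[of n w] by auto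
    ultimately show ?thesis using F_V[of "drop n w"] u(2) by blast
  qed
  have False if w: "set w \<subseteq> {1..m}" "\<pi> \<omega> \<in> F w ` frontier V" for w
  proof -
    let ?n = "length w"
    have in1: "\<pi> \<omega> \<in> F (pre \<omega> ?n) ` V" using coding_pre_sh[OF \<omega>, of ?n] inV by blast
    have fr: "frontier V \<inter> V = {}" "frontier V \<subseteq> closure V"
      using V(1) by (auto simp: frontier_def interior_open)
    show False
    proof (cases "w = pre \<omega> ?n")
      case True
      then have "\<pi> (sh ?n \<omega>) \<in> frontier V"
        using w coding_pre_sh[OF \<omega>, of ?n] inj_F[OF w(1)] by (metis inj_image_mem_iff)
      then show False using fr inV by blast
    next
      case False
      then have "\<not> prefix w (pre \<omega> ?n)" "\<not> prefix (pre \<omega> ?n) w"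
        by (auto dest: prefix_same_lengthD)
      then have "F w ` V \<inter> F (pre \<omega> ?n) ` V = {}"
        using w pre_in[OF \<omega>] by (intro F_V_disjoint) auto
      then have "closure (F w ` V) \<inter> F (pre \<omega> ?n) ` V = {}"
        using open_F[OF pre_in[OF \<omega>] V(1), of ?n] by (metis Int_commute open_Int_closure_eq_empty)
      moreover have "\<pi> \<omega> \<in> closure (F w ` V)" using w fr F_closure[OF w(1)] by blast
      ultimately show False using in1 by blast
    qed
  qed
  then show ?thesis using \<omega> by (auto simp: regular_codes_iff)
qed

section \<open>Birkhoff averages along words\<close>

definition p :: 'a where "p = (SOME x. x \<in> J)"

lemma p_in_J: "p \<in> J"
  unfolding p_def using J(2) by (simp add: some_in_eq)

definition D :: real where
  "D = (SOME D. 0 < D \<and> (\<forall>x\<in>J. \<forall>y\<in>J. dist x y \<le> D))"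

lemma D: "0 < D" "x \<in> J \<Longrightarrow> y \<in> J \<Longrightarrow> dist x y \<le> D"
proof -
  have "\<exists>D. 0 < D \<and> (\<forall>x\<in>J. \<forall>y\<in>J. dist x y \<le> D)" using dist_J_bound by metis
  from someI_ex[OF this] show "0 < D" "x \<in> J \<Longrightarrow> y \<in> J \<Longrightarrow> dist x y \<le> D"
    unfolding D_def by auto
qed

text \<open>The geometric series that bounds the total effect of a change of the tail of a code on the Birkhoff
sum over a word. The bound does not depend on the length of the word.\<close>

definition C :: real where "C = D / (1 - r_max)"

lemma C_pos: "0 < C" using D(1) r_max by (simp add: C_def)

text \<open>The Birkhoff sum of the identity along a word, with the unknown tail of the code replaced by the base
point \<open>p\<close>.\<close>

fun word_sum :: "nat list \<Rightarrow> 'a" where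
  "word_sum [] = 0"
| "word_sum (j # z) = F (j # z) p + word_sum z"

text \<open>The partial sums of the geometric series \<open>C\<close> are \<open>C * (1 - r_max ^ n)\<close>; in this form the errors
below can be bounded by induction on the length of the word.\<close>

lemma geometric_error_step:
  assumes "e \<le> C * (1 - r_max ^ n)" "d \<le> r_max ^ Suc n * D"
  shows "e + d \<le> C * (1 - r_max ^ Suc n)"
proof -
  have D_eq: "D = C * (1 - r_max)" using r_max by (simp add: C_def)
  have "r_max ^ Suc n \<le> r_max ^ n" using r_max by (intro power_decreasing) auto
  then have "r_max ^ Suc n * D \<le> r_max ^ n * D" using D(1) by (intro mult_right_mono) auto
  also have "\<dots> = C * (r_max ^ n - r_max ^ Suc n)" by (simp add: D_eq algebra_simps)
  finally have "d \<le> C * (r_max ^ n - r_max ^ Suc n)" using assms(2) by linarith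
  then show ?thesis using assms(1) by (simp add: algebra_simps)
qed

lemma geometric_error_le: "e \<le> C * (1 - r_max ^ n) \<Longrightarrow> e \<le> C"
proof -
  assume "e \<le> C * (1 - r_max ^ n)"
  also have "\<dots> \<le> C * 1" using C_pos r_max by (intro mult_left_mono) auto
  finally show ?thesis by simp
qed

lemma dist_F_J:
  assumes "set z \<subseteq> {1..m}" "x \<in> J" "y \<in> J"
  shows "dist (F z x) (F z y) \<le> r_max ^ length z * D"
proof -
  have "dist (F z x) (F z y) = r z * dist x y" using dist_F assms by simp
  also have "\<dots> \<le> r_max ^ length z * D"
    using assms D r_le_power[of z] r_max by (intro mult_mono) auto
  finally show ?thesis .
qed

lemma F_in_J: "set z \<subseteq> {1..m} \<Longrightarrow> x \<in> J \<Longrightarrow> F z x \<in> J"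
  using F_J by blast

lemma word_sum_append:
  assumes "set z \<subseteq> {1..m}" "set w \<subseteq> {1..m}"
  shows "norm (word_sum (z @ w) - word_sum z - word_sum w) \<le> C"
proof -
  have "norm (word_sum (z @ w) - word_sum z - word_sum w) \<le> C * (1 - r_max ^ length z)"
    using assms(1)
  proof (induction z)
    case (Cons j z)
    have "norm (word_sum ((j # z) @ w) - word_sum (j # z) - word_sum w)
        = norm ((word_sum (z @ w) - word_sum z - word_sum w) + (F (j # z) (F w p) - F (j # z) p))"
      by (simp add: F_append algebra_simps)
    also have "\<dots> \<le> norm (word_sum (z @ w) - word_sum z - word_sum w) + norm (F (j # z) (F w p) - F (j # z) p)"
      by (rule norm_triangle_ineq)
    also have "\<dots> \<le> C * (1 - r_max ^ Suc (length z))"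
    proof (rule geometric_error_step)
      show "norm (word_sum (z @ w) - word_sum z - word_sum w) \<le> C * (1 - r_max ^ length z)"
        using Cons by simp
      show "norm (F (j # z) (F w p) - F (j # z) p) \<le> r_max ^ Suc (length z) * D"
        using dist_F_J[OF Cons.prems F_in_J[OF assms(2) p_in_J] p_in_J] by (simp add: dist_norm)
    qed
    finally show ?case by simp
  qed simp
  then show ?thesis by (rule geometric_error_le)
qed

lemma S_Suc: "orbit_sum (Suc n) \<omega> = \<pi> \<omega> + orbit_sum n (sh 1 \<omega>)"
  unfolding orbit_sum_def by (subst sum.lessThan_Suc_shift) (simp add: sh_sh)

lemma S_add: "orbit_sum (n + k) \<omega> = orbit_sum n \<omega> + orbit_sum k (sh n \<omega>)"
  by (induction n arbitrary: \<omega>) (simp_all add: S_Suc sh_sh, simp add: orbit_sum_def)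

lemma word_sum_pre:
  assumes "\<omega> \<in> \<Sigma>"
  shows "norm (orbit_sum n \<omega> - word_sum (pre \<omega> n)) \<le> C"
proof -
  have "norm (orbit_sum n \<omega> - word_sum (pre \<omega> n)) \<le> C * (1 - r_max ^ n)"
    using assms
  proof (induction n arbitrary: \<omega>)
    case (Suc n)
    have pre: "pre \<omega> (Suc n) = \<omega> 0 # pre (sh 1 \<omega>) n"
      using pre_add[of \<omega> 1 n] by (simp add: pre_def)
    have "norm (orbit_sum (Suc n) \<omega> - word_sum (pre \<omega> (Suc n)))
        = norm ((orbit_sum n (sh 1 \<omega>) - word_sum (pre (sh 1 \<omega>) n)) + (\<pi> \<omega> - F (pre \<omega> (Suc n)) p))"
      by (simp add: S_Suc pre algebra_simps)
    also have "\<dots> \<le> norm (orbit_sum n (sh 1 \<omega>) - word_sum (pre (sh 1 \<omega>) n)) + norm (\<pi> \<omega> - F (pre \<omega> (Suc n)) p)"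
      by (rule norm_triangle_ineq)
    also have "\<dots> \<le> C * (1 - r_max ^ Suc n)"
    proof (rule geometric_error_step)
      show "norm (orbit_sum n (sh 1 \<omega>) - word_sum (pre (sh 1 \<omega>) n)) \<le> C * (1 - r_max ^ n)"
        using Suc by auto
      show "norm (\<pi> \<omega> - F (pre \<omega> (Suc n)) p) \<le> r_max ^ Suc n * D"
        using dist_F_J[OF pre_in coding_in_J p_in_J, OF Suc.prems sh_in[OF Suc.prems], of "Suc n" "Suc n"]
          coding_pre_sh[OF Suc.prems, of "Suc n"] by (simp add: dist_norm)
    qed
    finally show ?case .
  qed (simp add: orbit_sum_def)
  then show ?thesis by (rule geometric_error_le)
qed

definition fp :: "nat \<Rightarrow> 'a" where "fp j = \<pi> (\<lambda>_. j)"

lemma const_in: "j \<in> {1..m} \<Longrightarrow> (\<lambda>_. j) \<in> \<Sigma>"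
  by (simp add: symbol_space_def)

lemma sh_const [simp]: "sh n (\<lambda>_. j) = (\<lambda>_. j)" by (simp add: sh_def)

lemma pre_const: "pre (\<lambda>_. j) n = replicate n j"
  by (simp add: pre_def map_replicate_const)

lemma fp_in_J: "j \<in> {1..m} \<Longrightarrow> fp j \<in> J"
  unfolding fp_def by (intro coding_in_J const_in)

lemma f_fp: "j \<in> {1..m} \<Longrightarrow> f j (fp j) = fp j"
  using coding_pre_sh[OF const_in, of j 1] by (simp add: fp_def pre_const)

lemma f_eq: "j \<in> {1..m} \<Longrightarrow> f j x = (1 - \<rho> j) *\<^sub>R fp j + \<rho> j *\<^sub>R x"
  using f_fp[of j] by (simp add: maps algebra_simps)

lemma word_sum_replicate:
  assumes "j \<in> {1..m}"
  shows "norm (word_sum (replicate n j) - real n *\<^sub>R fp j) \<le> C"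
  using word_sum_pre[OF const_in[OF assms], of n]
  by (simp add: orbit_sum_def pre_const fp_def norm_minus_commute sum_constant_scaleR)

abbreviation \<Delta> :: "'a set" where "\<Delta> \<equiv> convex hull J"

lemma convex_F:
  assumes "set z \<subseteq> {1..m}" "convex X" "fp ` {1..m} \<subseteq> X"
  shows "F z ` X \<subseteq> X"
proof (rule F_image_subset[OF assms(1)])
  fix j assume j: "j \<in> {1..m}"
  then have "fp j \<in> X" using assms(3) by auto
  then show "f j ` X \<subseteq> X"
    using ratio[OF j] convexD[OF assms(2), of "fp j" _ "1 - \<rho> j" "\<rho> j"] by (auto simp: f_eq[OF j])
qed

text \<open>Each map moves a point towards its fixed point along a segment, so it preserves the hull of the fixed
points; images of a fixed point under long words come arbitrarily close to each point of \<open>J\<close>. Hence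
\<open>\<Delta>\<close> is a polytope.\<close>

lemma hull_eq: "\<Delta> = convex hull (fp ` {1..m})"
proof
  show "convex hull (fp ` {1..m}) \<subseteq> \<Delta>" using fp_in_J by (intro hull_mono) auto
  let ?P = "convex hull (fp ` {1..m})"
  have "closed ?P" by (intro compact_imp_closed finite_imp_compact_convex_hull) simp
  have "J \<subseteq> closure ?P"
  proof
    fix x assume x: "x \<in> J"
    show "x \<in> closure ?P"
      unfolding closure_approachable
    proof (intro allI impI)
      fix e :: real assume "0 < e"
      then obtain n where n: "r_max ^ n * D < e" using pow_r_max_less by blast
      obtain z y where z: "z \<in> words n" "y \<in> J" "x = F z y" using J_words_cover[of n] x by blast
      have "dist (F z (fp 1)) x \<le> r_max ^ n * D"
        using z dist_F_J[of z "fp 1" y] fp_in_J[of 1] m_pos by (auto simp: words_def)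
      moreover have "F z (fp 1) \<in> ?P"
        using convex_F[of z ?P] z m_pos hull_subset[of "fp ` {1..m}" convex]
          hull_inc[of "fp 1" "fp ` {1..m}" convex] by (auto simp: words_def)
      ultimately show "\<exists>y\<in>?P. dist y x < e" using n by force
    qed
  qed
  then show "\<Delta> \<subseteq> ?P" using \<open>closed ?P\<close> by (simp add: subset_hull)
qed

lemma compact_hull: "compact \<Delta>"
  using J(1) by (rule compact_convex_hull)

lemma J_subset_hull: "J \<subseteq> \<Delta>" by (rule hull_subset)

lemma word_sum_in_hull:
  assumes "set z \<subseteq> {1..m}"
  shows "\<exists>x\<in>\<Delta>. word_sum z = real (length z) *\<^sub>R x"
  using assms
proof (induction z)
  case Nil
  then show ?case using p_in_J J_subset_hull by auto
next
  case (Cons j z)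
  let ?n = "real (length z)"
  obtain x where x: "x \<in> \<Delta>" "word_sum z = ?n *\<^sub>R x" using Cons by auto
  have y: "F (j # z) p \<in> \<Delta>" using F_in_J[OF Cons.prems p_in_J] J_subset_hull by blast
  have "(1 / (?n + 1)) *\<^sub>R F (j # z) p + (?n / (?n + 1)) *\<^sub>R x \<in> \<Delta>"
    by (intro convexD[OF convex_convex_hull] y x) (auto simp: field_simps)
  moreover have "word_sum (j # z) = real (length (j # z)) *\<^sub>R
      ((1 / (?n + 1)) *\<^sub>R F (j # z) p + (?n / (?n + 1)) *\<^sub>R x)"
    using x by (simp add: scaleR_right_distrib add.commute[of 1])
  ultimately show ?case by blast
qed

lemma S_in_hull:
  assumes "\<omega> \<in> \<Sigma>" "0 < n"
  shows "(1 / real n) *\<^sub>R orbit_sum n \<omega> \<in> \<Delta>"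
proof -
  have "(\<Sum>k<n. (1 / real n) *\<^sub>R \<pi> (sh k \<omega>)) \<in> \<Delta>"
    by (rule convex_sum) (use assms J_subset_hull coding_in_J in auto)
  then show ?thesis by (simp add: orbit_sum_def scaleR_right.sum)
qed

section \<open>Upper bounds for dimensions\<close>

definition near :: "nat \<Rightarrow> 'a \<Rightarrow> real \<Rightarrow> nat list set" where
  "near n \<alpha> e = {z \<in> words n. norm (word_sum z - real n *\<^sub>R \<alpha>) \<le> e * real n}"

lemma finite_near [simp]: "finite (near n \<alpha> e)" by (simp add: near_def)

lemma near_words: "near n \<alpha> e \<subseteq> words n" by (auto simp: near_def)

text \<open>Richness asks for a large weight only at arbitrarily large lengths, since this is all that the
pigeonhole principle gives. Concatenation later turns it into a statement on all large lengths.\<close>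

definition rich :: "'a \<Rightarrow> real \<Rightarrow> bool" where
  "rich \<alpha> s \<longleftrightarrow> (\<forall>e>0. \<forall>N. \<exists>n\<ge>N. 1 \<le> (\<Sum>z\<in>near n \<alpha> e. r z powr s))"

text \<open>At a point that is not rich, some tolerance makes the weight less than 1 from some length on;
compactness makes finitely many of these points suffice.\<close>

lemma finite_cover_not_rich:
  assumes K: "compact K" and not_rich: "\<And>\<alpha>. \<alpha> \<in> K \<Longrightarrow> \<not> rich \<alpha> s"
  obtains T e N where "finite T" "T \<subseteq> K" "\<And>\<alpha>. \<alpha> \<in> T \<Longrightarrow> 0 < e \<alpha>" "K \<subseteq> (\<Union>\<alpha>\<in>T. ball \<alpha> (e \<alpha> / 2))"
    "\<And>\<alpha> n. \<alpha> \<in> T \<Longrightarrow> N \<le> n \<Longrightarrow> (\<Sum>z\<in>near n \<alpha> (e \<alpha>). r z powr s) < 1"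
proof -
  have "\<exists>e N. 0 < e \<and> (\<forall>n\<ge>N. (\<Sum>z\<in>near n \<alpha> e. r z powr s) < 1)" if "\<alpha> \<in> K" for \<alpha>
    using not_rich[OF that] unfolding rich_def by (metis linorder_not_le)
  then obtain e N where e: "\<And>\<alpha>. \<alpha> \<in> K \<Longrightarrow> 0 < e \<alpha>"
    and N: "\<And>\<alpha> n. \<alpha> \<in> K \<Longrightarrow> N \<alpha> \<le> n \<Longrightarrow> (\<Sum>z\<in>near n \<alpha> (e \<alpha>). r z powr s) < 1"
    by metis
  obtain T where T: "T \<subseteq> K" "finite T" "K \<subseteq> (\<Union>\<alpha>\<in>T. ball \<alpha> (e \<alpha> / 2))"
  proof (rule compactE_image[OF K, of K "\<lambda>\<alpha>. ball \<alpha> (e \<alpha> / 2)"])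
    show "K \<subseteq> (\<Union>\<alpha>\<in>K. ball \<alpha> (e \<alpha> / 2))" using e by force
  qed auto
  have "N \<alpha> \<le> Max (insert 0 (N ` T))" if "\<alpha> \<in> T" for \<alpha> by (rule Max_ge) (use that T in auto)
  then show ?thesis
    by (intro that[OF T(2,1) _ T(3), of "Max (insert 0 (N ` T))"]) (use T e N in \<open>meson order_trans subsetD\<close>)+
qed

text \<open>Passing from the exponent \<open>s\<close> to \<open>t\<close> gains a factor \<open>r_max powr ((t - s) * n)\<close> on words of length \<open>n\<close>.\<close>

lemma null_if_small_covers:
  assumes "0 \<le> s" "s < t"
    and A: "\<And>n. N \<le> n \<Longrightarrow> A n \<subseteq> words n"
    and cover: "\<And>n. N \<le> n \<Longrightarrow> G \<subseteq> (\<Union>z\<in>A n. F z ` J)"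
    and sum: "\<And>n. N \<le> n \<Longrightarrow> (\<Sum>z\<in>A n. r z powr s) \<le> B"
  shows "hausdorff_measure t G = 0"
  unfolding hausdorff_measure_eq_0_iff
proof (intro allI impI)
  fix \<delta> :: real assume "0 < \<delta>"
  then obtain N1 where N1: "\<And>n. N1 \<le> n \<Longrightarrow> r_max ^ n * D < \<delta>" using pow_r_max_less by blast
  have "hausdorff_premeasure t \<delta> G \<le> ennreal (D powr t * B * (r_max powr (t - s)) ^ n)"
    if n: "max N N1 \<le> n" for n
  proof -
    have diam: "bounded (F z ` J) \<and> diameter (F z ` J) \<le> D * r z \<and> r z \<le> r_max ^ n"
      if "z \<in> A n" for z
    proof -
      have z: "set z \<subseteq> {1..m}" "length z = n" using A[of n] n that by (auto simp: words_def)
      have "bounded (F z ` J)" using F_J[OF z(1)] compact_imp_bounded[OF J(1)] bounded_subset by blast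
      moreover have "diameter (F z ` J) \<le> D * r z"
      proof (rule diameter_le)
        fix x y assume "x \<in> F z ` J" "y \<in> F z ` J"
        then show "norm (x - y) \<le> D * r z"
          using dist_F[OF z(1)] D(2) r_pos[OF z(1)]
          by (auto simp: dist_norm mult.commute[of D] intro!: mult_left_mono)
      qed (use J in auto)
      ultimately show ?thesis using r_le_power[OF z(1)] z(2) by simp
    qed
    have "finite (A n)" using A[of n] n finite_subset[OF _ finite_words] by auto
    then have "hausdorff_premeasure t \<delta> G \<le> (\<Sum>z\<in>A n. hausdorff_weight t (F z ` J))"
    proof (rule hausdorff_premeasure_finite_cover)
      fix z assume z: "z \<in> A n"
      have "D * r z \<le> D * r_max ^ n" using diam[OF z] D by (intro mult_left_mono) auto
      also have "\<dots> < \<delta>" using N1[of n] n by (simp add: mult.commute)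
      finally show "bounded (F z ` J) \<and> diameter (F z ` J) \<le> \<delta>" using diam[OF z] by auto
    qed (use cover n \<open>0 < \<delta>\<close> in auto)
    also have "\<dots> \<le> (\<Sum>z\<in>A n. ennreal (D powr t * (r_max powr (t - s)) ^ n * r z powr s))"
    proof (rule sum_mono)
      fix z assume z: "z \<in> A n"
      have z': "set z \<subseteq> {1..m}" using A[of n] n z by (auto simp: words_def)
      have "diameter (F z ` J) powr t \<le> (D * r z) powr t"
        using diam[OF z] diameter_ge_0 assms by (intro powr_mono2) auto
      also have "\<dots> = D powr t * (r z powr (t - s) * r z powr s)"
        using D(1) r_pos[OF z'] by (simp add: powr_mult flip: powr_add)
      also have "\<dots> \<le> D powr t * ((r_max ^ n) powr (t - s) * r z powr s)"
        using diam[OF z] r_pos[OF z'] assms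
        by (intro mult_left_mono mult_right_mono powr_mono2) auto
      also have "(r_max ^ n) powr (t - s) = (r_max powr (t - s)) ^ n"
        using r_max by (simp add: powr_power powr_powr mult.commute flip: powr_realpow)
      finally show "hausdorff_weight t (F z ` J) \<le> ennreal (D powr t * (r_max powr (t - s)) ^ n * r z powr s)"
        using assms by (auto simp: hausdorff_weight_def mult_ac intro!: ennreal_leI)
    qed
    also have "\<dots> = ennreal (D powr t * (r_max powr (t - s)) ^ n * (\<Sum>z\<in>A n. r z powr s))"
      by (subst sum_ennreal) (auto simp: sum_distrib_left)
    also have "\<dots> \<le> ennreal (D powr t * (r_max powr (t - s)) ^ n * B)"
      using sum[of n] n by (intro ennreal_leI mult_left_mono) auto
    finally show ?thesis by (simp add: mult_ac)
  qed
  moreover have "(\<lambda>n. ennreal (D powr t * B * (r_max powr (t - s)) ^ n)) \<longlonglongrightarrow> ennreal (D powr t * B * 0)"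
  proof (intro tendsto_ennrealI tendsto_mult_left LIMSEQ_realpow_zero)
    have "r_max powr (t - s) < r_max powr 0" using r_max assms by (intro powr_less_mono') auto
    then show "r_max powr (t - s) < 1" using r_max by simp
  qed (use r_max in simp)
  ultimately have "hausdorff_premeasure t \<delta> G \<le> ennreal (D powr t * B * 0)"
    by (intro LIMSEQ_le_const) (auto intro!: exI[of _ "max N N1"])
  then show "hausdorff_premeasure t \<delta> G = 0" by simp
qed

text \<open>The points whose averages converge into one of the finitely many small balls of
\<open>finite_cover_not_rich\<close> are covered by the cylinders of the words with averages near its centre. The times from which
on the averages stay near their limits are not bounded, which leads to a countable union of null
sets.\<close>

lemma dim_le_if_not_rich:
  assumes "0 \<le> s" "compact K" and not_rich: "\<And>\<alpha>. \<alpha> \<in> K \<Longrightarrow> \<not> rich \<alpha> s"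
    and X: "\<And>x. x \<in> X \<Longrightarrow> \<exists>\<omega>\<in>\<Sigma>. \<exists>\<alpha>\<in>K. \<pi> \<omega> = x \<and> (\<lambda>n. (1 / real n) *\<^sub>R orbit_sum n \<omega>) \<longlonglongrightarrow> \<alpha>"
  shows "hausdorff_dim X \<le> ennreal s"
proof (rule hausdorff_dim_leI[OF assms(1)])
  fix t assume t: "s < t"
  obtain T e N where T: "finite T" "T \<subseteq> K" and e: "\<And>\<alpha>. \<alpha> \<in> T \<Longrightarrow> 0 < e \<alpha>"
    and cover: "K \<subseteq> (\<Union>\<alpha>\<in>T. ball \<alpha> (e \<alpha> / 2))"
    and N: "\<And>\<alpha> n. \<alpha> \<in> T \<Longrightarrow> N \<le> n \<Longrightarrow> (\<Sum>z\<in>near n \<alpha> (e \<alpha>). r z powr s) < 1"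
    by (rule finite_cover_not_rich[OF assms(2) not_rich]) (assumption, rule that)
  define G where "G = (\<lambda>(\<alpha>, M). {x. \<forall>n\<ge>M. x \<in> (\<Union>z\<in>near n \<alpha> (e \<alpha>). F z ` J)})"
  have "X \<subseteq> (\<Union>i\<in>T \<times> (UNIV :: nat set). G i)"
  proof
    fix x assume "x \<in> X"
    then obtain \<omega> \<beta> where \<omega>: "\<omega> \<in> \<Sigma>" "\<beta> \<in> K" "\<pi> \<omega> = x"
      and lim: "(\<lambda>n. (1 / real n) *\<^sub>R orbit_sum n \<omega>) \<longlonglongrightarrow> \<beta>" using X by blast
    then obtain \<alpha> where \<alpha>: "\<alpha> \<in> T" "dist \<alpha> \<beta> < e \<alpha> / 2" using cover by auto
    have e\<alpha>: "0 < e \<alpha>" using \<alpha> e by auto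
    have "(\<lambda>n. C / real n) \<longlonglongrightarrow> 0" by (rule lim_const_over_n)
    then have "\<forall>\<^sub>F n in sequentially. C / real n < e \<alpha> / 4"
      using e\<alpha> by (intro order_tendstoD(2)) auto
    moreover have "\<forall>\<^sub>F n in sequentially. dist ((1 / real n) *\<^sub>R orbit_sum n \<omega>) \<beta> < e \<alpha> / 4"
      using lim e\<alpha> by (intro tendstoD) auto
    ultimately have "\<forall>\<^sub>F n in sequentially. pre \<omega> n \<in> near n \<alpha> (e \<alpha>)"
      using eventually_gt_at_top[of 0]
    proof eventually_elim
      case (elim n)
      have "norm (orbit_sum n \<omega> - real n *\<^sub>R \<beta>) = real n * dist ((1 / real n) *\<^sub>R orbit_sum n \<omega>) \<beta>"
      proof -
        have "orbit_sum n \<omega> - real n *\<^sub>R \<beta> = real n *\<^sub>R ((1 / real n) *\<^sub>R orbit_sum n \<omega> - \<beta>)"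
          using elim by (simp add: scaleR_right_diff_distrib)
        then show ?thesis by (simp add: dist_norm)
      qed
      also have "\<dots> \<le> real n * (e \<alpha> / 4)" using elim by (intro mult_left_mono) auto
      finally have 1: "norm (orbit_sum n \<omega> - real n *\<^sub>R \<beta>) \<le> real n * (e \<alpha> / 4)" .
      have 2: "norm (orbit_sum n \<omega> - word_sum (pre \<omega> n)) \<le> real n * (e \<alpha> / 4)"
        using word_sum_pre[OF \<omega>(1), of n] elim by (simp add: field_simps)
      have "norm (real n *\<^sub>R \<beta> - real n *\<^sub>R \<alpha>) = real n * dist \<alpha> \<beta>"
        by (simp add: dist_norm norm_minus_commute flip: scaleR_right_diff_distrib)
      also have "\<dots> \<le> real n * (e \<alpha> / 2)" using \<alpha> by (intro mult_left_mono) auto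
      finally have 3: "norm (real n *\<^sub>R \<beta> - real n *\<^sub>R \<alpha>) \<le> real n * (e \<alpha> / 2)" .
      have "word_sum (pre \<omega> n) - real n *\<^sub>R \<alpha> = (orbit_sum n \<omega> - real n *\<^sub>R \<beta>) - (orbit_sum n \<omega> - word_sum (pre \<omega> n))
          + (real n *\<^sub>R \<beta> - real n *\<^sub>R \<alpha>)" by simp
      then have "norm (word_sum (pre \<omega> n) - real n *\<^sub>R \<alpha>) \<le> norm (orbit_sum n \<omega> - real n *\<^sub>R \<beta>)
          + norm (orbit_sum n \<omega> - word_sum (pre \<omega> n)) + norm (real n *\<^sub>R \<beta> - real n *\<^sub>R \<alpha>)"
        by (simp only:) (rule order_trans[OF norm_triangle_ineq add_right_mono[OF norm_triangle_ineq4]])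
      then have "norm (word_sum (pre \<omega> n) - real n *\<^sub>R \<alpha>) \<le> e \<alpha> * real n"
        using 1 2 3 by (simp add: algebra_simps)
      then show ?case using pre_words[OF \<omega>(1)] by (simp add: near_def)
    qed
    then obtain M where M: "\<And>n. M \<le> n \<Longrightarrow> pre \<omega> n \<in> near n \<alpha> (e \<alpha>)"
      by (auto simp: eventually_sequentially)
    have "x \<in> (\<Union>z\<in>near n \<alpha> (e \<alpha>). F z ` J)" if "M \<le> n" for n
      using M[OF that] coding_in_F_J[OF \<omega>(1), of n] \<omega>(3) by blast
    then have "x \<in> G (\<alpha>, M)" by (simp add: G_def)
    then show "x \<in> (\<Union>i\<in>T \<times> UNIV. G i)" using \<alpha> by blast
  qed
  moreover have "hausdorff_measure t (\<Union>i\<in>T \<times> (UNIV :: nat set). G i) = 0"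
  proof (rule hausdorff_null_countable_UN)
    show "countable (T \<times> (UNIV :: nat set))" using T by (auto simp: countable_finite)
    fix i assume "i \<in> T \<times> (UNIV :: nat set)"
    then obtain \<alpha> M where i: "i = (\<alpha>, M)" "\<alpha> \<in> T" by auto
    show "hausdorff_measure t (G i) = 0"
    proof (rule null_if_small_covers[OF assms(1) t, of "max M N" "\<lambda>n. near n \<alpha> (e \<alpha>)" _ 1])
      show "\<And>n. max M N \<le> n \<Longrightarrow> G i \<subseteq> (\<Union>z\<in>near n \<alpha> (e \<alpha>). F z ` J)"
        by (auto simp: i G_def)
    qed (use N i near_words in \<open>auto intro: less_imp_le\<close>)
  qed
  ultimately show "hausdorff_measure t X = 0" by (rule hausdorff_null_subset)
qed

text \<open>The weights are multiplicative under concatenation.\<close>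

lemma sum_words: "(\<Sum>z\<in>words n. r z powr s) = (\<Sum>j\<in>{1..m}. \<rho> j powr s) ^ n"
proof (induction n)
  case (Suc n)
  have eq: "words (Suc n) = (\<lambda>(j, z). j # z) ` ({1..m} \<times> words n)"
    by (auto simp: words_def length_Suc_conv image_iff)
  have "(\<Sum>z\<in>words (Suc n). r z powr s) = (\<Sum>(j, z)\<in>{1..m} \<times> words n. r (j # z) powr s)"
    unfolding eq by (subst sum.reindex) (auto simp: inj_on_def case_prod_unfold)
  also have "\<dots> = (\<Sum>(j, z)\<in>{1..m} \<times> words n. \<rho> j powr s * r z powr s)"
    using ratio r_pos by (intro sum.cong) (auto simp: words_def powr_mult)
  also have "\<dots> = (\<Sum>j\<in>{1..m}. \<rho> j powr s) * (\<Sum>z\<in>words n. r z powr s)"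
    by (simp add: sum_product sum.cartesian_product)
  finally show ?case by (simp add: Suc)
qed simp

text \<open>The weights of the words of length \<open>n\<close> sum to \<open>X ^ n\<close>, and \<open>X > 1\<close> because otherwise the covers by
all cylinders would bound the dimension by \<open>s\<close>. Without rich points, the averages of words would
lie in finitely many balls, and the words of length \<open>n\<close> with average in any one of them would have total
weight less than 1 eventually.\<close>

lemma exists_rich_below_dim:
  assumes "0 \<le> s" "ennreal s < hausdorff_dim J"
  shows "\<exists>\<alpha>\<in>\<Delta>. rich \<alpha> s"
proof (rule ccontr)
  assume not_rich: "\<not> (\<exists>\<alpha>\<in>\<Delta>. rich \<alpha> s)"
  define X where "X = (\<Sum>j\<in>{1..m}. \<rho> j powr s)"
  have "X > 1"
  proof (rule ccontr)
    assume "\<not> X > 1"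
    moreover have "0 \<le> X" unfolding X_def by (intro sum_nonneg) auto
    ultimately have "X ^ n \<le> 1" for n by (intro power_le_one) auto
    then have "hausdorff_dim J \<le> ennreal s"
      by (intro hausdorff_dim_leI[OF assms(1)] null_if_small_covers[OF assms(1), of _ 0 words _ 1])
         (use J_words_cover in \<open>auto simp: sum_words X_def\<close>)
    then show False using assms(2) by simp
  qed
  have "\<not> rich \<alpha> s" if "\<alpha> \<in> \<Delta>" for \<alpha> using not_rich that by simp
  then obtain T e N where T: "finite T" "T \<subseteq> \<Delta>" and e: "\<And>\<alpha>. \<alpha> \<in> T \<Longrightarrow> 0 < e \<alpha>"
    and cover: "\<Delta> \<subseteq> (\<Union>\<alpha>\<in>T. ball \<alpha> (e \<alpha> / 2))"
    and N: "\<And>\<alpha> n. \<alpha> \<in> T \<Longrightarrow> N \<le> n \<Longrightarrow> (\<Sum>z\<in>near n \<alpha> (e \<alpha>). r z powr s) < 1"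
    by (rule finite_cover_not_rich[OF compact_hull]) (assumption, rule that)
  obtain k where k: "real (card T) < X ^ k" using real_arch_pow[OF \<open>X > 1\<close>] by blast
  define n where "n = k + N"
  have le: "(\<Sum>z\<in>near n \<alpha> (e \<alpha>). r z powr s) \<le> 1" if "\<alpha> \<in> T" for \<alpha>
    using N[OF that, of n] by (simp add: n_def)
  have "words n \<subseteq> (\<Union>\<alpha>\<in>T. near n \<alpha> (e \<alpha>))"
  proof
    fix z assume z: "z \<in> words n"
    then obtain x where x: "x \<in> \<Delta>" "word_sum z = real n *\<^sub>R x" using word_sum_in_hull[of z] by (auto simp: words_def)
    then obtain \<alpha> where \<alpha>: "\<alpha> \<in> T" "dist \<alpha> x < e \<alpha> / 2" using cover by auto
    have "norm (word_sum z - real n *\<^sub>R \<alpha>) = real n * dist \<alpha> x"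
      by (simp add: x dist_norm norm_minus_commute flip: scaleR_right_diff_distrib)
    also have "\<dots> \<le> real n * e \<alpha>" using \<alpha> e[of \<alpha>] by (intro mult_left_mono) auto
    finally show "z \<in> (\<Union>\<alpha>\<in>T. near n \<alpha> (e \<alpha>))" using z \<alpha> by (auto simp: near_def mult.commute)
  qed
  then have "(\<Sum>z\<in>words n. r z powr s) \<le> (\<Sum>z\<in>(\<Union>\<alpha>\<in>T. near n \<alpha> (e \<alpha>)). r z powr s)"
    using T(1) by (intro sum_mono2) auto
  also have "\<dots> \<le> (\<Sum>\<alpha>\<in>T. \<Sum>z\<in>near n \<alpha> (e \<alpha>). r z powr s)"
    using T(1) by (intro sum_UN_le) auto
  also have "\<dots> \<le> (\<Sum>\<alpha>\<in>T. 1)" using le by (intro sum_mono) auto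
  also have "\<dots> < X ^ k" using k by simp
  also have "\<dots> \<le> X ^ n" using \<open>X > 1\<close> by (intro power_increasing) (auto simp: n_def)
  finally show False by (simp add: sum_words X_def)
qed

section \<open>Prescribing averages by concatenating words\<close>

lemma sum_concat:
  assumes "A \<subseteq> words n" "B \<subseteq> words k"
  shows "(\<Sum>z\<in>(\<lambda>(z, w). z @ w) ` (A \<times> B). r z powr t)
    = (\<Sum>z\<in>A. r z powr t) * (\<Sum>w\<in>B. r w powr t)"
proof -
  have "inj_on (\<lambda>(z, w). z @ w) (A \<times> B)"
    using assms by (auto simp: inj_on_def words_def subset_iff)
  then have "(\<Sum>z\<in>(\<lambda>(z, w). z @ w) ` (A \<times> B). r z powr t) = (\<Sum>(z, w)\<in>A \<times> B. r (z @ w) powr t)"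
    by (subst sum.reindex) (auto simp: case_prod_unfold)
  also have "\<dots> = (\<Sum>(z, w)\<in>A \<times> B. r z powr t * r w powr t)"
    using assms by (intro sum.cong) (auto simp: r_append words_def powr_mult r_pos less_imp_le)
  finally show ?thesis by (simp add: sum_product sum.cartesian_product)
qed

text \<open>Each junction of two words costs an error of \<open>C\<close>, so the relative error of long concatenations is
\<open>e + C / n0\<close>, where the second term is small if \<open>n0\<close> is large.\<close>

lemma concatenated_powers:
  assumes A0: "A0 \<subseteq> near n0 \<alpha> e"
  shows "\<exists>A\<subseteq>words (k * n0). (\<forall>z\<in>A. norm (word_sum z - real (k * n0) *\<^sub>R \<alpha>) \<le> real k * (e * real n0 + C)) \<and>
     (\<Sum>z\<in>A. r z powr t) = (\<Sum>z\<in>A0. r z powr t) ^ k"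
proof (induction k)
  case 0
  show ?case by (rule exI[of _ "{[]}"]) simp
next
  case (Suc k)
  then obtain A where A: "A \<subseteq> words (k * n0)"
      "\<And>z. z \<in> A \<Longrightarrow> norm (word_sum z - real (k * n0) *\<^sub>R \<alpha>) \<le> real k * (e * real n0 + C)"
      "(\<Sum>z\<in>A. r z powr t) = (\<Sum>z\<in>A0. r z powr t) ^ k"
    by metis
  have A0': "A0 \<subseteq> words n0" using A0 near_words by blast
  let ?B = "(\<lambda>(z, w). z @ w) ` (A0 \<times> A)"
  show ?case
  proof (intro exI[of _ ?B] conjI ballI)
    show "?B \<subseteq> words (Suc k * n0)"
      using words_append A0' A(1) by fastforce
    show "(\<Sum>z\<in>?B. r z powr t) = (\<Sum>z\<in>A0. r z powr t) ^ Suc k"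
      by (simp add: sum_concat[OF A0' A(1)] A(3))
    fix x assume "x \<in> ?B"
    then obtain z w where x: "x = z @ w" "z \<in> A0" "w \<in> A" by auto
    have "norm (word_sum z - real n0 *\<^sub>R \<alpha>) \<le> e * real n0" using x A0 by (auto simp: near_def)
    moreover have "norm (word_sum w - real (k * n0) *\<^sub>R \<alpha>) \<le> real k * (e * real n0 + C)" using x A by auto
    moreover have "norm (word_sum x - word_sum z - word_sum w) \<le> C"
      unfolding x by (rule word_sum_append) (use x A0' A in \<open>auto simp: words_def\<close>)
    moreover have "word_sum x - real (Suc k * n0) *\<^sub>R \<alpha> = (word_sum z - real n0 *\<^sub>R \<alpha>) + (word_sum w - real (k * n0) *\<^sub>R \<alpha>)
        + (word_sum x - word_sum z - word_sum w)" by (simp add: algebra_simps)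
    ultimately have "norm (word_sum x - real (Suc k * n0) *\<^sub>R \<alpha>)
        \<le> e * real n0 + real k * (e * real n0 + C) + C"
      by (simp only:) (rule order_trans[OF norm_add3_le add_mono[OF add_mono]])
    then show "norm (word_sum x - real (Suc k * n0) *\<^sub>R \<alpha>) \<le> real (Suc k) * (e * real n0 + C)"
      by (simp add: algebra_simps)
  qed
qed

lemma word_of_fixed_points:
  assumes "finite I" "I \<subseteq> {1..m}"
  shows "\<exists>y\<in>words (sum l I). norm (word_sum y - (\<Sum>j\<in>I. real (l j) *\<^sub>R fp j)) \<le> 2 * C * real (card I)"
  using assms
proof (induction I)
  case empty
  then show ?case by simp
next
  case (insert i I)
  then obtain y where y: "y \<in> words (sum l I)"
    "norm (word_sum y - (\<Sum>j\<in>I. real (l j) *\<^sub>R fp j)) \<le> 2 * C * real (card I)" by auto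
  let ?x = "replicate (l i) i"
  have x: "?x \<in> words (l i)" using insert.prems by (auto simp: words_def)
  have 1: "norm (word_sum ?x - real (l i) *\<^sub>R fp i) \<le> C" using insert.prems by (intro word_sum_replicate) auto
  have 2: "norm (word_sum (?x @ y) - word_sum ?x - word_sum y) \<le> C"
    by (rule word_sum_append) (use x y in \<open>auto simp: words_def\<close>)
  have "word_sum (?x @ y) - (\<Sum>j\<in>insert i I. real (l j) *\<^sub>R fp j) = (word_sum ?x - real (l i) *\<^sub>R fp i)
      + (word_sum y - (\<Sum>j\<in>I. real (l j) *\<^sub>R fp j)) + (word_sum (?x @ y) - word_sum ?x - word_sum y)"
    using insert by simp
  then have "norm (word_sum (?x @ y) - (\<Sum>j\<in>insert i I. real (l j) *\<^sub>R fp j))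
      \<le> norm (word_sum ?x - real (l i) *\<^sub>R fp i) + norm (word_sum y - (\<Sum>j\<in>I. real (l j) *\<^sub>R fp j))
        + norm (word_sum (?x @ y) - word_sum ?x - word_sum y)"
    by (simp only: norm_add3_le)
  also have "\<dots> \<le> 2 * C * real (card (insert i I))" using 1 2 y insert by (simp add: algebra_simps)
  finally show ?case
    using words_append[OF x y(1)] insert by (intro bexI[of _ "?x @ y"]) auto
qed

lemma norm_hull_bound: obtains B where "0 < B" "\<And>x. x \<in> \<Delta> \<Longrightarrow> norm x \<le> B"
  using compact_imp_bounded[OF compact_hull] unfolding bounded_pos by auto

lemma norm_word_sum_le:
  assumes "set z \<subseteq> {1..m}" "\<And>x. x \<in> \<Delta> \<Longrightarrow> norm x \<le> B"
  shows "norm (word_sum z) \<le> real (length z) * B"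
  using word_sum_in_hull[OF assms(1)] assms(2) by (auto intro!: mult_left_mono)

text \<open>Several maps may have the same fixed point, so the coefficients are first chosen on a set of indices
on which \<open>fp\<close> is injective.\<close>

lemma hull_coefficients:
  assumes "\<beta> \<in> \<Delta>"
  obtains q where "\<And>j. 0 \<le> q j" "sum q {1..m} = 1" "\<beta> = (\<Sum>j\<in>{1..m}. q j *\<^sub>R fp j)"
proof -
  obtain I where I: "I \<subseteq> {1..m}" "inj_on fp I" "fp ` {1..m} = fp ` I"
    using subset_image_inj[of "fp ` {1..m}" fp "{1..m}"] by auto
  have "finite I" using I finite_subset by blast
  have "\<beta> \<in> convex hull (fp ` I)" using assms hull_eq I by simp
  then obtain v where v: "\<And>x. x \<in> fp ` I \<Longrightarrow> 0 \<le> v x" "sum v (fp ` I) = 1" "(\<Sum>x\<in>fp ` I. v x *\<^sub>R x) = \<beta>"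
    using \<open>finite I\<close> by (subst (asm) convex_hull_finite) auto
  define q where "q j = (if j \<in> I then v (fp j) else 0)" for j
  show ?thesis
  proof (rule that[of q])
    show "0 \<le> q j" for j using v by (simp add: q_def)
    have "sum q {1..m} = sum q I" using I by (intro sum.mono_neutral_right) (auto simp: q_def)
    also have "\<dots> = 1" using v I(2) by (simp add: sum.reindex q_def)
    finally show "sum q {1..m} = 1" .
    have "(\<Sum>j\<in>{1..m}. q j *\<^sub>R fp j) = (\<Sum>j\<in>I. q j *\<^sub>R fp j)"
      using I by (intro sum.mono_neutral_right) (auto simp: q_def)
    also have "\<dots> = \<beta>" using v I(2) by (simp add: sum.reindex q_def)
    finally show "\<beta> = (\<Sum>j\<in>{1..m}. q j *\<^sub>R fp j)" ..
  qed
qed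

text \<open>The words consist of \<open>k\<close> words of \<open>A0\<close>, a power of each letter, a further power of the letter 1, and \<open>u\<close>.
The number of letters spent on \<open>\<alpha>\<close> and on each fixed point is its coefficient in \<open>\<beta>\<close> times \<open>N\<close> up to
rounding, and the further power of 1 makes up for the rounding. The rounding, that power and \<open>u\<close> have an
effect that is bounded by the constant \<open>K\<close>. The last inequality says that the
words lose at most the factor \<open>r_min powr t\<close> for each letter outside of the words of \<open>A0\<close>.\<close>

lemma mixed_words:
  assumes A0: "A0 \<subseteq> near n0 \<alpha> (e / 4)" and n0: "0 < n0" "4 * C \<le> e * real n0" and e: "0 < e"
    and "\<alpha> \<in> \<Delta>" and q: "0 \<le> q0" "\<And>j. 0 \<le> q j" "q0 + sum q {1..m} = 1"
    and \<beta>: "\<beta> = q0 *\<^sub>R \<alpha> + (\<Sum>j\<in>{1..m}. q j *\<^sub>R fp j)" "\<beta> \<in> \<Delta>"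
    and u: "set u \<subseteq> {1..m}" and t: "0 \<le> t"
  shows "\<exists>K N0. 0 \<le> K \<and> (\<forall>N\<ge>N0. \<exists>k A. k * n0 \<le> N \<and> q0 * real N \<le> real (k * n0) + K \<and>
     A \<subseteq> near N \<beta> e \<and> (\<forall>z\<in>A. suffix u z) \<and>
     (\<Sum>z\<in>A0. r z powr t) ^ k * (r_min ^ (N - k * n0)) powr t \<le> (\<Sum>z\<in>A. r z powr t))"
    (is "\<exists>K N0. 0 \<le> K \<and> (\<forall>N\<ge>N0. ?P K N)")
proof -
  obtain B where B: "0 < B" "\<And>x. x \<in> \<Delta> \<Longrightarrow> norm x \<le> B" using norm_hull_bound by blast
  let ?u = "length u"
  define K where "K = 2 * C * real m + (real n0 + real m) * B + 2 * (real ?u * B) + 3 * C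
      + real n0 * B + real m * B + real n0 + real ?u"
  obtain N1 where N1: "2 * K / e < real N1" using reals_Archimedean2 by blast
  have "0 \<le> K" using B C_pos by (simp add: K_def)
  moreover have "?P K N" if "max ?u N1 \<le> N" for N
  proof -
    have "2 * K / e \<le> real N" using that N1 by linarith
    then have N: "?u \<le> N" "2 * K \<le> e * real N" using that e by (auto simp: field_simps)
    define N' where "N' = N - ?u"
    have N': "real N = real N' + real ?u" "N = N' + ?u" using N(1) by (auto simp: N'_def)
    define k where "k = nat \<lfloor>q0 * real N' / real n0\<rfloor>"
    define l where "l j = nat \<lfloor>q j * real N'\<rfloor>" for j
    have "real k \<le> q0 * real N' / real n0" "q0 * real N' / real n0 \<le> real k + 1"
      using q(1) by (auto simp: k_def le_nat_floor of_nat_nat intro: less_imp_le)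
    then have k: "real (k * n0) \<le> q0 * real N'" "q0 * real N' \<le> real (k * n0) + real n0"
      using n0 by (auto simp: field_simps)
    have l: "real (l j) \<le> q j * real N'" "q j * real N' \<le> real (l j) + 1" for j
      using q(2)[of j] by (auto simp: l_def le_nat_floor of_nat_nat intro: less_imp_le)
    have N'_eq: "real N' = q0 * real N' + (\<Sum>j\<in>{1..m}. q j * real N')"
      using q(3) by (simp flip: sum_distrib_right distrib_right)
    have suml: "real (sum l {1..m}) \<le> (\<Sum>j\<in>{1..m}. q j * real N')"
        "(\<Sum>j\<in>{1..m}. q j * real N') \<le> real (sum l {1..m}) + real m"
    proof -
      show "real (sum l {1..m}) \<le> (\<Sum>j\<in>{1..m}. q j * real N')"
        unfolding of_nat_sum by (intro sum_mono l)
      have "(\<Sum>j\<in>{1..m}. q j * real N') \<le> (\<Sum>j\<in>{1..m}. real (l j) + 1)"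
        by (intro sum_mono l)
      then show "(\<Sum>j\<in>{1..m}. q j * real N') \<le> real (sum l {1..m}) + real m"
        by (simp add: sum.distrib)
    qed
    have "real (k * n0 + sum l {1..m}) \<le> real N'" using k suml N'_eq by simp
    then have le: "k * n0 + sum l {1..m} \<le> N'" by (simp only: of_nat_le_iff)
    define pad where "pad = N' - (k * n0 + sum l {1..m})"
    have pad: "N' = k * n0 + sum l {1..m} + pad" using le by (simp add: pad_def)
    then have pad_le: "real pad \<le> real n0 + real m" using k suml N'_eq by simp
    obtain A where A: "A \<subseteq> words (k * n0)"
      "\<And>z. z \<in> A \<Longrightarrow> norm (word_sum z - real (k * n0) *\<^sub>R \<alpha>) \<le> real k * (e / 4 * real n0 + C)"
      "(\<Sum>z\<in>A. r z powr t) = (\<Sum>z\<in>A0. r z powr t) ^ k"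
      using concatenated_powers[OF A0, of k t] by metis
    obtain y where y: "y \<in> words (sum l {1..m})"
      "norm (word_sum y - (\<Sum>j\<in>{1..m}. real (l j) *\<^sub>R fp j)) \<le> 2 * C * real m"
      using word_of_fixed_points[of "{1..m}" l] by auto
    let ?p = "replicate pad 1"
    have p: "?p \<in> words pad" using m_pos by (auto simp: words_def)
    have sets: "set y \<subseteq> {1..m}" "set ?p \<subseteq> {1..m}" using y p by (auto simp: words_def simp del: set_replicate_conv_if)
    let ?v = "y @ ?p @ u"
    have v: "?v \<in> words (N - k * n0)"
      using words_append[OF y(1) words_append[OF p wordsI[OF u]]] pad N'(2) by (simp add: add.assoc)
    define A' where "A' = (\<lambda>(z, w). z @ w) ` (A \<times> {?v})"
    show "?P K N"
    proof (intro exI[of _ k] exI[of _ A'] conjI ballI subsetI)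
      show kN: "k * n0 \<le> N" using pad N'(2) by simp
      have "q0 \<le> 1" using q(3) sum_nonneg[of "{1..m}" q, OF q(2)] by linarith
      then have "q0 * real ?u \<le> real ?u" using q(1) by (simp add: mult_left_le_one_le)
      then have "q0 * real N \<le> real (k * n0) + real n0 + real ?u"
        using k by (simp add: N' distrib_left)
      moreover have "real n0 + real ?u \<le> K"
      proof -
        have "0 \<le> 2 * C * real m" "0 \<le> (real n0 + real m) * B" "0 \<le> real ?u * B"
            "0 \<le> real n0 * B" "0 \<le> real m * B"
          using B C_pos by auto
        then show ?thesis unfolding K_def using C_pos by linarith
      qed
      ultimately show "q0 * real N \<le> real (k * n0) + K" by linarith
      show "(\<Sum>z\<in>A0. r z powr t) ^ k * (r_min ^ (N - k * n0)) powr t \<le> (\<Sum>z\<in>A'. r z powr t)"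
      proof -
        have "(\<Sum>z\<in>A'. r z powr t) = (\<Sum>z\<in>A0. r z powr t) ^ k * r ?v powr t"
          unfolding A'_def using v by (subst sum_concat[OF A(1), of _ "N - k * n0"]) (auto simp: A(3))
        moreover have "(r_min ^ (N - k * n0)) powr t \<le> r ?v powr t"
          using r_ge_power[of ?v] v r_min(2) t by (intro powr_mono2) (auto simp: words_def)
        ultimately show ?thesis by (simp add: mult_left_mono sum_nonneg)
      qed
      show "suffix u x" if "x \<in> A'" for x using that by (auto simp: A'_def suffix_append)
      fix x assume "x \<in> A'"
      then obtain z where x: "x = z @ ?v" "z \<in> A" by (auto simp: A'_def)
      have "x \<in> words N" using words_append[OF subsetD[OF A(1) x(2)] v] kN x(1) by simp
      have z: "set z \<subseteq> {1..m}" using x A by (auto simp: words_def)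
      define e1 where "e1 = word_sum (z @ y @ ?p @ u) - word_sum z - word_sum (y @ ?p @ u)"
      define e2 where "e2 = word_sum (y @ ?p @ u) - word_sum y - word_sum (?p @ u)"
      define e3 where "e3 = word_sum (?p @ u) - word_sum ?p - word_sum u"
      define e4 where "e4 = word_sum z - real (k * n0) *\<^sub>R \<alpha>"
      define e5 where "e5 = word_sum y - (\<Sum>j\<in>{1..m}. real (l j) *\<^sub>R fp j)"
      define e6 where "e6 = (q0 * real N' - real (k * n0)) *\<^sub>R \<alpha>"
      define e7 where "e7 = (\<Sum>j\<in>{1..m}. (q j * real N' - real (l j)) *\<^sub>R fp j)"
      have e123: "norm e1 \<le> C" "norm e2 \<le> C" "norm e3 \<le> C"
        unfolding e1_def e2_def e3_def
        by (rule word_sum_append; use z sets u in \<open>simp del: set_replicate_conv_if\<close>)+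
      have e4: "norm e4 \<le> e / 2 * real N"
      proof -
        have "norm e4 \<le> real k * (e / 4 * real n0 + C)" using A(2)[OF x(2)] by (simp add: e4_def)
        also have "\<dots> \<le> real k * (e / 2 * real n0)" using n0 by (intro mult_left_mono) auto
        also have "\<dots> = e / 2 * real (k * n0)" by simp
        also have "\<dots> \<le> e / 2 * real N"
          using kN e by (intro mult_left_mono) (auto simp del: of_nat_mult)
        finally show ?thesis .
      qed
      have e5: "norm e5 \<le> 2 * C * real m" using y by (simp add: e5_def)
      have e6: "norm e6 \<le> real n0 * B"
        unfolding e6_def norm_scaleR using k B \<open>\<alpha> \<in> \<Delta>\<close> by (intro mult_mono) auto
      have e7: "norm e7 \<le> real m * B"
      proof -
        have "norm e7 \<le> (\<Sum>j\<in>{1..m}. norm ((q j * real N' - real (l j)) *\<^sub>R fp j))"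
          unfolding e7_def by (rule norm_sum)
        also have "\<dots> \<le> (\<Sum>j\<in>{1..m}. 1 * B)"
        proof (rule sum_mono)
          fix j assume "j \<in> {1..m}"
          then have "norm (fp j) \<le> B" using fp_in_J J_subset_hull B by blast
          then show "norm ((q j * real N' - real (l j)) *\<^sub>R fp j) \<le> 1 * B"
            unfolding norm_scaleR using l[of j] by (intro mult_mono) auto
        qed
        finally show ?thesis by simp
      qed
      have e8: "norm (word_sum ?p) \<le> (real n0 + real m) * B"
        by (rule order_trans[OF norm_word_sum_le[OF sets(2) B(2)]])
           (use B pad_le mult_right_mono[of "real pad" "real n0 + real m" B] in auto)
      have e9: "norm (word_sum u) \<le> real ?u * B" using norm_word_sum_le[OF u, of B] B by simp
      have e10: "norm (real ?u *\<^sub>R \<beta>) \<le> real ?u * B" using B \<beta> by (simp add: mult_left_mono)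
      have "real N *\<^sub>R \<beta> = (q0 * real N') *\<^sub>R \<alpha> + (\<Sum>j\<in>{1..m}. (q j * real N') *\<^sub>R fp j) + real ?u *\<^sub>R \<beta>"
      proof -
        have "real N *\<^sub>R \<beta> = real N' *\<^sub>R \<beta> + real ?u *\<^sub>R \<beta>" by (simp add: N' scaleR_add_left)
        moreover have "real N' *\<^sub>R \<beta> = (q0 * real N') *\<^sub>R \<alpha> + (\<Sum>j\<in>{1..m}. (q j * real N') *\<^sub>R fp j)"
          by (subst \<beta>(1)) (simp add: scaleR_right_distrib scaleR_right.sum mult.commute)
        ultimately show ?thesis by simp
      qed
      also have "(\<Sum>j\<in>{1..m}. (q j * real N') *\<^sub>R fp j) = e7 + (\<Sum>j\<in>{1..m}. real (l j) *\<^sub>R fp j)"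
        unfolding e7_def by (simp add: scaleR_left_diff_distrib sum_subtractf)
      also have "(q0 * real N') *\<^sub>R \<alpha> = e6 + real (k * n0) *\<^sub>R \<alpha>"
        unfolding e6_def by (simp add: scaleR_left_diff_distrib)
      finally have "word_sum x - real N *\<^sub>R \<beta>
          = e1 + e2 + e3 + e4 + e5 - e6 - e7 + word_sum ?p + word_sum u - real ?u *\<^sub>R \<beta>"
        unfolding x e1_def e2_def e3_def e4_def e5_def by (simp add: algebra_simps)
      also have "norm \<dots> \<le> norm e1 + norm e2 + norm e3 + norm e4 + norm e5 + norm e6 + norm e7
          + norm (word_sum ?p) + norm (word_sum u) + norm (real ?u *\<^sub>R \<beta>)"
        by (smt (verit) norm_triangle_ineq norm_triangle_ineq4)
      also have "\<dots> \<le> e / 2 * real N + K"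
        using e123 e4 e5 e6 e7 e8 e9 e10 unfolding K_def by linarith
      also have "\<dots> \<le> e * real N" using N(2) by simp
      finally show "x \<in> near N \<beta> e" using \<open>x \<in> words N\<close> by (simp add: near_def)
    qed
  qed
  ultimately show ?thesis by blast
qed

text \<open>In contrast to \<open>rich\<close>, this concerns all large lengths, so that blocks of prescribed lengths exist,
and the words end in \<open>u\<close>, which makes the concatenated codes regular.\<close>

definition reach :: "nat list \<Rightarrow> 'a \<Rightarrow> real \<Rightarrow> bool" where
  "reach u \<alpha> t \<longleftrightarrow> (\<forall>e>0. \<exists>N. \<forall>n\<ge>N. \<exists>A\<subseteq>near n \<alpha> e. (\<forall>z\<in>A. suffix u z) \<and> 1 \<le> (\<Sum>z\<in>A. r z powr t))"

lemma length_large: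
  assumes "0 < e" obtains N where "\<And>n. N \<le> n \<Longrightarrow> n1 \<le> n \<and> 4 * C \<le> e * real n"
proof -
  obtain N where N: "4 * C / e < real N" using reals_Archimedean2 by blast
  have "4 * C \<le> e * real n" if "max n1 N \<le> n" for n
  proof -
    have "4 * C / e \<le> real n" using N that by linarith
    then show ?thesis using assms by (simp add: field_simps)
  qed
  then show ?thesis using that[of "max n1 N"] by simp
qed

text \<open>At exponent 0 a single word is enough, and powers of letters reach every convex combination of fixed
points.\<close>

lemma reach_0:
  assumes "\<beta> \<in> \<Delta>" "set u \<subseteq> {1..m}"
  shows "reach u \<beta> 0"
  unfolding reach_def
proof (intro allI impI)
  fix e :: real assume e: "0 < e"
  obtain q where q: "\<And>j. 0 \<le> q j" "sum q {1..m} = 1" "\<beta> = (\<Sum>j\<in>{1..m}. q j *\<^sub>R fp j)"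
    using hull_coefficients[OF assms(1)] by metis
  obtain n0 where n0: "0 < n0" "4 * C \<le> e * real n0" using length_large[OF e, of 1] by (metis less_eq_Suc_le One_nat_def order_refl)
  let ?w = "replicate n0 (1::nat)"
  have 1: "1 \<in> {1..m}" using m_pos by simp
  have A: "{?w} \<subseteq> near n0 (fp 1) (e / 4)"
    using word_sum_replicate[OF 1, of n0] 1 n0 by (auto simp: near_def words_def)
  have prems: "fp 1 \<in> \<Delta>" "(0::real) \<le> 0" "0 + sum q {1..m} = 1"
      "\<beta> = 0 *\<^sub>R fp 1 + (\<Sum>j\<in>{1..m}. q j *\<^sub>R fp j)"
    using fp_in_J[OF 1] J_subset_hull q by auto
  have "0 < r ?w" by (rule r_pos) (use 1 in auto)
  then show "\<exists>N. \<forall>n\<ge>N. \<exists>A\<subseteq>near n \<beta> e. (\<forall>z\<in>A. suffix u z) \<and> 1 \<le> (\<Sum>z\<in>A. r z powr 0)"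
    using mixed_words[OF A n0 e prems(1,2) q(1) prems(3,4) assms prems(2)] r_min(2) by simp meson
qed

text \<open>A polytope is the intersection of finitely many half-spaces. Those whose boundary contains \<open>\<alpha>\<close> are
invariant under dilations from \<open>\<alpha>\<close>, and \<open>\<alpha>\<close> is in the interior of the others. For a general convex
body this fails.\<close>

lemma dilation_in_hull:
  assumes "\<alpha> \<in> \<Delta>" "0 \<le> k"
  shows "\<forall>\<^sub>F \<beta> in nhds \<alpha>. \<beta> \<in> \<Delta> \<longrightarrow> \<alpha> + k *\<^sub>R (\<beta> - \<alpha>) \<in> \<Delta>"
proof -
  have "polytope \<Delta>" unfolding hull_eq by (rule polytope_convex_hull) simp
  then have "polyhedron \<Delta>" by (rule polytope_imp_polyhedron)
  then obtain H where H: "finite H" "\<Delta> = \<Inter>H" "\<And>h. h \<in> H \<Longrightarrow> \<exists>b d. b \<noteq> 0 \<and> h = {x. b \<bullet> x \<le> d}"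
    unfolding polyhedron_def by metis
  have "\<forall>\<^sub>F \<beta> in nhds \<alpha>. \<forall>h\<in>H. \<beta> \<in> \<Delta> \<longrightarrow> \<alpha> + k *\<^sub>R (\<beta> - \<alpha>) \<in> h"
  proof (rule eventually_ball_finite[OF H(1)], rule ballI)
    fix h assume h: "h \<in> H"
    then obtain b d where bd: "h = {x. b \<bullet> x \<le> d}" using H(3) by metis
    show "\<forall>\<^sub>F \<beta> in nhds \<alpha>. \<beta> \<in> \<Delta> \<longrightarrow> \<alpha> + k *\<^sub>R (\<beta> - \<alpha>) \<in> h"
    proof (cases "b \<bullet> \<alpha> < d")
      case True
      have "((\<lambda>\<beta>. b \<bullet> (\<alpha> + k *\<^sub>R (\<beta> - \<alpha>))) \<longlongrightarrow> b \<bullet> (\<alpha> + k *\<^sub>R (\<alpha> - \<alpha>))) (nhds \<alpha>)"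
        by (intro tendsto_intros) (auto simp: filterlim_ident)
      then have "\<forall>\<^sub>F \<beta> in nhds \<alpha>. b \<bullet> (\<alpha> + k *\<^sub>R (\<beta> - \<alpha>)) < d"
        using True by (intro order_tendstoD(2)) auto
      then show ?thesis by eventually_elim (simp add: bd)
    next
      case False
      have "b \<bullet> (\<alpha> + k *\<^sub>R (\<beta> - \<alpha>)) \<le> d" if "\<beta> \<in> \<Delta>"  for \<beta>
      proof -
        have "b \<bullet> \<alpha> = d" "b \<bullet> \<beta> \<le> d" using False assms(1) that h H(2) bd by auto
        moreover from this have "k * (b \<bullet> \<beta> - b \<bullet> \<alpha>) \<le> 0" using assms(2) by (simp add: mult_nonneg_nonpos)
        ultimately show ?thesis by (simp add: inner_add_right inner_diff_right)
      qed
      then show ?thesis by (auto simp: bd not_less)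
    qed
  qed
  then show ?thesis by eventually_elim (use H(2) in auto)
qed

text \<open>Write \<open>\<beta> = (1 - \<tau>) \<alpha> + \<tau> \<gamma>\<close> with \<open>\<gamma> \<in> \<Delta>\<close>, which is possible for \<open>\<beta>\<close> close to \<open>\<alpha>\<close> even though \<open>\<tau>\<close>
is fixed. Words near \<open>\<alpha>\<close> gain a factor exponential in the number of their letters when the exponent
drops from \<open>s\<close> to \<open>t\<close>. The remaining proportion \<open>\<tau>\<close> of the letters costs an exponential factor, and
\<open>\<tau>\<close> is chosen so small that the gain prevails.\<close>

lemma reach_near_rich:
  assumes \<alpha>: "rich \<alpha> s" "\<alpha> \<in> \<Delta>" and t: "0 \<le> t" "t < s" and u: "set u \<subseteq> {1..m}"
  shows "\<forall>\<^sub>F \<beta> in nhds \<alpha>. \<beta> \<in> \<Delta> \<longrightarrow> reach u \<beta> t"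
proof -
  define x where "x = - ln r_max"
  define y where "y = - ln r_min"
  have xy: "0 < x" "0 < y" using r_max r_min by (auto simp: x_def y_def)
  define w where "w = (s - t) * x + t * y"
  \<comment> \<open>half of the value at which the gain \<open>(s - t) * x * (1 - \<tau>)\<close> balances the loss \<open>t * y * \<tau>\<close>\<close>
  define \<tau> where "\<tau> = (s - t) * x / (2 * w)"
  have sx: "0 < (s - t) * x" using t xy by simp
  have w: "0 < w" "(s - t) * x \<le> w" using sx t xy by (auto simp: w_def intro!: add_pos_nonneg)
  have \<tau>: "0 < \<tau>" "\<tau> < 1" "\<tau> * w = (s - t) * x / 2"
    using w sx by (auto simp: \<tau>_def)
  have "0 \<le> 1 / \<tau>" using \<tau> by simp
  from dilation_in_hull[OF \<alpha>(2) this] show ?thesis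
  proof eventually_elim
    case (elim \<beta>)
    show ?case
    proof
      assume \<beta>: "\<beta> \<in> \<Delta>"
      define \<gamma> where "\<gamma> = \<alpha> + (1 / \<tau>) *\<^sub>R (\<beta> - \<alpha>)"
      have "\<gamma> \<in> \<Delta>" using elim \<beta> \<tau> by (auto simp: \<gamma>_def)
      then obtain b where b: "\<And>j. 0 \<le> b j" "sum b {1..m} = 1" "\<gamma> = (\<Sum>j\<in>{1..m}. b j *\<^sub>R fp j)"
        using hull_coefficients by metis
      have "\<beta> = (1 - \<tau>) *\<^sub>R \<alpha> + \<tau> *\<^sub>R \<gamma>" using \<tau> by (simp add: \<gamma>_def algebra_simps)
      also have "\<tau> *\<^sub>R \<gamma> = (\<Sum>j\<in>{1..m}. (\<tau> * b j) *\<^sub>R fp j)" by (simp add: b scaleR_right.sum)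
      finally have \<beta>_eq: "\<beta> = (1 - \<tau>) *\<^sub>R \<alpha> + (\<Sum>j\<in>{1..m}. (\<tau> * b j) *\<^sub>R fp j)" .
      have sum1: "(1 - \<tau>) + (\<Sum>j\<in>{1..m}. \<tau> * b j) = 1" using b by (simp flip: sum_distrib_left)
      show "reach u \<beta> t"
        unfolding reach_def
      proof (intro allI impI)
        fix e :: real assume e: "0 < e"
        obtain n1 where n1: "\<And>n. n1 \<le> n \<Longrightarrow> 1 \<le> n \<and> 4 * C \<le> e * real n"
          using length_large[OF e, of 1] by blast
        obtain n0 where n0: "n1 \<le> n0" "1 \<le> (\<Sum>z\<in>near n0 \<alpha> (e / 4). r z powr s)"
          using \<alpha>(1) e unfolding rich_def by (meson divide_pos_pos zero_less_numeral)
        have n0': "0 < n0" "4 * C \<le> e * real n0" using n1[OF n0(1)] by auto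
        let ?A = "near n0 \<alpha> (e / 4)"
        let ?X = "\<Sum>z\<in>?A. r z powr t"
        have X: "exp (x * (s - t) * real n0) \<le> ?X"
        proof -
          have "exp (x * (s - t) * real n0) * 1 \<le> exp (x * (s - t) * real n0) * (\<Sum>z\<in>?A. r z powr s)"
            using n0 by (intro mult_left_mono) auto
          also have "\<dots> = (\<Sum>z\<in>?A. exp (x * (s - t) * real n0) * r z powr s)" by (rule sum_distrib_left)
          also have "\<dots> \<le> ?X"
          proof (rule sum_mono)
            fix z assume "z \<in> ?A"
            then have z: "set z \<subseteq> {1..m}" "length z = n0" by (auto simp: near_def words_def)
            have "ln (r z) \<le> ln (r_max ^ n0)"
              using r_le_power[OF z(1)] r_pos[OF z(1)] z(2) by simp
            also have "\<dots> = - (x * real n0)" using r_max by (simp add: ln_realpow x_def)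
            finally have "(s - t) * ln (r z) \<le> (s - t) * (- (x * real n0))"
              using t by (intro mult_left_mono) auto
            then have "x * (s - t) * real n0 + s * ln (r z) \<le> t * ln (r z)" by (simp add: algebra_simps)
            then show "exp (x * (s - t) * real n0) * r z powr s \<le> r z powr t"
              using r_pos[OF z(1)] by (simp add: powr_def flip: exp_add)
          qed
          finally show ?thesis by simp
        qed
        have prems: "0 \<le> 1 - \<tau>" "\<And>j. 0 \<le> \<tau> * b j" using \<tau> b by auto
        obtain K N0 where K: "0 \<le> K" and N0: "\<And>N. N0 \<le> N \<Longrightarrow> \<exists>k A. k * n0 \<le> N \<and>
           (1 - \<tau>) * real N \<le> real (k * n0) + K \<and> A \<subseteq> near N \<beta> e \<and> (\<forall>z\<in>A. suffix u z) \<and>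
           ?X ^ k * (r_min ^ (N - k * n0)) powr t \<le> (\<Sum>z\<in>A. r z powr t)"
          using mixed_words[OF subset_refl n0' e \<alpha>(2) prems sum1 \<beta>_eq \<beta> u t(1)] by blast
        obtain N1 where N1: "K / \<tau> < real N1" using reals_Archimedean2 by blast
        show "\<exists>N. \<forall>n\<ge>N. \<exists>A\<subseteq>near n \<beta> e. (\<forall>z\<in>A. suffix u z) \<and> 1 \<le> (\<Sum>z\<in>A. r z powr t)"
        proof (intro exI[of _ "max N0 N1"] allI impI)
          fix n assume n: "max N0 N1 \<le> n"
          then obtain k B where B: "k * n0 \<le> n" "(1 - \<tau>) * real n \<le> real (k * n0) + K"
            "B \<subseteq> near n \<beta> e" "\<And>z. z \<in> B \<Longrightarrow> suffix u z"
            "?X ^ k * (r_min ^ (n - k * n0)) powr t \<le> (\<Sum>z\<in>B. r z powr t)"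
            using N0[of n] by auto
          have nK: "K / \<tau> \<le> real n" using N1 n by linarith
          have "1 \<le> (\<Sum>z\<in>B. r z powr t)"
          proof -
            let ?k = "real (k * n0)"
            have "K \<le> \<tau> * real n" using nK \<tau> by (simp add: field_simps)
            then have "K * w \<le> (\<tau> * w) * real n" using mult_right_mono[of K "\<tau> * real n" w] w by (simp add: mult_ac)
            moreover have "((1 - \<tau>) * real n - K) * w \<le> ?k * w" using B(2) w by (intro mult_right_mono) auto
            moreover have "((1 - \<tau>) * real n - K) * w = w * real n - (\<tau> * w) * real n - K * w"
              by (simp add: algebra_simps)
            moreover have "2 * ((\<tau> * w) * real n) = (s - t) * x * real n" by (simp add: \<tau>(3))
            moreover have "w * real n = (s - t) * x * real n + t * y * real n" by (simp add: w_def distrib_right)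
            ultimately have "0 \<le> ?k * w - t * y * real n"
              by linarith
            then have nonneg: "0 \<le> x * (s - t) * ?k - t * (y * (real n - ?k))"
              by (simp add: w_def algebra_simps)
            have "exp (x * (s - t) * ?k - t * (y * (real n - ?k)))
                = exp (x * (s - t) * real n0) ^ k * exp (- (t * (y * (real n - ?k))))"
              by (simp add: exp_diff exp_minus divide_inverse mult_ac flip: exp_of_nat_mult)
            also have "exp (- (t * (y * (real n - ?k)))) = (r_min ^ (n - k * n0)) powr t"
            proof -
              have "ln (r_min ^ (n - k * n0)) = - (y * (real n - ?k))"
                using r_min B(1) by (simp add: ln_realpow y_def of_nat_diff)
              then show ?thesis using r_min by (simp add: powr_def)
            qed
            also have "exp (x * (s - t) * real n0) ^ k * (r_min ^ (n - k * n0)) powr t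
                \<le> ?X ^ k * (r_min ^ (n - k * n0)) powr t"
              using X by (intro mult_right_mono power_mono) auto
            finally show ?thesis using B(5) nonneg by (smt (verit) one_le_exp_iff)
          qed
          then show "\<exists>A\<subseteq>near n \<beta> e. (\<forall>z\<in>A. suffix u z) \<and> 1 \<le> (\<Sum>z\<in>A. r z powr t)"
            using B(3,4) by blast
        qed
      qed
    qed
  qed
qed

text \<open>Words that are good for one target serve nearby targets with a slightly larger tolerance, so
compactness makes the threshold for the length uniform in the target.\<close>

lemma reach_uniform:
  assumes K: "compact K" and reach: "\<And>\<alpha>. \<alpha> \<in> K \<Longrightarrow> reach u \<alpha> t"
  obtains e N where "e \<longlonglongrightarrow> (0::real)"
    "\<And>n \<alpha>. N \<le> n \<Longrightarrow> \<alpha> \<in> K \<Longrightarrow> \<exists>A\<subseteq>near n \<alpha> (e n). (\<forall>z\<in>A. suffix u z) \<and> 1 \<le> (\<Sum>z\<in>A. r z powr t)"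
proof -
  define good where "good n e \<alpha> \<longleftrightarrow> (\<exists>A\<subseteq>near n \<alpha> e. (\<forall>z\<in>A. suffix u z) \<and> 1 \<le> (\<Sum>z\<in>A. r z powr t))"
    for n e \<alpha>
  have near_mono: "near n \<alpha> x \<subseteq> near n \<beta> y" if "x + dist \<alpha> \<beta> \<le> y" for n \<alpha> \<beta> x y
  proof
    fix z assume z: "z \<in> near n \<alpha> x"
    have "norm (word_sum z - real n *\<^sub>R \<beta>) \<le> norm (word_sum z - real n *\<^sub>R \<alpha>) + norm (real n *\<^sub>R \<alpha> - real n *\<^sub>R \<beta>)"
      using norm_triangle_ineq[of "word_sum z - real n *\<^sub>R \<alpha>" "real n *\<^sub>R \<alpha> - real n *\<^sub>R \<beta>"] by simp
    also have "norm (real n *\<^sub>R \<alpha> - real n *\<^sub>R \<beta>) = dist \<alpha> \<beta> * real n"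
      by (simp add: dist_norm mult.commute flip: scaleR_right_diff_distrib)
    also have "norm (word_sum z - real n *\<^sub>R \<alpha>) + dist \<alpha> \<beta> * real n \<le> (x + dist \<alpha> \<beta>) * real n"
      using z by (simp add: near_def distrib_right)
    also have "\<dots> \<le> y * real n" using that by (intro mult_right_mono) auto
    finally show "z \<in> near n \<beta> y" using z by (simp add: near_def)
  qed
  have good_mono: "good n y \<beta>" if "good n x \<alpha>" "x + dist \<alpha> \<beta> \<le> y" for n \<alpha> \<beta> x y
    using that near_mono[OF that(2)] unfolding good_def by (meson order_trans)
  obtain e N where e: "e \<longlonglongrightarrow> 0" "\<And>n. N \<le> n \<Longrightarrow> \<forall>\<alpha>\<in>K. good n (e n) \<alpha>"
  proof (rule diagonal_tolerance[of "\<lambda>n e. \<forall>\<alpha>\<in>K. good n e \<alpha>"])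
    show "\<forall>\<alpha>\<in>K. good n y \<alpha>" if "\<forall>\<alpha>\<in>K. good n x \<alpha>" "x \<le> y" for n x y
      using that by (metis add.right_neutral dist_self good_mono)
    fix x :: real assume x: "0 < x"
    have "\<exists>N. \<forall>n\<ge>N. good n (x / 2) \<alpha>" if "\<alpha> \<in> K" for \<alpha>
      using reach[OF that] x unfolding reach_def good_def by (meson half_gt_zero)
    then obtain N where N: "\<And>\<alpha> n. \<alpha> \<in> K \<Longrightarrow> N \<alpha> \<le> n \<Longrightarrow> good n (x / 2) \<alpha>" by metis
    obtain T where T: "T \<subseteq> K" "finite T" "K \<subseteq> (\<Union>\<alpha>\<in>T. ball \<alpha> (x / 2))"
    proof (rule compactE_image[OF K, of K "\<lambda>\<alpha>. ball \<alpha> (x / 2)"])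
      show "K \<subseteq> (\<Union>\<alpha>\<in>K. ball \<alpha> (x / 2))" using x by force
    qed auto
    show "\<exists>N. \<forall>n\<ge>N. \<forall>\<alpha>\<in>K. good n x \<alpha>"
    proof (intro exI[of _ "Max (insert 0 (N ` T))"] allI impI ballI)
      fix n \<beta> assume n: "Max (insert 0 (N ` T)) \<le> n" and "\<beta> \<in> K"
      then obtain \<alpha> where \<alpha>: "\<alpha> \<in> T" "dist \<alpha> \<beta> < x / 2" using T by auto
      have "N \<alpha> \<le> n" by (rule order_trans[OF Max_ge n]) (use \<alpha> T in auto)
      then have "good n (x / 2) \<alpha>" using \<alpha> T by (intro N) auto
      then show "good n x \<beta>" by (rule good_mono) (use \<alpha> in simp)
    qed
  qed blast
  then show ?thesis using that unfolding good_def by blast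
qed

section \<open>Mass distributions on words\<close>

text \<open>The words at which a descent in the tree of words first meets the scale \<open>s\<close>, as far as their cylinders
come close to \<open>x\<close>.\<close>

definition stopping_words :: "real \<Rightarrow> 'a \<Rightarrow> nat list set" where
  "stopping_words s x = {z. set z \<subseteq> {1..m} \<and> z \<noteq> [] \<and> r z \<le> s \<and> s < r (butlast z) \<and>
     F z ` J \<inter> ball x (2 * s) \<noteq> {}}"

text \<open>The images of a ball in \<open>V\<close> under stopping words are disjoint and contain balls of radius comparable
to \<open>s\<close>, all of them within a distance comparable to \<open>s\<close> from \<open>x\<close>. So volume bounds their number
independently of \<open>s\<close> and \<open>x\<close>.\<close>

lemma stopping_words_bounded:
  obtains N where "\<And>s x. 0 < s \<Longrightarrow> finite (stopping_words s x) \<and> card (stopping_words s x) \<le> N"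
proof -
  obtain D where D: "0 < D" "\<And>x y. x \<in> closure V \<Longrightarrow> y \<in> closure V \<Longrightarrow> dist x y \<le> D"
    using dist_closure_V_bound by blast
  obtain x0 where x0: "x0 \<in> V" using V(2) by blast
  then obtain b where b: "0 < b" "ball x0 b \<subseteq> V" using V(1) openE by blast
  define c where "c = b * r_min"
  have c: "0 < c" using b r_min by (simp add: c_def)
  define R0 where "R0 = 2 + D + c"
  have R0: "0 < R0" using D c by (simp add: R0_def)
  define N where "N = nat \<lceil>(R0 / c) ^ DIM('a)\<rceil>"
  show ?thesis
  proof (rule that[of N])
    fix s :: real and x :: 'a assume s: "0 < s"
    show "finite (stopping_words s x) \<and> card (stopping_words s x) \<le> N"
    proof (rule finite_if_finite_subsets_card_bdd)
      fix T assume T: "T \<subseteq> stopping_words s x" "finite T"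
      define A where "A z = ball (F z x0) (c * s)" for z
      have small: "c * s \<le> b * r z" and words: "set z \<subseteq> {1..m}" if z: "z \<in> T" for z
      proof -
        have z': "set z \<subseteq> {1..m}" "z \<noteq> []" "s < r (butlast z)"
          using T z by (auto simp: stopping_words_def)
        then show "set z \<subseteq> {1..m}" by simp
        have "z = butlast z @ [last z]" "last z \<in> {1..m}" using z' last_in_set by force+
        then have "r z = r (butlast z) * \<rho> (last z)" "r_min \<le> \<rho> (last z)"
          using r_append[of "butlast z" "[last z]"] r_min(1) by auto
        then have "s * r_min \<le> r z" using z' s r_min(2) by (auto intro!: mult_mono)
        then show "c * s \<le> b * r z" using b by (simp add: c_def mult_ac)
      qed
      have A_sub: "A z \<subseteq> F z ` V" if z: "z \<in> T" for z
      proof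
        fix y assume y: "y \<in> A z"
        have rz: "0 < r z" using words[OF z] r_pos by simp
        define v where "v = (1 / r z) *\<^sub>R (y - F z 0)"
        have Fv: "F z v = y" using rz by (subst F_affine[OF words[OF z]]) (simp add: v_def)
        have "r z * dist x0 v < b * r z"
          using y small[OF z] dist_F[OF words[OF z], of x0 v] Fv by (simp add: A_def)
        then have "v \<in> ball x0 b" using rz by (simp add: mult.commute)
        then show "y \<in> F z ` V" using b Fv by blast
      qed
      have disj: "disjoint_family_on A T"
        unfolding disjoint_family_on_def
      proof (intro ballI impI)
        have not_prefix: "\<not> prefix z w" if "z \<in> T" "w \<in> T" "z \<noteq> w" for z w
        proof
          assume "prefix z w"
          then have "prefix z (butlast w)"
            using that(3) by (cases w rule: rev_cases) auto
          then obtain v where v: "butlast w = z @ v" by (auto simp: prefix_def)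
          have zw: "set z \<subseteq> {1..m}" "r z \<le> s" "s < r (butlast w)" "set (butlast w) \<subseteq> {1..m}"
            using T that words[OF that(2)] by (auto simp: stopping_words_def dest: in_set_butlastD)
          have "set v \<subseteq> {1..m}" using zw(4) unfolding v by simp
          then have "r (butlast w) \<le> r z * 1"
            unfolding v r_append using r_pos[OF zw(1)] r_le_1[of v] by (intro mult_left_mono) auto
          then show False using zw by simp
        qed
        fix z w assume zw: "z \<in> T" "w \<in> T" "z \<noteq> w"
        have "F z ` V \<inter> F w ` V = {}"
          by (rule F_V_disjoint[OF words[OF zw(1)] words[OF zw(2)] not_prefix[OF zw]
                not_prefix[OF zw(2,1) zw(3)[symmetric]]])
        then show "A z \<inter> A w = {}"
          using Int_mono[OF A_sub[OF zw(1)] A_sub[OF zw(2)]] by simp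
      qed
      have "(\<Union>z\<in>T. A z) \<subseteq> ball x (R0 * s)"
      proof
        fix y assume "y \<in> (\<Union>z\<in>T. A z)"
        then obtain z where z: "z \<in> T" "dist (F z x0) y < c * s" by (auto simp: A_def)
        then obtain y' where y': "y' \<in> J" "dist x (F z y') < 2 * s" "r z \<le> s"
          using T unfolding stopping_words_def by force
        have "dist (F z y') (F z x0) = r z * dist y' x0" by (rule dist_F[OF words[OF z(1)]])
        also have "\<dots> \<le> s * D"
          using y' D J_subset_closure_V x0 closure_subset[of V] s by (intro mult_mono) auto
        finally have "dist x y < 2 * s + s * D + c * s"
          using y' z dist_triangle[of x y "F z y'"] dist_triangle[of "F z y'" y "F z x0"] by linarith
        then show "y \<in> ball x (R0 * s)" by (simp add: R0_def algebra_simps)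
      qed
      then have "measure lborel (\<Union>z\<in>T. A z) \<le> measure lborel (ball x (R0 * s))"
      proof (rule measure_mono_fmeasurable)
        show "ball x (R0 * s) \<in> fmeasurable lborel"
          by (rule fmeasurableI) (use emeasure_bounded_finite[OF bounded_ball] in auto)
      qed (use T in \<open>auto simp: A_def\<close>)
      also have "measure lborel (\<Union>z\<in>T. A z) = (\<Sum>z\<in>T. measure lborel (A z))"
      proof (rule measure_finite_Union[OF T(2) _ disj])
        show "emeasure lborel (A z) \<noteq> \<infinity>" for z
          unfolding A_def using emeasure_bounded_finite[OF bounded_ball] by (metis less_irrefl infinity_ennreal_def)
      qed (auto simp: A_def)
      also have "\<dots> = real (card T) * (unit_ball_vol (real DIM('a)) * (c * s) ^ DIM('a))"
        using c s by (simp add: A_def content_ball)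
      also have "measure lborel (ball x (R0 * s)) = unit_ball_vol (real DIM('a)) * (R0 * s) ^ DIM('a)"
        using R0 s by (simp add: content_ball)
      finally have "unit_ball_vol (real DIM('a)) * s ^ DIM('a) * (real (card T) * c ^ DIM('a))
          \<le> unit_ball_vol (real DIM('a)) * s ^ DIM('a) * R0 ^ DIM('a)"
        by (simp add: power_mult_distrib mult_ac)
      then have "real (card T) * c ^ DIM('a) \<le> R0 ^ DIM('a)"
        using s by (subst (asm) mult_le_cancel_left_pos) auto
      then have "real (card T) \<le> (R0 / c) ^ DIM('a)"
        using c by (simp add: power_divide field_simps)
      then show "card T \<le> N" unfolding N_def by linarith
    qed
  qed
qed

definition extensions :: "nat list \<Rightarrow> nat \<Rightarrow> nat list set" where
  "extensions z n = {x \<in> words n. prefix z x}"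

lemma finite_extensions [simp]: "finite (extensions z n)"
  by (simp add: extensions_def)

lemma F_extension: "prefix z x \<Longrightarrow> set x \<subseteq> {1..m} \<Longrightarrow> F x ` J \<subseteq> F z ` J"
proof -
  assume "prefix z x" "set x \<subseteq> {1..m}"
  then obtain v where "x = z @ v" "set v \<subseteq> {1..m}" by (auto simp: prefix_def)
  then show "F x ` J \<subseteq> F z ` J" using F_J[of v] by (auto simp: F_append)
qed

lemma r_extension: "prefix z x \<Longrightarrow> set x \<subseteq> {1..m} \<Longrightarrow> r x \<le> r z"
  using r_le_1 r_pos by (auto simp: prefix_def r_append mult_right_le_one_le less_imp_le)

end

text \<open>Mass is specified only on the words of the lengths \<open>L 0 < L 1 < \<dots>\<close>, that is, at the ends of blocks,
where it can be written down explicitly.\<close>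

locale mass_distribution = homothetic_ifs +
  fixes L :: "nat \<Rightarrow> nat" and M :: "nat \<Rightarrow> nat list \<Rightarrow> real"
  assumes L_0: "L 0 = 0" and L_mono: "strict_mono L"
    and M_0: "M 0 [] = 1" and M_nonneg: "\<And>k z. 0 \<le> M k z"
    and M_split: "\<And>k z. z \<in> words (L k) \<Longrightarrow> (\<Sum>v\<in>words (L (Suc k) - L k). M (Suc k) (z @ v)) = M k z"
begin

definition support :: "(nat \<Rightarrow> nat) set" where
  "support = {\<omega> \<in> \<Sigma>. \<forall>k. 0 < M k (pre \<omega> (L k))}"

lemma L_le: "k \<le> K \<Longrightarrow> L k \<le> L K"
  using L_mono by (simp add: strict_mono_less_eq)

lemma L_ge: "k \<le> L k"
  using L_mono by (rule strict_mono_imp_increasing)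

lemma mass_extensions:
  assumes "z \<in> words (L k)" "k \<le> K"
  shows "(\<Sum>x\<in>extensions z (L K). M K x) = M k z"
  using assms(2)
proof (induction K rule: dec_induct)
  case base
  have "extensions z (L k) = {z}"
    using assms(1) by (auto simp: extensions_def words_def dest: prefix_same_lengthD)
  then show ?case by simp
next
  case (step K)
  let ?W = "words (L (Suc K) - L K)"
  have le: "L k \<le> L K" "L K \<le> L (Suc K)" using L_le step by auto
  have "extensions z (L (Suc K)) = (\<lambda>(x, v). x @ v) ` (extensions z (L K) \<times> ?W)"
  proof
    show "extensions z (L (Suc K)) \<subseteq> (\<lambda>(x, v). x @ v) ` (extensions z (L K) \<times> ?W)"
    proof
      fix y assume y: "y \<in> extensions z (L (Suc K))"
      have "take (L K) y \<in> extensions z (L K)"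
        using y le assms(1) by (auto simp: extensions_def words_def prefix_def dest: in_set_takeD)
      moreover have "drop (L K) y \<in> ?W"
        using y by (auto simp: extensions_def words_def dest: in_set_dropD)
      ultimately show "y \<in> (\<lambda>(x, v). x @ v) ` (extensions z (L K) \<times> ?W)"
        by (intro image_eqI[of _ _ "(take (L K) y, drop (L K) y)"]) auto
    qed
    show "(\<lambda>(x, v). x @ v) ` (extensions z (L K) \<times> ?W) \<subseteq> extensions z (L (Suc K))"
      using le words_append[of _ "L K" _ "L (Suc K) - L K"] by (auto simp: extensions_def)
  qed
  moreover have "inj_on (\<lambda>(x, v). x @ v) (extensions z (L K) \<times> ?W)"
    by (auto simp: inj_on_def extensions_def words_def)
  ultimately have "(\<Sum>x\<in>extensions z (L (Suc K)). M (Suc K) x)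
      = (\<Sum>(x, v)\<in>extensions z (L K) \<times> ?W. M (Suc K) (x @ v))"
    by (simp add: sum.reindex case_prod_unfold)
  also have "\<dots> = (\<Sum>x\<in>extensions z (L K). \<Sum>v\<in>?W. M (Suc K) (x @ v))"
    by (simp add: sum.cartesian_product)
  also have "\<dots> = (\<Sum>x\<in>extensions z (L K). M K x)"
    by (intro sum.cong) (auto simp: extensions_def M_split)
  finally show ?case using step by simp
qed

lemma mass_le_mass_take:
  assumes "x \<in> words (L K)" "k \<le> K"
  shows "M K x \<le> M k (take (L k) x)"
proof -
  have t: "take (L k) x \<in> words (L k)"
    using assms L_le[OF assms(2)] by (auto simp: words_def dest: in_set_takeD)
  have "M K x = (\<Sum>y\<in>{x}. M K y)" by simp
  also have "\<dots> \<le> (\<Sum>y\<in>extensions (take (L k) x) (L K). M K y)"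
    using assms M_nonneg by (intro sum_mono2) (auto simp: extensions_def take_is_prefix)
  finally show ?thesis using mass_extensions[OF t assms(2)] by simp
qed

text \<open>Koenig's lemma for the tree of words of positive mass: a property that is inherited by extensions and
that every branch acquires is acquired by all branches at a common level. It replaces the
compactness of the coded set.\<close>

lemma uniform_bar:
  assumes mono: "\<And>z x. prefix z x \<Longrightarrow> set x \<subseteq> {1..m} \<Longrightarrow> Q z \<Longrightarrow> Q x"
    and bar: "\<And>\<omega>. \<omega> \<in> support \<Longrightarrow> \<exists>k. Q (pre \<omega> (L k))"
  obtains K where "\<And>x. x \<in> words (L K) \<Longrightarrow> 0 < M K x \<Longrightarrow> Q x"
proof (rule ccontr)
  assume "\<not> thesis"
  then have no: "\<exists>x\<in>words (L K). 0 < M K x \<and> \<not> Q x" for K using that by blast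
  define bad where "bad k z \<longleftrightarrow> z \<in> words (L k) \<and> (\<forall>K\<ge>k. \<exists>x\<in>extensions z (L K). 0 < M K x \<and> \<not> Q x)"
    for k z
  have "\<exists>z. bad 0 z" using no by (intro exI[of _ "[]"]) (auto simp: bad_def L_0 extensions_def)
  moreover have "\<exists>z'. bad (Suc k) z' \<and> prefix z z'" if bad: "bad k z" for k z
  proof (rule ccontr)
    assume no_child: "\<not> (\<exists>z'. bad (Suc k) z' \<and> prefix z z')"
    let ?E = "extensions z (L (Suc k))"
    have "\<exists>K\<ge>Suc k. \<forall>x\<in>extensions z' (L K). 0 < M K x \<longrightarrow> Q x" if "z' \<in> ?E" for z'
      using no_child that unfolding bad_def extensions_def by blast
    then obtain g where g: "\<And>z'. z' \<in> ?E \<Longrightarrow> Suc k \<le> g z'"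
      "\<And>z' x. z' \<in> ?E \<Longrightarrow> x \<in> extensions z' (L (g z')) \<Longrightarrow> 0 < M (g z') x \<Longrightarrow> Q x"
      by metis
    define K where "K = Max (insert (Suc k) (g ` ?E))"
    have K: "Suc k \<le> K" unfolding K_def by (rule Max_ge) auto
    have gK: "g z' \<le> K" if "z' \<in> ?E" for z' unfolding K_def by (rule Max_ge) (use that in auto)
    obtain x where x: "x \<in> extensions z (L K)" "0 < M K x" "\<not> Q x"
      using bad K unfolding bad_def by (meson Suc_leD)
    then have xw: "x \<in> words (L K)" "prefix z x" by (auto simp: extensions_def)
    let ?z = "take (L (Suc k)) x"
    have z: "length z = L k" "L k \<le> L (Suc k)" "L (Suc k) \<le> L K" using bad L_le K by (auto simp: bad_def words_def)
    have zE: "?z \<in> ?E"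
      using xw z by (auto simp: extensions_def words_def prefix_def dest: in_set_takeD)
    let ?y = "take (L (g ?z)) x"
    have "?y \<in> extensions ?z (L (g ?z))"
      using xw L_le[OF g(1)[OF zE]] L_le[OF gK[OF zE]] z(3)
      by (auto simp: extensions_def words_def take_is_prefix min_absorb1 dest: in_set_takeD
            intro: prefix_length_prefix[of _ x])
    moreover have "0 < M (g ?z) ?y"
      using mass_le_mass_take[OF xw(1) gK[OF zE]] x(2) by simp
    ultimately have "Q ?y" using g(2)[OF zE] by blast
    then have "Q x" by (rule mono[rotated 2]) (use xw in \<open>auto simp: words_def take_is_prefix\<close>)
    then show False using x by simp
  qed
  ultimately obtain z where z: "\<And>k. bad k (z k)" "\<And>k. prefix (z k) (z (Suc k))"
    using dependent_nat_choice[of bad "\<lambda>_ z z'. prefix z z'"] by blast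
  have zw: "z k \<in> words (L k)" for k using z(1) by (simp add: bad_def)
  have mono_z: "prefix (z k) (z K)" if "k \<le> K" for k K
    using that by (induction K rule: dec_induct) (use z(2) in \<open>auto intro: prefix_order.trans\<close>)
  define \<omega> where "\<omega> n = z (Suc n) ! n" for n
  have nth: "\<omega> n = z k ! n" if "n < L k" for n k
  proof -
    have len: "n < length (z (Suc n))" "n < length (z k)"
      using L_ge[of "Suc n"] zw that by (auto simp: words_def)
    show ?thesis
      using mono_z[of k "Suc n"] mono_z[of "Suc n" k] len
      by (cases "k \<le> Suc n") (auto simp: \<omega>_def prefix_def nth_append)
  qed
  have pre: "pre \<omega> (L k) = z k" for k
    using zw[of k] by (intro nth_equalityI) (auto simp: words_def nth pre_def)
  have "\<omega> n \<in> set (z (Suc n))" for n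
    using L_ge[of "Suc n"] zw[of "Suc n"] by (auto simp: \<omega>_def words_def)
  then have \<omega>: "\<omega> \<in> \<Sigma>" using zw by (force simp: symbol_space_def words_def)
  have zk: "0 < M k (z k) \<and> \<not> Q (z k)" for k
  proof -
    obtain x where x: "x \<in> extensions (z k) (L k)" "0 < M k x" "\<not> Q x"
      using z(1)[of k] unfolding bad_def by blast
    then have "x = z k" using zw[of k] by (auto simp: extensions_def words_def dest: prefix_same_lengthD)
    then show ?thesis using x by simp
  qed
  then have "\<omega> \<in> support" using \<omega> by (simp add: support_def pre)
  then obtain k where "Q (pre \<omega> (L k))" using bar by blast
  then show False using zk by (simp add: pre)
qed

lemma support_nonempty: "support \<noteq> {}"
proof
  assume empty: "support = {}"
  obtain K where K: "\<And>x. x \<in> words (L K) \<Longrightarrow> 0 < M K x \<Longrightarrow> False"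
    by (rule uniform_bar[of "\<lambda>_. False"]) (use empty in auto)
  have "(\<Sum>x\<in>extensions [] (L K). M K x) = 1"
    using mass_extensions[of "[]" 0 K] by (simp add: L_0 M_0)
  moreover have "M K x = 0" if "x \<in> extensions [] (L K)" for x
    using K[of x] M_nonneg[of K x] that by (force simp: extensions_def)
  ultimately show False by simp
qed

text \<open>The mass distribution principle. Enlarge the sets of a cheap cover to balls of radius
comparable to \<open>s i\<close>; by Koenig's lemma each word of positive mass at some level \<open>K\<close> has its cylinder
inside one of the balls. Collect these words by their initial stopping words at scale \<open>s i\<close>. For
each ball there are at most \<open>N\<close> of those, each with mass at most \<open>B * s i powr t\<close>, so the total mass 1
is bounded by a multiple of the cost of the cover.\<close>

theorem hausdorff_measure_support_pos:
  assumes t: "0 < t" and B: "0 \<le> B"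
    and bound: "\<And>k z. set z \<subseteq> {1..m} \<Longrightarrow> L k \<le> length z \<Longrightarrow> length z < L (Suc k) \<Longrightarrow>
      M k (take (L k) z) \<le> B * r z powr t"
  shows "hausdorff_measure t (\<pi> ` support) \<noteq> 0"
proof
  assume null: "hausdorff_measure t (\<pi> ` support) = 0"
  obtain N where N: "\<And>s x. 0 < s \<Longrightarrow> finite (stopping_words s x) \<and> card (stopping_words s x) \<le> N"
    using stopping_words_bounded by blast
  define \<eta> where "\<eta> = 1 / (4 * (real N * B + 1))"
  have NB: "0 \<le> real N * B" using B by simp
  have \<eta>: "0 < \<eta>" "2 * \<eta> < 1" "real N * B * (2 * \<eta>) < 1"
    using NB by (auto simp: \<eta>_def field_simps)
  have "hausdorff_premeasure t 1 (\<pi> ` support) < ennreal \<eta>"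
    using null \<eta> by (simp add: hausdorff_measure_eq_0_iff)
  then obtain U where U: "\<pi> ` support \<subseteq> (\<Union>i. U i)" "\<And>i. bounded (U i)"
      "(\<Sum>i. hausdorff_weight t (U i)) < ennreal \<eta>"
    unfolding hausdorff_premeasure_def INF_less_iff by auto
  define I where "I = {i. U i \<noteq> {}}"
  \<comment> \<open>the added terms make the radii \<open>s i\<close> positive, also for sets of diameter 0, and sum to \<open>\<eta>\<close>\<close>
  define cost where "cost i = diameter (U i) powr t + \<eta> * (1 / 2) ^ Suc i" for i
  define s where "s i = cost i powr (1 / t)" for i
  have cost: "0 < cost i" for i using \<eta> by (auto simp: cost_def intro!: add_nonneg_pos)
  have s: "0 < s i" "s i powr t = cost i" "diameter (U i) \<le> s i" for i
  proof -
    show "0 < s i" using cost[of i] by (simp add: s_def)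
    show "s i powr t = cost i" using cost[of i] t by (simp add: s_def powr_powr)
    have "(diameter (U i) powr t) powr (1 / t) \<le> s i"
      unfolding s_def using t \<eta> by (intro powr_mono2) (auto simp: cost_def)
    then show "diameter (U i) \<le> s i" using t diameter_ge_0[OF U(2)] by (simp add: powr_powr)
  qed
  have sumR: "sum cost I' \<le> 2 * \<eta>" if I': "finite I'" "I' \<subseteq> I" for I'
  proof -
    have "ennreal (\<Sum>i\<in>I'. diameter (U i) powr t) = (\<Sum>i\<in>I'. hausdorff_weight t (U i))"
    proof -
      have "hausdorff_weight t (U i) = ennreal (diameter (U i) powr t)" if "i \<in> I'" for i
        using t I' that by (auto simp: hausdorff_weight_def I_def)
      then show ?thesis by (simp add: sum_ennreal)
    qed
    also have "\<dots> \<le> (\<Sum>i. hausdorff_weight t (U i))" using I' by (intro sum_le_suminf) auto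
    also have "\<dots> \<le> ennreal \<eta>" using U(3) by simp
    finally have "(\<Sum>i\<in>I'. diameter (U i) powr t) \<le> \<eta>" using \<eta> by simp
    moreover have "(\<Sum>i\<in>I'. \<eta> * (1 / 2) ^ Suc i) \<le> \<eta>"
    proof -
      have sums: "(\<lambda>i. \<eta> * (1 / 2) ^ Suc i) sums \<eta>" using sums_mult[OF power_half_series, of \<eta>] by simp
      then have "(\<Sum>i\<in>I'. \<eta> * (1 / 2) ^ Suc i) \<le> (\<Sum>i. \<eta> * (1 / 2) ^ Suc i)"
        using I' \<eta> by (intro sum_le_suminf) (auto simp: sums_iff)
      also have "\<dots> = \<eta>" using sums by (simp add: sums_iff)
      finally show ?thesis .
    qed
    ultimately show ?thesis by (simp add: cost_def sum.distrib)
  qed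
  have s_less_1: "s i < 1" if "i \<in> I" for i
  proof (rule ccontr)
    assume "\<not> s i < 1"
    then have "1 \<le> s i powr t" using t by (simp add: ge_one_powr_ge_zero)
    then show False using sumR[of "{i}"] that \<eta> by (simp add: s)
  qed
  have "\<exists>x. x \<in> U i" if "i \<in> I" for i using that by (auto simp: I_def)
  then obtain x where x: "\<And>i. i \<in> I \<Longrightarrow> x i \<in> U i" by metis
  define Q where "Q z \<longleftrightarrow> (\<exists>i\<in>I. F z ` J \<subseteq> ball (x i) (2 * s i) \<and> r z \<le> s i)" for z
  obtain K where K: "\<And>z. z \<in> words (L K) \<Longrightarrow> 0 < M K z \<Longrightarrow> Q z"
  proof (rule uniform_bar)
    show "Q w" if "prefix z w" "set w \<subseteq> {1..m}" "Q z" for z w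
      using that F_extension[OF that(1,2)] r_extension[OF that(1,2)] unfolding Q_def
      by (meson order_trans)
    fix \<omega> assume \<omega>: "\<omega> \<in> support"
    then have \<omega>\<Sigma>: "\<omega> \<in> \<Sigma>" by (simp add: support_def)
    obtain i where i: "\<pi> \<omega> \<in> U i" using U(1) \<omega> by blast
    then have iI: "i \<in> I" by (auto simp: I_def)
    obtain n where n: "\<And>k. n \<le> k \<Longrightarrow> r_max ^ k * (D + 1) < s i"
      using pow_r_max_less[OF s(1)] by blast
    let ?z = "pre \<omega> (L n)"
    have z: "set ?z \<subseteq> {1..m}" "length ?z = L n" using pre_in[OF \<omega>\<Sigma>] by auto
    have "r_max ^ L n * (D + 1) < s i" using n L_ge by blast
    moreover have "r_max ^ L n * (D + 1) = r_max ^ L n * D + r_max ^ L n" by (simp add: distrib_left)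
    moreover have "0 \<le> r_max ^ L n * D" "0 \<le> r_max ^ L n" using r_max D(1) by auto
    ultimately have small: "r_max ^ L n * D < s i" "r_max ^ L n < s i" by linarith+
    have "F ?z ` J \<subseteq> ball (x i) (2 * s i)"
    proof
      fix y assume "y \<in> F ?z ` J"
      then obtain y' where y': "y' \<in> J" "y = F ?z y'" by blast
      obtain w where w: "w \<in> J" "\<pi> \<omega> = F ?z w" using coding_in_F_J[OF \<omega>\<Sigma>] by blast
      have "dist (\<pi> \<omega>) y < s i" using dist_F_J[OF z(1) w(1) y'(1)] z(2) small y' w by simp
      moreover have "dist (x i) (\<pi> \<omega>) \<le> s i"
        using diameter_bounded_bound[OF U(2) x[OF iI] i] s(3)[of i] by linarith
      ultimately show "y \<in> ball (x i) (2 * s i)" using dist_triangle[of "x i" y "\<pi> \<omega>"] by simp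
    qed
    moreover have "r ?z \<le> s i" using r_le_power[OF z(1)] z(2) small by simp
    ultimately show "\<exists>k. Q (pre \<omega> (L k))" using iI unfolding Q_def by blast
  qed (rule that)
  have cyl: "(\<Sum>y\<in>extensions z (L K). M K y) \<le> B * r z powr t"
    if z: "set z \<subseteq> {1..m}" "length z \<le> L K" for z
  proof -
    obtain k where k1: "L k \<le> length z" and k2: "length z < L (Suc k)"
      using strict_mono_interval[OF L_mono, of 0 "length z"] L_0 by auto
    have kK: "k \<le> K" using k1 z(2) L_mono by (meson le_trans strict_mono_less_eq)
    have "(\<Sum>y\<in>extensions z (L K). M K y) \<le> (\<Sum>y\<in>extensions (take (L k) z) (L K). M K y)"
      using M_nonneg by (intro sum_mono2) (auto simp: extensions_def intro: prefix_order.trans[OF take_is_prefix])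
    also have "\<dots> = M k (take (L k) z)"
      using z k1 by (intro mass_extensions[OF _ kK]) (auto simp: words_def dest: in_set_takeD)
    also have "\<dots> \<le> B * r z powr t" by (rule bound[OF z(1) k1 k2])
    finally show ?thesis .
  qed
  let ?P = "{z \<in> words (L K). 0 < M K z}"
  have "\<forall>z\<in>?P. \<exists>i. i \<in> I \<and> F z ` J \<subseteq> ball (x i) (2 * s i) \<and> r z \<le> s i"
    using K unfolding Q_def by blast
  then obtain i where i: "\<And>z. z \<in> ?P \<Longrightarrow> i z \<in> I \<and> F z ` J \<subseteq> ball (x (i z)) (2 * s (i z)) \<and> r z \<le> s (i z)"
    by metis
  define I' where "I' = i ` ?P"
  have I': "finite I'" "I' \<subseteq> I" using i by (auto simp: I'_def)
  define T where "T j = {z \<in> stopping_words (s j) (x j). length z \<le> L K}" for j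
  have T: "finite (T j)" "card (T j) \<le> N" for j
  proof -
    have "T j \<subseteq> stopping_words (s j) (x j)" by (auto simp: T_def)
    then show "finite (T j)" "card (T j) \<le> N"
      using N[OF s(1), of j "x j"] by (meson finite_subset, meson card_mono le_trans)
  qed
  have "?P \<subseteq> (\<Union>j\<in>I'. \<Union>z\<in>T j. extensions z (L K))"
  proof
    fix z assume z: "z \<in> ?P"
    let ?j = "i z"
    have zw: "set z \<subseteq> {1..m}" "length z = L K" using z by (auto simp: words_def)
    define n where "n = (LEAST n. r (take n z) \<le> s ?j)"
    have ex: "r (take (length z) z) \<le> s ?j" using i[OF z] by simp
    have n: "r (take n z) \<le> s ?j" "n \<le> length z"
      unfolding n_def by (rule LeastI[of _ "length z"], rule ex, rule Least_le, rule ex)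
    have "n \<noteq> 0"
    proof
      assume "n = 0"
      then show False using n(1) s_less_1[of ?j] i[OF z] by auto
    qed
    then have "n - 1 < n" by simp
    then have n1: "s ?j < r (take (n - 1) z)" unfolding n_def by (metis not_less_Least not_le)
    let ?y = "take n z"
    have y: "set ?y \<subseteq> {1..m}" "?y \<noteq> []" "butlast ?y = take (n - 1) z" "prefix ?y z"
      using zw n \<open>n \<noteq> 0\<close> by (auto simp: butlast_take take_is_prefix dest: in_set_takeD)
    have "F z ` J \<subseteq> F ?y ` J" by (rule F_extension[OF y(4) zw(1)])
    then have "F ?y ` J \<inter> ball (x ?j) (2 * s ?j) \<noteq> {}" using i[OF z] J(2) by blast
    then have "?y \<in> T ?j" using y n n1 zw by (simp add: T_def stopping_words_def)
    moreover have "z \<in> extensions ?y (L K)" using z y by (simp add: extensions_def)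
    moreover have "?j \<in> I'" using z by (auto simp: I'_def)
    ultimately show "z \<in> (\<Union>j\<in>I'. \<Union>z\<in>T j. extensions z (L K))" by blast
  qed
  have "1 = (\<Sum>z\<in>extensions [] (L K). M K z)" using mass_extensions[of "[]" 0 K] by (simp add: L_0 M_0)
  also have "extensions [] (L K) = words (L K)" by (auto simp: extensions_def)
  also have "(\<Sum>z\<in>words (L K). M K z) = (\<Sum>z\<in>?P. M K z)"
    using M_nonneg by (intro sum.mono_neutral_right) (auto simp: less_le)
  also have "\<dots> \<le> (\<Sum>z\<in>(\<Union>j\<in>I'. \<Union>z\<in>T j. extensions z (L K)). M K z)"
    using \<open>?P \<subseteq> _\<close> I' T M_nonneg by (intro sum_mono2) auto
  also have "\<dots> \<le> (\<Sum>j\<in>I'. \<Sum>y\<in>(\<Union>z\<in>T j. extensions z (L K)). M K y)"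
    using I' T M_nonneg by (intro sum_UN_le) auto
  also have "\<dots> \<le> (\<Sum>j\<in>I'. \<Sum>z\<in>T j. \<Sum>y\<in>extensions z (L K). M K y)"
    using T M_nonneg by (intro sum_mono sum_UN_le) auto
  also have "\<dots> \<le> (\<Sum>j\<in>I'. \<Sum>z\<in>T j. B * cost j)"
  proof (intro sum_mono)
    fix j z assume "z \<in> T j"
    then have z: "set z \<subseteq> {1..m}" "length z \<le> L K" "r z \<le> s j" by (auto simp: T_def stopping_words_def)
    have "B * r z powr t \<le> B * s j powr t"
      using z r_pos[OF z(1)] t B by (intro mult_left_mono powr_mono2) auto
    then show "(\<Sum>y\<in>extensions z (L K). M K y) \<le> B * cost j" using cyl[OF z(1,2)] s(2)[of j] by simp
  qed
  also have "\<dots> \<le> (\<Sum>j\<in>I'. real N * (B * cost j))"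
    using T B cost by (intro sum_mono) (auto intro!: mult_right_mono simp: less_imp_le)
  also have "\<dots> = real N * B * sum cost I'" by (simp add: sum_distrib_left mult.assoc)
  also have "\<dots> \<le> real N * B * (2 * \<eta>)" using sumR[OF I'] NB by (intro mult_left_mono) auto
  also have "\<dots> < 1" by (rule \<eta>)
  finally show False by simp
qed

end

context homothetic_ifs
begin

section \<open>Codes with prescribed averages\<close>

text \<open>Since the length of a block is negligible compared to what precedes it, it is enough to control the
sums over complete blocks.\<close>

lemma averages_from_blocks:
  assumes \<omega>: "\<omega> \<in> \<Sigma>" and L: "strict_mono L"
    and ratio: "(\<lambda>k. real (L (Suc k) - L k) / real (L k)) \<longlonglongrightarrow> 0"
    and \<delta>: "\<delta> \<longlonglongrightarrow> 0"
    and blocks: "\<And>k. 1 \<le> k \<Longrightarrow>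
      norm (orbit_sum (L (Suc k) - L k) (sh (L k) \<omega>) - real (L (Suc k) - L k) *\<^sub>R \<beta>) \<le> \<delta> k * real (L (Suc k) - L k)"
  shows "(\<lambda>n. (1 / real n) *\<^sub>R orbit_sum n \<omega>) \<longlonglongrightarrow> \<beta>"
proof (rule LIMSEQ_I)
  fix \<eta> :: real assume \<eta>: "0 < \<eta>"
  obtain E where E: "0 < E" "\<And>x. x \<in> J \<Longrightarrow> norm (x - \<beta>) \<le> E"
  proof -
    obtain B where "\<forall>x\<in>J. dist \<beta> x \<le> B"
      using compact_imp_bounded[OF J(1)] bounded_any_center[of J \<beta>] by auto
    then show ?thesis by (intro that[of "max B 1"]) (force simp: dist_norm norm_minus_commute)+
  qed
  have S_E: "norm (orbit_sum n \<omega>' - real n *\<^sub>R \<beta>) \<le> real n * E" if "\<omega>' \<in> \<Sigma>" for n \<omega>'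
  proof -
    have "orbit_sum n \<omega>' - real n *\<^sub>R \<beta> = (\<Sum>k<n. \<pi> (sh k \<omega>') - \<beta>)"
      by (simp add: orbit_sum_def sum_subtractf sum_constant_scaleR)
    also have "norm \<dots> \<le> (\<Sum>k<n. E)"
      using that by (intro sum_norm_le E coding_in_J sh_in)
    finally show ?thesis by simp
  qed
  define h where "h = \<eta> / 4"
  have h: "0 < h" using \<eta> by (simp add: h_def)
  have "\<forall>\<^sub>F k in sequentially. \<delta> k < h" "\<forall>\<^sub>F k in sequentially. real (L (Suc k) - L k) / real (L k) < h / E"
    using order_tendstoD(2)[OF \<delta> h] order_tendstoD(2)[OF ratio, of "h / E"] h E by auto
  then have "\<forall>\<^sub>F k in sequentially. \<delta> k < h \<and> real (L (Suc k) - L k) / real (L k) < h / E \<and> 1 \<le> k"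
    using eventually_ge_at_top[of 1] by eventually_elim auto
  then obtain k0 where k0: "\<And>k. k0 \<le> k \<Longrightarrow> \<delta> k < h \<and> real (L (Suc k) - L k) / real (L k) < h / E \<and> 1 \<le> k"
    by (auto simp: eventually_sequentially)
  have L_ge: "k \<le> L k" for k using L by (rule strict_mono_imp_increasing)
  have L_Suc: "L (Suc k) = L k + (L (Suc k) - L k)" for k using strict_monoD[OF L, of k "Suc k"] by simp
  define G where "G = real (L k0) * E"
  have at_L: "norm (orbit_sum (L k) \<omega> - real (L k) *\<^sub>R \<beta>) \<le> G + h * real (L k)" if "k0 \<le> k" for k
    using that
  proof (induction k rule: dec_induct)
    case base
    have "norm (orbit_sum (L k0) \<omega> - real (L k0) *\<^sub>R \<beta>) \<le> G" unfolding G_def by (rule S_E[OF \<omega>])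
    moreover have "0 \<le> h * real (L k0)" using h by simp
    ultimately show ?case by linarith
  next
    case (step k)
    let ?l = "L (Suc k) - L k"
    have eq: "orbit_sum (L (Suc k)) \<omega> - real (L (Suc k)) *\<^sub>R \<beta> =
        (orbit_sum (L k) \<omega> - real (L k) *\<^sub>R \<beta>) + (orbit_sum ?l (sh (L k) \<omega>) - real ?l *\<^sub>R \<beta>)"
      by (subst (1 2) L_Suc) (simp add: S_add scaleR_left_distrib)
    have "norm (orbit_sum ?l (sh (L k) \<omega>) - real ?l *\<^sub>R \<beta>) \<le> \<delta> k * real ?l" using k0[OF step(1)] blocks by blast
    also have "\<dots> \<le> h * real ?l" using k0[OF step(1)] by (intro mult_right_mono) auto
    finally have "norm (orbit_sum (L (Suc k)) \<omega> - real (L (Suc k)) *\<^sub>R \<beta>) \<le> G + h * real (L k) + h * real ?l"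
      unfolding eq by (intro order_trans[OF norm_triangle_ineq] add_mono step.IH)
    also have "\<dots> = G + h * real (L k + ?l)" by (simp add: distrib_left)
    also have "L k + ?l = L (Suc k)" by (rule L_Suc[symmetric])
    finally show ?case .
  qed
  obtain n1 where n1: "G / h < real n1" using reals_Archimedean2 by blast
  show "\<exists>n0. \<forall>n\<ge>n0. norm ((1 / real n) *\<^sub>R orbit_sum n \<omega> - \<beta>) < \<eta>"
  proof (intro exI[of _ "max (Suc n1) (L k0)"] allI impI)
    fix n assume n: "max (Suc n1) (L k0) \<le> n"
    obtain k where k3: "k0 \<le> k" and k1: "L k \<le> n" and k2: "n < L (Suc k)"
      using strict_mono_interval[OF L, of k0 n] n by auto
    let ?l = "L (Suc k) - L k"
    have Lpos: "0 < L k" using L_ge[of k] k0[OF k3] by linarith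
    have "real ?l / real (L k) \<le> h / E" using k0[OF k3] by auto
    then have lE: "real ?l * E \<le> h * real (L k)" using Lpos E by (simp add: field_simps)
    have eq: "orbit_sum n \<omega> - real n *\<^sub>R \<beta> = (orbit_sum (L k) \<omega> - real (L k) *\<^sub>R \<beta>)
        + (orbit_sum (n - L k) (sh (L k) \<omega>) - real (n - L k) *\<^sub>R \<beta>)"
      using S_add[of "L k" "n - L k" \<omega>] k1 by (simp add: algebra_simps of_nat_diff)
    have "norm (orbit_sum (n - L k) (sh (L k) \<omega>) - real (n - L k) *\<^sub>R \<beta>) \<le> real (n - L k) * E"
      by (rule S_E[OF sh_in[OF \<omega>]])
    also have "\<dots> \<le> real ?l * E" using k2 E by (intro mult_right_mono) auto
    also have "\<dots> \<le> h * real (L k)" by (rule lE)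
    finally have "norm (orbit_sum n \<omega> - real n *\<^sub>R \<beta>) \<le> G + h * real (L k) + h * real (L k)"
      unfolding eq by (intro order_trans[OF norm_triangle_ineq] add_mono at_L[OF k3])
    also have "\<dots> \<le> G + 2 * (h * real n)" using k1 h by simp
    also have "\<dots> < 3 * (h * real n)"
    proof -
      have "G / h < real n" using n1 n by linarith
      then show ?thesis using h by (simp add: field_simps)
    qed
    also have "\<dots> \<le> \<eta> * real n" using \<eta> by (simp add: h_def)
    finally have "norm (orbit_sum n \<omega> - real n *\<^sub>R \<beta>) < \<eta> * real n" .
    moreover have npos: "0 < real n" using n by simp
    moreover have "(1 / real n) *\<^sub>R orbit_sum n \<omega> - \<beta> = (1 / real n) *\<^sub>R (orbit_sum n \<omega> - real n *\<^sub>R \<beta>)"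
      using npos by (simp add: scaleR_right_diff_distrib)
    ultimately have "norm ((1 / real n) *\<^sub>R orbit_sum n \<omega> - \<beta>) = norm (orbit_sum n \<omega> - real n *\<^sub>R \<beta>) / real n"
      by simp
    also have "\<dots> < \<eta>" using \<open>norm (orbit_sum n \<omega> - real n *\<^sub>R \<beta>) < \<eta> * real n\<close> npos by (simp add: divide_less_eq)
    finally show "norm ((1 / real n) *\<^sub>R orbit_sum n \<omega> - \<beta>) < \<eta>" .
  qed
qed

text \<open>At the end of a block that leads to the word \<open>y\<close>, the mass of \<open>y\<close> is distributed among the admissible
next blocks \<open>B k y\<close> in proportion to their weights.\<close>

primrec block_mass :: "(nat \<Rightarrow> nat) \<Rightarrow> (nat \<Rightarrow> nat list \<Rightarrow> nat list set) \<Rightarrow> real \<Rightarrow> nat \<Rightarrow> nat list \<Rightarrow> real" where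
  "block_mass L B t 0 z = 1"
| "block_mass L B t (Suc k) z = block_mass L B t k (take (L k) z) *
     (if drop (L k) z \<in> B k (take (L k) z)
      then r (drop (L k) z) powr t / (\<Sum>v\<in>B k (take (L k) z). r v powr t) else 0)"

lemma block_mass_nonneg: "0 \<le> block_mass L B t k z"
  by (induction k arbitrary: z) (auto intro!: mult_nonneg_nonneg divide_nonneg_nonneg sum_nonneg)

lemma mass_distribution_block_mass:
  assumes L: "L 0 = 0" "strict_mono L"
    and B: "\<And>k y. B k y \<subseteq> words (L (Suc k) - L k)" "\<And>k y. B k y \<noteq> {}"
  shows "mass_distribution m \<rho> c f J V L (block_mass L B t)"
proof (unfold_locales, fact L(1), fact L(2), simp, rule block_mass_nonneg)
  fix k z assume z: "z \<in> words (L k)"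
  let ?W = "words (L (Suc k) - L k)"
  let ?s = "\<Sum>v\<in>B k z. r v powr t"
  have fin: "finite (B k z)" by (rule finite_subset[OF B(1) finite_words])
  have "0 < ?s"
  proof (rule sum_pos[OF fin B(2)])
    fix v assume "v \<in> B k z"
    then have "0 < r v" using B(1) by (intro r_pos) (auto simp: words_def)
    then show "0 < r v powr t" by simp
  qed
  have "(\<Sum>v\<in>?W. block_mass L B t (Suc k) (z @ v))
      = (\<Sum>v\<in>?W. if v \<in> B k z then block_mass L B t k z * (r v powr t / ?s) else 0)"
    using z by (intro sum.cong) (auto simp: words_def)
  also have "\<dots> = (\<Sum>v\<in>B k z. block_mass L B t k z * (r v powr t / ?s))"
    using B(1)[of k z] by (simp add: sum.If_cases Int_absorb1)
  also have "\<dots> = block_mass L B t k z"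
    using \<open>0 < ?s\<close>
    by (subst sum_distrib_left[symmetric], subst sum_divide_distrib[symmetric]) simp
  finally show "(\<Sum>v\<in>?W. block_mass L B t (Suc k) (z @ v)) = block_mass L B t k z" .
qed

text \<open>As the total weight of the admissible blocks is at least 1 from the second block on, normalization
only decreases the weights. The first block is the prescribed word \<open>w0\<close>, which causes the constant.\<close>

lemma block_mass_le:
  assumes L: "L 0 = 0" "strict_mono L"
    and w0: "set w0 \<subseteq> {1..m}" "0 \<le> t"
    and B0: "\<And>y. B 0 y = {w0}"
    and B: "\<And>k y. 1 \<le> k \<Longrightarrow> 1 \<le> (\<Sum>v\<in>B k y. r v powr t)"
    and z: "z \<in> words (L k)"
  shows "block_mass L B t k z \<le> r w0 powr (- t) * r z powr t"
  using z
proof (induction k arbitrary: z)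
  case 0
  have "1 \<le> r w0 powr (- t)"
    using r_pos[OF w0(1)] r_le_1[OF w0(1)] w0(2) by (simp add: powr_minus one_le_inverse powr_le1)
  then show ?case using 0 L by simp
next
  case (Suc k)
  let ?y = "take (L k) z" and ?v = "drop (L k) z"
  have zs: "set z \<subseteq> {1..m}" using Suc.prems by (auto simp: words_def)
  have "L k \<le> L (Suc k)" using L(2) by (simp add: strict_mono_less_eq)
  then have y: "?y \<in> words (L k)" using Suc.prems by (auto simp: words_def dest: in_set_takeD)
  have rz: "r z powr t = r ?y powr t * r ?v powr t"
  proof -
    have "r z = r ?y * r ?v" by (metis append_take_drop_id r_append)
    moreover have "0 < r ?y" "0 < r ?v"
      by (rule r_pos[OF order_trans[OF set_take_subset zs]],
          rule r_pos[OF order_trans[OF set_drop_subset zs]])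
    ultimately show ?thesis by (simp add: powr_mult)
  qed
  have nonneg: "0 \<le> r w0 powr (- t) * r z powr t" by simp
  show ?case
  proof (cases "?v \<in> B k ?y")
    case False
    then show ?thesis using nonneg by simp
  next
    case True
    show ?thesis
    proof (cases k)
      case 0
      then have "z = w0" using True by (simp add: B0 L)
      then show ?thesis using 0 r_pos[OF w0(1)] L by (simp add: B0 flip: powr_add)
    next
      case (Suc k')
      then have "1 \<le> (\<Sum>v\<in>B k ?y. r v powr t)" by (intro B) simp
      then have "r ?v powr t / (\<Sum>v\<in>B k ?y. r v powr t) \<le> r ?v powr t"
        by (simp add: divide_le_eq mult_le_cancel_left1)
      then have "block_mass L B t (Suc k) z \<le> block_mass L B t k ?y * r ?v powr t"
        using True mult_left_mono[OF _ block_mass_nonneg, of "r ?v powr t / (\<Sum>v\<in>B k ?y. r v powr t)"] by simp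
      also have "\<dots> \<le> r w0 powr (- t) * r ?y powr t * r ?v powr t"
        using Suc.IH[OF y] by (intro mult_right_mono) auto
      finally show ?thesis by (simp add: rz mult.assoc)
    qed
  qed
qed

text \<open>Within a block nothing is known about how its mass is spread, so the mass of a cylinder is compared
with the mass at the start of the block. As blocks are short compared to what precedes them, this
costs an arbitrarily small part of the exponent.\<close>

lemma block_ratio_bound:
  assumes L: "strict_mono L"
    and ratio: "(\<lambda>k. real (L (Suc k) - L k) / real (L k)) \<longlonglongrightarrow> 0"
    and t: "0 \<le> t'" "t' < t"
  obtains G where "0 \<le> G" "\<And>k z. set z \<subseteq> {1..m} \<Longrightarrow> L k \<le> length z \<Longrightarrow> length z < L (Suc k) \<Longrightarrow>
     r (take (L k) z) powr t \<le> G * r z powr t'"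
proof -
  define x where "x = - ln r_max"
  define y where "y = - ln r_min"
  have xy: "0 < x" "0 < y" using r_max r_min by (auto simp: x_def y_def)
  have L_ge: "k \<le> L k" for k using L by (rule strict_mono_imp_increasing)
  define g where "g k = t' * y * real (L (Suc k) - L k) - (t - t') * x * real (L k)" for k
  have "0 < (t - t') * x / (t' * y + 1)" using t xy by (auto intro!: divide_pos_pos add_nonneg_pos)
  from order_tendstoD(2)[OF ratio this] obtain k0 where
    k0: "\<And>k. k0 \<le> k \<Longrightarrow> real (L (Suc k) - L k) / real (L k) < (t - t') * x / (t' * y + 1)"
    by (auto simp: eventually_sequentially)
  have g_le: "g k \<le> Max (insert 0 (g ` {..k0}))" for k
  proof (cases "k \<le> k0")
    case False
    then have "0 < L k" using L_ge[of k] by simp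
    let ?l = "real (L (Suc k) - L k)"
    have "?l / real (L k) \<le> (t - t') * x / (t' * y + 1)" using k0[of k] False by simp
    moreover have "0 < t' * y + 1" using t xy by (intro add_nonneg_pos) auto
    ultimately have "?l * (t' * y + 1) \<le> (t - t') * x * real (L k)"
      using \<open>0 < L k\<close> by (simp add: field_simps)
    then have "g k \<le> 0" by (simp add: g_def algebra_simps)
    also have "\<dots> \<le> Max (insert 0 (g ` {..k0}))" by (rule Max_ge) auto
    finally show ?thesis .
  next
    case True
    then show ?thesis by (intro Max_ge) auto
  qed
  define G where "G = exp (Max (insert 0 (g ` {..k0})))"
  show ?thesis
  proof (rule that[of G])
    fix k z assume z: "set z \<subseteq> {1..m}" "L k \<le> length z" "length z < L (Suc k)"
    let ?u = "take (L k) z" and ?v = "drop (L k) z"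
    have uv: "set ?u \<subseteq> {1..m}" "set ?v \<subseteq> {1..m}"
      using order_trans[OF set_take_subset z(1)] order_trans[OF set_drop_subset z(1)] by auto
    have rz: "r z = r ?u * r ?v" by (metis append_take_drop_id r_append)
    have pos: "0 < r ?u" "0 < r ?v" "0 < r z" using r_pos uv z by auto
    have "ln (r ?u) \<le> ln (r_max ^ L k)" using r_le_power[OF uv(1)] pos z by (simp add: min_absorb2)
    then have u: "ln (r ?u) \<le> - (x * real (L k))" using r_max by (simp add: ln_realpow x_def mult.commute)
    have "ln (r_min ^ length ?v) \<le> ln (r ?v)" using r_ge_power[OF uv(2)] pos r_min by simp
    then have "- (y * real (length ?v)) \<le> ln (r ?v)" using r_min by (simp add: ln_realpow y_def mult.commute)
    moreover have "y * real (length ?v) \<le> y * real (L (Suc k) - L k)" using z xy by (intro mult_left_mono) auto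
    ultimately have v: "- (y * real (L (Suc k) - L k)) \<le> ln (r ?v)" by linarith
    have "(t - t') * ln (r ?u) \<le> (t - t') * - (x * real (L k))" using u t by (intro mult_left_mono) auto
    moreover have "t' * - (y * real (L (Suc k) - L k)) \<le> t' * ln (r ?v)" using v t by (intro mult_left_mono) auto
    ultimately have "t * ln (r ?u) \<le> g k + t' * (ln (r ?u) + ln (r ?v))"
      by (simp add: g_def algebra_simps)
    then have "t * ln (r ?u) \<le> Max (insert 0 (g ` {..k0})) + t' * ln (r z)"
      using g_le[of k] pos by (simp add: rz ln_mult)
    then show "r ?u powr t \<le> G * r z powr t'"
      using pos by (simp add: powr_def G_def flip: exp_add)
  qed (simp add: G_def)
qed

text \<open>The target of the next block is a function \<open>\<tau>\<close> of the word so far. The first block is \<open>w0\<close>, and the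
block number \<open>k \<ge> 1\<close> has length \<open>N + k\<close>: the lengths tend to infinity, so that the errors at the
junctions average out, but slowly enough to be negligible compared to their partial sums.\<close>

lemma codes_with_moving_target:
  assumes u: "set u \<subseteq> {1..m}" "F u ` closure V \<subseteq> V"
    and K: "compact K" "\<And>\<alpha>. \<alpha> \<in> K \<Longrightarrow> reach u \<alpha> t" and t: "0 \<le> t"
    and w0: "set w0 \<subseteq> {1..m}" "w0 \<noteq> []"
    and \<tau>: "\<And>y. \<tau> y \<in> K"
  obtains \<Omega> where "\<Omega> \<subseteq> regular_codes" "\<Omega> \<noteq> {}" "\<And>\<omega>. \<omega> \<in> \<Omega> \<Longrightarrow> pre \<omega> (length w0) = w0"
    "\<And>\<omega> \<beta>. \<omega> \<in> \<Omega> \<Longrightarrow> (\<lambda>n. \<tau> (pre \<omega> n)) \<longlonglongrightarrow> \<beta> \<Longrightarrow> (\<lambda>n. (1 / real n) *\<^sub>R orbit_sum n \<omega>) \<longlonglongrightarrow> \<beta>"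
    "\<And>t'. 0 < t' \<Longrightarrow> t' < t \<Longrightarrow> hausdorff_measure t' (\<pi> ` \<Omega>) \<noteq> 0"
proof -
  obtain e N where e: "e \<longlonglongrightarrow> 0"
    and N: "\<And>n \<alpha>. N \<le> n \<Longrightarrow> \<alpha> \<in> K \<Longrightarrow> \<exists>A\<subseteq>near n \<alpha> (e n). (\<forall>z\<in>A. suffix u z) \<and> 1 \<le> (\<Sum>z\<in>A. r z powr t)"
    using reach_uniform[OF K] by blast
  then obtain A where A: "\<And>n \<alpha>. N \<le> n \<Longrightarrow> \<alpha> \<in> K \<Longrightarrow> A n \<alpha> \<subseteq> near n \<alpha> (e n)"
      "\<And>n \<alpha> z. N \<le> n \<Longrightarrow> \<alpha> \<in> K \<Longrightarrow> z \<in> A n \<alpha> \<Longrightarrow> suffix u z"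
      "\<And>n \<alpha>. N \<le> n \<Longrightarrow> \<alpha> \<in> K \<Longrightarrow> 1 \<le> (\<Sum>z\<in>A n \<alpha>. r z powr t)"
    by metis
  define L where "L k = (case k of 0 \<Rightarrow> 0 | Suc k \<Rightarrow> length w0 + (\<Sum>i<k. N + Suc i))" for k
  define B where "B k y = (if k = 0 then {w0} else A (N + k) (\<tau> y))" for k y
  have L0: "L 0 = 0" and L1: "L (Suc 0) = length w0" by (simp_all add: L_def)
  have L_Suc: "L (Suc k) = L k + (N + k)" if "1 \<le> k" for k
    using that by (cases k) (simp_all add: L_def)
  have L_mono: "strict_mono L"
    unfolding strict_mono_Suc_iff
  proof
    fix k show "L k < L (Suc k)" using w0 L_Suc[of k] by (cases "k = 0") (auto simp: L0 L1)
  qed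
  have L_ge: "k \<le> L k" for k using L_mono by (rule strict_mono_imp_increasing)
  have L_diff: "L (Suc k) - L k = (if k = 0 then length w0 else N + k)" for k
    using L_Suc[of k] by (auto simp: L0 L1)
  have ratio: "(\<lambda>k. real (L (Suc k) - L k) / real (L k)) \<longlonglongrightarrow> 0"
  proof -
    have sq: "real k ^ 2 \<le> 2 * real (L (Suc k))" for k
    proof (induction k)
      case (Suc k)
      then show ?case using L_Suc[of "Suc k"] by (simp add: power2_eq_square algebra_simps)
    qed simp
    have "(\<lambda>k. real (L (Suc (Suc k)) - L (Suc k)) / real (L (Suc k))) \<longlonglongrightarrow> 0"
    proof (rule tendsto_sandwich[OF _ _ tendsto_const])
      show "\<forall>\<^sub>F k in sequentially. 0 \<le> real (L (Suc (Suc k)) - L (Suc k)) / real (L (Suc k))"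
        by simp
      show "\<forall>\<^sub>F k in sequentially. real (L (Suc (Suc k)) - L (Suc k)) / real (L (Suc k))
          \<le> 2 * (real (N + 1) / real k + 1) / real k"
        using eventually_gt_at_top[of 0]
      proof eventually_elim
        case (elim k)
        have "real (N + Suc k) / real (L (Suc k)) \<le> real (N + Suc k) / (real k ^ 2 / 2)"
          using sq[of k] elim L_ge[of "Suc k"] by (intro divide_left_mono mult_pos_pos) auto
        also have "\<dots> = 2 * (real (N + 1) / real k + 1) / real k"
          using elim by (simp add: field_simps power2_eq_square)
        finally show ?case by (simp add: L_diff)
      qed
      have "(\<lambda>k. real (N + 1) / real k) \<longlonglongrightarrow> 0" by (rule lim_const_over_n)
      then have "(\<lambda>k. 2 * (real (N + 1) / real k + 1) * (1 / real k)) \<longlonglongrightarrow> 2 * (0 + 1) * 0"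
        by (intro tendsto_intros lim_1_over_n)
      then show "(\<lambda>k. 2 * (real (N + 1) / real k + 1) / real k) \<longlonglongrightarrow> 0" by simp
    qed
    then show ?thesis by (rule LIMSEQ_imp_Suc)
  qed
  have B_words: "B k y \<subseteq> words (L (Suc k) - L k)" for k y
    using A(1)[OF _ \<tau>, of "N + k" y] near_words w0 by (auto simp: B_def L_diff words_def near_def)
  have B_sum: "1 \<le> (\<Sum>v\<in>B k y. r v powr t)" if "1 \<le> k" for k y
    using A(3)[OF _ \<tau>, of "N + k" y] that by (simp add: B_def)
  have B_ne: "B k y \<noteq> {}" for k y
    using B_sum[of k y] by (cases "k = 0") (auto simp: B_def)
  interpret mass_distribution m \<rho> c f J V L "block_mass L B t"
    by (rule mass_distribution_block_mass[OF L0 L_mono B_words B_ne])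
  have blockB: "pre (sh (L k) \<omega>) (L (Suc k) - L k) \<in> B k (pre \<omega> (L k))" if "\<omega> \<in> support" for k \<omega>
  proof -
    have "0 < block_mass L B t (Suc k) (pre \<omega> (L (Suc k)))"
      using that unfolding support_def by blast
    then have "drop (L k) (pre \<omega> (L (Suc k))) \<in> B k (take (L k) (pre \<omega> (L (Suc k))))"
      by (auto split: if_splits)
    then show ?thesis using L_le[of k "Suc k"] by (simp add: take_pre drop_pre)
  qed
  have sup_\<Sigma>: "\<omega> \<in> \<Sigma>" if "\<omega> \<in> support" for \<omega> using that by (simp add: support_def)
  show ?thesis
  proof (rule that[of support])
    show "support \<noteq> {}" by (rule support_nonempty)
    show "pre \<omega> (length w0) = w0" if "\<omega> \<in> support" for \<omega>
      using blockB[OF that, of 0] by (simp add: L0 L1 B_def)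
    show "support \<subseteq> regular_codes"
    proof
      fix \<omega> assume \<omega>: "\<omega> \<in> support"
      show "\<omega> \<in> regular_codes"
      proof (rule regular_if_inner_word_recurs[OF sup_\<Sigma>[OF \<omega>] u])
        fix n
        let ?k = "Suc n"
        have "pre (sh (L ?k) \<omega>) (L (Suc ?k) - L ?k) \<in> A (N + ?k) (\<tau> (pre \<omega> (L ?k)))"
          using blockB[OF \<omega>, of ?k] by (simp add: B_def)
        then obtain w where w: "pre (sh (L ?k) \<omega>) (L (Suc ?k) - L ?k) = w @ u"
          using A(2)[of "N + ?k", OF _ \<tau>] by (auto simp: suffix_def)
        have "pre \<omega> (L (Suc ?k)) = (pre \<omega> (L ?k) @ w) @ u"
          using pre_add[of \<omega> "L ?k" "L (Suc ?k) - L ?k"] L_le[of ?k "Suc ?k"] w by simp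
        moreover have "n \<le> L (Suc ?k)" "n \<le> length (pre \<omega> (L ?k) @ w)"
          using L_ge[of "Suc ?k"] L_ge[of ?k] by auto
        ultimately show "\<exists>i\<ge>n. \<exists>w. pre \<omega> i = w @ u \<and> n \<le> length w" by blast
      qed
    qed
    show "(\<lambda>n. (1 / real n) *\<^sub>R orbit_sum n \<omega>) \<longlonglongrightarrow> \<beta>"
      if \<omega>: "\<omega> \<in> support" and lim: "(\<lambda>n. \<tau> (pre \<omega> n)) \<longlonglongrightarrow> \<beta>" for \<omega> \<beta>
    proof (rule averages_from_blocks[OF sup_\<Sigma>[OF \<omega>] L_mono ratio])
      let ?\<tau> = "\<lambda>k. \<tau> (pre \<omega> (L k))"
      let ?\<delta> = "\<lambda>k. e (k + N) + C / real (k + N) + dist (?\<tau> k) \<beta>"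
      have "?\<tau> \<longlonglongrightarrow> \<beta>" using LIMSEQ_subseq_LIMSEQ[OF lim L_mono] by (simp add: o_def)
      then have "?\<delta> \<longlonglongrightarrow> 0 + 0 + dist \<beta> \<beta>"
        by (intro tendsto_intros LIMSEQ_ignore_initial_segment[OF e]
            LIMSEQ_ignore_initial_segment[OF lim_const_over_n])
      then show "?\<delta> \<longlonglongrightarrow> 0" by simp
      fix k :: nat assume k: "1 \<le> k"
      let ?l = "L (Suc k) - L k"
      let ?v = "pre (sh (L k) \<omega>) ?l"
      have l: "?l = k + N" "0 < ?l" using k by (auto simp: L_diff)
      have "?v \<in> near ?l (?\<tau> k) (e ?l)"
        using blockB[OF \<omega>, of k] A(1)[OF _ \<tau>, of "N + k"] k by (auto simp: B_def L_diff)
      then have 1: "norm (word_sum ?v - real ?l *\<^sub>R ?\<tau> k) \<le> e ?l * real ?l" by (simp add: near_def)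
      have 2: "norm (orbit_sum ?l (sh (L k) \<omega>) - word_sum ?v) \<le> C" by (rule word_sum_pre[OF sh_in[OF sup_\<Sigma>[OF \<omega>]]])
      have 3: "norm (real ?l *\<^sub>R ?\<tau> k - real ?l *\<^sub>R \<beta>) = dist (?\<tau> k) \<beta> * real ?l"
        by (simp add: dist_norm flip: scaleR_right_diff_distrib)
      have "orbit_sum ?l (sh (L k) \<omega>) - real ?l *\<^sub>R \<beta> = (orbit_sum ?l (sh (L k) \<omega>) - word_sum ?v)
          + (word_sum ?v - real ?l *\<^sub>R ?\<tau> k) + (real ?l *\<^sub>R ?\<tau> k - real ?l *\<^sub>R \<beta>)" by simp
      then have "norm (orbit_sum ?l (sh (L k) \<omega>) - real ?l *\<^sub>R \<beta>)
          \<le> C + e ?l * real ?l + dist (?\<tau> k) \<beta> * real ?l"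
        by (simp only:) (rule order_trans[OF norm_add3_le add_mono[OF add_mono[OF 2 1] eq_refl[OF 3]]])
      also have "\<dots> = (e ?l + C / real ?l + dist (?\<tau> k) \<beta>) * real ?l"
        using l(2) unfolding distrib_right by simp
      also have "\<dots> = ?\<delta> k * real ?l" by (simp only: l(1))
      finally show "norm (orbit_sum ?l (sh (L k) \<omega>) - real ?l *\<^sub>R \<beta>) \<le> ?\<delta> k * real ?l" .
    qed
    show "hausdorff_measure t' (\<pi> ` support) \<noteq> 0" if t': "0 < t'" "t' < t" for t'
    proof -
      obtain G where G: "0 \<le> G" "\<And>k z. set z \<subseteq> {1..m} \<Longrightarrow> L k \<le> length z \<Longrightarrow> length z < L (Suc k) \<Longrightarrow>
         r (take (L k) z) powr t \<le> G * r z powr t'"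
        using block_ratio_bound[OF L_mono ratio, of t' t] t' by auto
      show ?thesis
      proof (rule hausdorff_measure_support_pos[OF t'(1)])
        show "0 \<le> r w0 powr (- t) * G" using G by simp
        fix k z assume z: "set z \<subseteq> {1..m}" "L k \<le> length z" "length z < L (Suc k)"
        have "block_mass L B t k (take (L k) z) \<le> r w0 powr (- t) * r (take (L k) z) powr t"
          using z by (intro block_mass_le L0 L_mono w0 t B_sum) (auto simp: B_def words_def dest: in_set_takeD)
        also have "\<dots> \<le> r w0 powr (- t) * (G * r z powr t')"
          using G(2)[OF z] by (intro mult_left_mono) auto
        finally show "block_mass L B t k (take (L k) z) \<le> r w0 powr (- t) * G * r z powr t'"
          by (simp add: mult.assoc)
      qed
    qed
  qed
qed

section \<open>Spectrum and asymptotic fixed points\<close>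

abbreviation Jt :: "'a set" where "Jt \<equiv> regular_part m f V J"
abbreviation g :: "'a \<Rightarrow> 'a" where "g \<equiv> induced_map m f V"

abbreviation Fix :: "'a set" where "Fix \<equiv> asymptotic_fixed_points Jt g"

lemma coding_level_set:
  assumes "\<omega> \<in> regular_codes"
  shows "\<pi> \<omega> \<in> level_set Jt g \<alpha> \<longleftrightarrow> (\<lambda>n. (1 / real n) *\<^sub>R orbit_sum n \<omega>) \<longlonglongrightarrow> \<alpha>"
  using assms by (auto simp: level_set_def regular_part_eq birkhoff_sum_coding)

lemma coding_asymptotic_fixed_points:
  assumes "\<omega> \<in> regular_codes"
  shows "\<pi> \<omega> \<in> Fix \<longleftrightarrow> (\<lambda>n. (1 / real n) *\<^sub>R orbit_sum n \<omega>) \<longlonglongrightarrow> \<pi> \<omega>"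
  using assms by (auto simp: asymptotic_fixed_points_def regular_part_eq birkhoff_sum_coding
      simp flip: birkhoff_sum_def)

lemma limit_averages_subset: "limit_averages Jt g \<subseteq> \<Delta>"
proof
  fix \<alpha> assume "\<alpha> \<in> limit_averages Jt g"
  then obtain \<omega> where \<omega>: "\<omega> \<in> regular_codes" "(\<lambda>n. (1 / real n) *\<^sub>R orbit_sum n \<omega>) \<longlonglongrightarrow> \<alpha>"
    using coding_level_set by (auto simp: limit_averages_def level_set_def regular_part_eq)
  show "\<alpha> \<in> \<Delta>"
  proof (rule Lim_in_closed_set[OF compact_imp_closed[OF compact_hull] _ _ \<omega>(2)])
    show "\<forall>\<^sub>F n in sequentially. (1 / real n) *\<^sub>R orbit_sum n \<omega> \<in> \<Delta>"
      using eventually_gt_at_top[of 0] by eventually_elim (use \<omega> regular_codes_subset S_in_hull in auto)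
  qed simp
qed

lemma level_set_large:
  assumes u: "set u \<subseteq> {1..m}" "F u ` closure V \<subseteq> V" and "reach u \<alpha> t" "0 \<le> t"
  shows "level_set Jt g \<alpha> \<noteq> {} \<and>
    (\<forall>t'. 0 < t' \<and> t' < t \<longrightarrow> hausdorff_measure t' (level_set Jt g \<alpha>) \<noteq> 0)"
proof -
  obtain \<Omega> where \<Omega>: "\<Omega> \<subseteq> regular_codes" "\<Omega> \<noteq> {}"
    "\<And>\<omega> \<beta>. \<omega> \<in> \<Omega> \<Longrightarrow> (\<lambda>n. \<alpha>) \<longlonglongrightarrow> \<beta> \<Longrightarrow> (\<lambda>n. (1 / real n) *\<^sub>R orbit_sum n \<omega>) \<longlonglongrightarrow> \<beta>"
    "\<And>t'. 0 < t' \<Longrightarrow> t' < t \<Longrightarrow> hausdorff_measure t' (\<pi> ` \<Omega>) \<noteq> 0"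
  proof (rule codes_with_moving_target[OF u, of "{\<alpha>}" t "[1]" "\<lambda>_. \<alpha>"])
    show "set [1] \<subseteq> {1..m}" using m_pos by simp
  qed (use assms that in auto)
  have "\<pi> ` \<Omega> \<subseteq> level_set Jt g \<alpha>"
    using \<Omega>(1,3) coding_level_set by (blast intro: tendsto_const)
  then show ?thesis using \<Omega>(2,4) hausdorff_null_subset by blast
qed

lemma F_pre_tendsto:
  assumes "\<omega> \<in> \<Sigma>" "x \<in> J" shows "(\<lambda>n. F (pre \<omega> n) x) \<longlonglongrightarrow> \<pi> \<omega>"
proof (rule tendstoI)
  fix e :: real assume "0 < e"
  have "\<forall>\<^sub>F n in sequentially. r_max ^ n * D < e"
    using order_tendstoD(2)[OF pow_r_max_tendsto[of D], of e] \<open>0 < e\<close> by auto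
  then show "\<forall>\<^sub>F n in sequentially. dist (F (pre \<omega> n) x) (\<pi> \<omega>) < e"
  proof eventually_elim
    case (elim n)
    obtain y where "y \<in> J" "\<pi> \<omega> = F (pre \<omega> n) y" using coding_in_F_J[OF assms(1), of n] by blast
    then show ?case using dist_F_J[OF pre_in[OF assms(1)] assms(2), of y n] elim by simp
  qed
qed

text \<open>The target of the next block is the point \<open>F y p\<close>, where \<open>y\<close> is the word so far. Along a code these
targets converge to the coded point, and then so do the averages. All codes start with
\<open>w0\<close>, and the targets beyond it lie in the cylinder of \<open>w0\<close>; the default value in \<open>\<tau>\<close> is
never used at the initial words of these codes that extend \<open>w0\<close>.\<close>

lemma asymptotic_fixed_points_large:
  assumes u: "set u \<subseteq> {1..m}" "F u ` closure V \<subseteq> V"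
    and w0: "set w0 \<subseteq> {1..m}" "w0 \<noteq> []" and K: "compact K" "F w0 ` J \<subseteq> K"
    and reach: "\<And>\<alpha>. \<alpha> \<in> K \<Longrightarrow> reach u \<alpha> t" and t: "0 \<le> t"
  shows "Fix \<inter> F w0 ` J \<noteq> {} \<and>
    (\<forall>t'. 0 < t' \<and> t' < t \<longrightarrow> hausdorff_measure t' (Fix) \<noteq> 0)"
proof -
  have F0: "F w0 p \<in> K" using K(2) p_in_J by blast
  define \<tau> where "\<tau> y = (if F y p \<in> K then F y p else F w0 p)" for y
  obtain \<Omega> where \<Omega>: "\<Omega> \<subseteq> regular_codes" "\<Omega> \<noteq> {}" "\<And>\<omega>. \<omega> \<in> \<Omega> \<Longrightarrow> pre \<omega> (length w0) = w0"
    "\<And>\<omega> \<beta>. \<omega> \<in> \<Omega> \<Longrightarrow> (\<lambda>n. \<tau> (pre \<omega> n)) \<longlonglongrightarrow> \<beta> \<Longrightarrow> (\<lambda>n. (1 / real n) *\<^sub>R orbit_sum n \<omega>) \<longlonglongrightarrow> \<beta>"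
    "\<And>t'. 0 < t' \<Longrightarrow> t' < t \<Longrightarrow> hausdorff_measure t' (\<pi> ` \<Omega>) \<noteq> 0"
    by (rule codes_with_moving_target[OF u K(1) reach t w0, of \<tau>]) (use F0 in \<open>auto simp: \<tau>_def\<close>)
  have in_\<Sigma>: "\<omega> \<in> \<Sigma>" if "\<omega> \<in> \<Omega>" for \<omega> using that \<Omega>(1) regular_codes_subset by blast
  have in_w0: "\<pi> \<omega> \<in> F w0 ` J" if "\<omega> \<in> \<Omega>" for \<omega>
    using coding_in_F_J[OF in_\<Sigma>[OF that], of "length w0"] \<Omega>(3)[OF that] by simp
  have sub: "\<pi> ` \<Omega> \<subseteq> Fix"
  proof
    fix x assume "x \<in> \<pi> ` \<Omega>"
    then obtain \<omega> where \<omega>: "\<omega> \<in> \<Omega>" "x = \<pi> \<omega>" by blast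
    have "\<forall>\<^sub>F n in sequentially. F (pre \<omega> n) p = \<tau> (pre \<omega> n)"
      using eventually_ge_at_top[of "length w0"]
    proof eventually_elim
      case (elim n)
      have "pre \<omega> n = w0 @ pre (sh (length w0) \<omega>) (n - length w0)"
        using pre_add[of \<omega> "length w0" "n - length w0"] elim \<Omega>(3)[OF \<omega>(1)] by simp
      then have "F (pre \<omega> n) p \<in> F w0 ` J"
        using F_in_J[OF pre_in[OF sh_in[OF in_\<Sigma>[OF \<omega>(1)]]] p_in_J] by (simp add: F_append)
      then show ?case using K(2) by (auto simp: \<tau>_def)
    qed
    then have "(\<lambda>n. \<tau> (pre \<omega> n)) \<longlonglongrightarrow> \<pi> \<omega>"
      by (rule Lim_transform_eventually[OF F_pre_tendsto[OF in_\<Sigma>[OF \<omega>(1)] p_in_J]])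
    then show "x \<in> Fix"
      using \<Omega>(1,4) \<omega> coding_asymptotic_fixed_points by blast
  qed
  then have "Fix \<inter> F w0 ` J \<noteq> {}" using \<Omega>(2) in_w0 by blast
  moreover have "hausdorff_measure t' (Fix) \<noteq> 0" if "0 < t'" "t' < t" for t'
    using \<Omega>(5)[OF that] sub hausdorff_null_subset by blast
  ultimately show ?thesis by blast
qed

theorem limit_averages_eq: "limit_averages Jt g = \<Delta>"
proof
  obtain u where u: "set u \<subseteq> {1..m}" "F u ` closure V \<subseteq> V" by (rule inner_word_exists)
  show "\<Delta> \<subseteq> limit_averages Jt g"
  proof
    fix \<alpha> assume "\<alpha> \<in> \<Delta>"
    then have "level_set Jt g \<alpha> \<noteq> {}"
      using level_set_large[OF u reach_0[OF _ u(1)] order_refl] by simp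
    then show "\<alpha> \<in> limit_averages Jt g" unfolding limit_averages_def by simp
  qed
qed (rule limit_averages_subset)

lemma small_cylinder:
  assumes "\<alpha> \<in> J" "0 < e"
  obtains w where "set w \<subseteq> {1..m}" "w \<noteq> []" "F w ` J \<subseteq> cball \<alpha> e"
proof -
  obtain \<omega> where \<omega>: "\<omega> \<in> \<Sigma>" "\<pi> \<omega> = \<alpha>" using coding_surj[OF assms(1)] by blast
  obtain n0 where n0: "\<And>k. n0 \<le> k \<Longrightarrow> r_max ^ k * D < e" using pow_r_max_less[OF assms(2)] by blast
  define n where "n = Suc n0"
  have n: "r_max ^ n * D < e" "1 \<le> n" using n0[of n] by (auto simp: n_def)
  show ?thesis
  proof (rule that[of "pre \<omega> n"])
    show "set (pre \<omega> n) \<subseteq> {1..m}" by (rule pre_in[OF \<omega>(1)])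
    show "pre \<omega> n \<noteq> []" using n(2) by (metis length_pre list.size(3) not_one_le_zero)
    obtain y where y: "y \<in> J" "\<alpha> = F (pre \<omega> n) y" using coding_in_F_J[OF \<omega>(1), of n] \<omega>(2) by blast
    show "F (pre \<omega> n) ` J \<subseteq> cball \<alpha> e"
    proof
      fix x assume "x \<in> F (pre \<omega> n) ` J"
      then obtain x' where "x' \<in> J" "x = F (pre \<omega> n) x'" by blast
      then show "x \<in> cball \<alpha> e"
        using dist_F_J[OF pre_in[OF \<omega>(1)] y(1), of x' n] y(2) n(1) by simp
    qed
  qed
qed

theorem asymptotic_fixed_points_dense: "closure (Fix) = J"
proof
  have "Fix \<subseteq> J" by (auto simp: asymptotic_fixed_points_def regular_part_def)
  then show "closure (Fix) \<subseteq> J"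
    using compact_imp_closed[OF J(1)] by (rule closure_minimal)
  obtain u where u: "set u \<subseteq> {1..m}" "F u ` closure V \<subseteq> V" by (rule inner_word_exists)
  show "J \<subseteq> closure (Fix)"
  proof
    fix \<alpha> assume \<alpha>: "\<alpha> \<in> J"
    show "\<alpha> \<in> closure (Fix)"
      unfolding closure_approachable
    proof (intro allI impI)
      fix e :: real assume e: "0 < e"
      then obtain w where w: "set w \<subseteq> {1..m}" "w \<noteq> []" "F w ` J \<subseteq> cball \<alpha> (e / 2)"
        using small_cylinder[OF \<alpha>, of "e / 2"] by auto
      have "Fix \<inter> F w ` J \<noteq> {}"
        using asymptotic_fixed_points_large[OF u w(1,2) J(1) F_J[OF w(1)]
            reach_0[OF subsetD[OF J_subset_hull] u(1)] order_refl] by simp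
      then obtain x where "x \<in> Fix" "x \<in> cball \<alpha> (e / 2)" using w by blast
      then show "\<exists>y\<in>Fix. dist y \<alpha> < e"
        using e by (intro bexI[of _ x]) (auto simp: dist_commute)
    qed
  qed
qed

lemma dim_spectrum_ge_if_rich:
  assumes "rich \<alpha> s" "\<alpha> \<in> \<Delta>"
  shows "ennreal s \<le> dim_spectrum Jt g \<alpha>"
  unfolding dim_spectrum_def
proof (rule hausdorff_dim_geI)
  fix t assume t: "0 \<le> t" "t < s"
  obtain u where u: "set u \<subseteq> {1..m}" "F u ` closure V \<subseteq> V" by (rule inner_word_exists)
  have "reach u \<alpha> ((t + s) / 2)"
    using eventually_nhds_x_imp_x[OF reach_near_rich[OF assms _ _ u(1), of "(t + s) / 2"]] t assms by simp
  from level_set_large[OF u this] show "hausdorff_measure t (level_set Jt g \<alpha>) \<noteq> 0"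
    using t by (cases "t = 0") (auto simp: hausdorff_measure_0_eq_0_iff)
qed

text \<open>All points of \<open>J\<close> close to \<open>\<alpha>\<close> can be reached at exponents below \<open>s\<close>, so the moving target may start
in a small cylinder around \<open>\<alpha>\<close>.\<close>

lemma dim_asymptotic_fixed_points_ge_if_rich:
  assumes "rich \<alpha> s" "\<alpha> \<in> J"
  shows "ennreal s \<le> hausdorff_dim (Fix)"
proof (rule hausdorff_dim_geI)
  fix t assume t: "0 \<le> t" "t < s"
  obtain u where u: "set u \<subseteq> {1..m}" "F u ` closure V \<subseteq> V" by (rule inner_word_exists)
  have \<alpha>: "\<alpha> \<in> \<Delta>" using assms J_subset_hull by blast
  have "\<forall>\<^sub>F \<beta> in nhds \<alpha>. \<beta> \<in> \<Delta> \<longrightarrow> reach u \<beta> ((t + s) / 2)"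
    by (rule reach_near_rich[OF assms(1) \<alpha> _ _ u(1)]) (use t in auto)
  then obtain d where d: "0 < d" "\<And>\<beta>. dist \<beta> \<alpha> < d \<Longrightarrow> \<beta> \<in> \<Delta> \<Longrightarrow> reach u \<beta> ((t + s) / 2)"
    by (auto simp: eventually_nhds_metric)
  obtain w where w: "set w \<subseteq> {1..m}" "w \<noteq> []" "F w ` J \<subseteq> cball \<alpha> (d / 2)"
    using small_cylinder[OF assms(2), of "d / 2"] d by auto
  have "compact (J \<inter> cball \<alpha> (d / 2))" "F w ` J \<subseteq> J \<inter> cball \<alpha> (d / 2)"
    using J(1) w F_J[OF w(1)] by (auto intro: compact_Int)
  moreover have "reach u \<beta> ((t + s) / 2)" if "\<beta> \<in> J \<inter> cball \<alpha> (d / 2)" for \<beta>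
    using that d J_subset_hull by (intro d(2)) (auto simp: dist_commute)
  ultimately show "hausdorff_measure t (Fix) \<noteq> 0"
    using asymptotic_fixed_points_large[OF u w(1,2), of "J \<inter> cball \<alpha> (d / 2)" "(t + s) / 2"] t
    by (cases "t = 0") (auto simp: hausdorff_measure_0_eq_0_iff)
qed

lemma rich_if_less_dim_spectrum:
  assumes "0 \<le> s" "ennreal s < dim_spectrum Jt g \<alpha>"
  shows "rich \<alpha> s"
proof (rule ccontr)
  assume "\<not> rich \<alpha> s"
  then have "dim_spectrum Jt g \<alpha> \<le> ennreal s"
    unfolding dim_spectrum_def
    by (intro dim_le_if_not_rich[OF assms(1), of "{\<alpha>}"])
       (use regular_codes_subset in \<open>auto simp: level_set_def regular_part_eq birkhoff_sum_coding\<close>)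
  then show False using assms(2) by simp
qed

lemma exists_rich_below_dim_asymptotic_fixed_points:
  assumes "0 \<le> s" "ennreal s < hausdorff_dim (Fix)"
  shows "\<exists>\<alpha>\<in>J. rich \<alpha> s"
proof (rule ccontr)
  assume "\<not> (\<exists>\<alpha>\<in>J. rich \<alpha> s)"
  then have "hausdorff_dim (Fix) \<le> ennreal s"
  proof (intro dim_le_if_not_rich[OF assms(1) J(1)])
    fix x assume x: "x \<in> Fix"
    then obtain \<omega> where \<omega>: "\<omega> \<in> regular_codes" "x = \<pi> \<omega>"
      by (auto simp: asymptotic_fixed_points_def regular_part_eq)
    then show "\<exists>\<omega>\<in>\<Sigma>. \<exists>\<alpha>\<in>J. \<pi> \<omega> = x \<and> (\<lambda>n. (1 / real n) *\<^sub>R orbit_sum n \<omega>) \<longlonglongrightarrow> \<alpha>"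
      using x coding_asymptotic_fixed_points[OF \<omega>(1)] regular_codes_subset coding_in_J by blast
  qed auto
  then show False using assms(2) by simp
qed

theorem dim_asymptotic_fixed_points:
  "hausdorff_dim (Fix) = (SUP \<alpha>\<in>J. dim_spectrum Jt g \<alpha>)"
proof (rule antisym)
  show "hausdorff_dim (Fix) \<le> (SUP \<alpha>\<in>J. dim_spectrum Jt g \<alpha>)"
  proof (rule ennreal_le_by_reals)
    fix s assume "0 \<le> s" "ennreal s < hausdorff_dim (Fix)"
    then obtain \<alpha> where "\<alpha> \<in> J" "rich \<alpha> s" using exists_rich_below_dim_asymptotic_fixed_points by blast
    then show "ennreal s \<le> (SUP \<alpha>\<in>J. dim_spectrum Jt g \<alpha>)"
      using dim_spectrum_ge_if_rich J_subset_hull by (blast intro: SUP_upper2)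
  qed
  show "(SUP \<alpha>\<in>J. dim_spectrum Jt g \<alpha>) \<le> hausdorff_dim (Fix)"
    by (rule SUP_least, rule ennreal_le_by_reals, rule dim_asymptotic_fixed_points_ge_if_rich,
        rule rich_if_less_dim_spectrum)
qed

theorem full_dimension:
  assumes \<alpha>: "\<alpha> \<in> J" "\<And>\<beta>. \<beta> \<in> \<Delta> \<Longrightarrow> dim_spectrum Jt g \<beta> \<le> dim_spectrum Jt g \<alpha>"
  shows "hausdorff_dim (Fix) = hausdorff_dim J"
proof (rule antisym)
  show "hausdorff_dim (Fix) \<le> hausdorff_dim J"
    by (rule hausdorff_dim_mono) (auto simp: asymptotic_fixed_points_def regular_part_def)
  have "hausdorff_dim J \<le> dim_spectrum Jt g \<alpha>"
  proof (rule ennreal_le_by_reals)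
    fix s assume "0 \<le> s" "ennreal s < hausdorff_dim J"
    then obtain \<beta> where "\<beta> \<in> \<Delta>" "rich \<beta> s" using exists_rich_below_dim by blast
    then show "ennreal s \<le> dim_spectrum Jt g \<alpha>"
      using order_trans[OF dim_spectrum_ge_if_rich \<alpha>(2)] by simp
  qed
  also have "\<dots> \<le> hausdorff_dim (Fix)"
    unfolding dim_asymptotic_fixed_points using \<alpha>(1) by (rule SUP_upper)
  finally show "hausdorff_dim J \<le> hausdorff_dim (Fix)" .
qed

section \<open>The attractor meets the interior of its hull\<close>

lemma convex_hull_F: "set z \<subseteq> {1..m} \<Longrightarrow> F z ` \<Delta> \<subseteq> \<Delta>"
  using fp_in_J J_subset_hull by (intro convex_F) auto

text \<open>\<open>F z x\<close> is a convex combination of \<open>x\<close> and the fixed points of the letters of \<open>z\<close> in which each of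
these fixed points has a positive coefficient.\<close>

lemma minimum_on_face:
  assumes "set z \<subseteq> {1..m}" "x \<in> \<Delta>" and min: "\<And>y. y \<in> \<Delta> \<Longrightarrow> d \<le> b \<bullet> y"
    and "b \<bullet> F z x = d" "j \<in> set z"
  shows "b \<bullet> fp j = d"
  using assms(1,4,5)
proof (induction z)
  case (Cons i z)
  have i: "i \<in> {1..m}" and z: "set z \<subseteq> {1..m}" using Cons.prems by auto
  have 1: "d \<le> b \<bullet> fp i" using i fp_in_J J_subset_hull by (intro min) auto
  have 2: "d \<le> b \<bullet> F z x" using convex_hull_F[OF z] assms(2) by (intro min) auto
  have \<rho>: "0 < \<rho> i" "\<rho> i < 1" using ratio[OF i] by auto
  have "(1 - \<rho> i) * (b \<bullet> fp i - d) + \<rho> i * (b \<bullet> F z x - d) = 0"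
    using Cons.prems(2) by (simp add: f_eq[OF i] inner_add_right algebra_simps)
  moreover have "0 \<le> (1 - \<rho> i) * (b \<bullet> fp i - d)" "0 \<le> \<rho> i * (b \<bullet> F z x - d)"
    using 1 2 \<rho> by auto
  ultimately have "(1 - \<rho> i) * (b \<bullet> fp i - d) = 0" "\<rho> i * (b \<bullet> F z x - d) = 0" by linarith+
  then have "b \<bullet> fp i = d" "b \<bullet> F z x = d" using \<rho> by auto
  then show ?case using Cons.IH[OF z] Cons.prems(3) by auto
qed simp

text \<open>The image of a point of \<open>J\<close> under a word that contains all letters lies in the interior of \<open>\<Delta>\<close>: a
supporting hyperplane there would contain all the fixed points, hence \<open>\<Delta>\<close>. A contraction towards a
point of \<open>V \<inter> J\<close> moves this image into \<open>V\<close>.\<close>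

lemma attractor_meets_interior:
  assumes "aff_dim \<Delta> = int DIM('a)"
  shows "V \<inter> interior \<Delta> \<inter> J \<noteq> {}"
proof -
  have rel: "rel_interior \<Delta> = interior \<Delta>"
    using assms by (intro rel_interior_interior) (simp add: aff_dim_eq_full)
  define z where "z = [1..<Suc m]"
  have z: "set z = {1..m}" by (auto simp: z_def)
  define x where "x = F z p"
  have xJ: "x \<in> J" unfolding x_def using z p_in_J by (intro F_in_J) auto
  have x: "x \<in> interior \<Delta>"
  proof (rule ccontr)
    assume "x \<notin> interior \<Delta>"
    then have "x \<notin> rel_interior \<Delta>" by (simp add: rel)
    obtain b where b: "\<And>y. y \<in> \<Delta> \<Longrightarrow> b \<bullet> x \<le> b \<bullet> y"
        "\<And>y. y \<in> rel_interior \<Delta> \<Longrightarrow> b \<bullet> x < b \<bullet> y"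
      using supporting_hyperplane_rel_boundary[OF convex_convex_hull subsetD[OF J_subset_hull xJ]] \<open>x \<notin> rel_interior \<Delta>\<close>
      by metis
    have "b \<bullet> fp j = b \<bullet> x" if "j \<in> {1..m}" for j
    proof (rule minimum_on_face[of z p])
      show "b \<bullet> x \<le> b \<bullet> y" if "y \<in> \<Delta>" for y using that by (rule b(1))
    qed (use z that p_in_J J_subset_hull in \<open>auto simp: x_def\<close>)
    then have "\<Delta> \<subseteq> {y. b \<bullet> y = b \<bullet> x}"
      unfolding hull_eq by (intro hull_minimal) (auto simp: convex_hyperplane)
    moreover have "rel_interior \<Delta> \<noteq> {}" using J(2) by (simp add: rel_interior_eq_empty)
    ultimately show False using b(2) rel_interior_subset[of \<Delta>] by force
  qed
  obtain y where y: "y \<in> V" "y \<in> J" using V(3) by blast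
  obtain e where e: "0 < e" "cball y e \<subseteq> V" using V(1) y(1) open_contains_cball by blast
  obtain w where w: "set w \<subseteq> {1..m}" "F w ` J \<subseteq> cball y e"
    using small_cylinder[OF y(2) e(1)] by metis
  have "F w ` interior \<Delta> \<subseteq> interior \<Delta>"
    using convex_hull_F[OF w(1)] interior_subset[of \<Delta>]
    by (intro interior_maximal open_F[OF w(1)]) auto
  then have "F w x \<in> interior \<Delta>" using x by blast
  moreover have "F w x \<in> V" using w(2) e(2) xJ by blast
  moreover have "F w x \<in> J" using F_in_J[OF w(1) xJ] .
  ultimately show ?thesis by blast
qed

end

text \<open>The set \<open>V = W \<inter> interior \<Delta>\<close> inherits the strong open set condition once it is known to meet \<open>J\<close>.
To show this, the theory is first applied to the intersection of \<open>W\<close> with the open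
neighbourhood \<open>U\<close> of \<open>J\<close> of radius 1. This intersection is bounded, the maps preserve it because they
contract distances and preserve \<open>J\<close>, and it meets \<open>J\<close> because \<open>W\<close> does.\<close>

theorem theorem3p4:
  fixes m :: nat
    and \<rho> :: "nat \<Rightarrow> real"
    and c :: "nat \<Rightarrow> 'a::euclidean_space"
    and f :: "nat \<Rightarrow> 'a \<Rightarrow> 'a"
    and J W V Jt :: "'a set"
    and gt :: "'a \<Rightarrow> 'a"
  assumes ratio: "\<And>j. j \<in> {1..m} \<Longrightarrow> 0 < \<rho> j \<and> \<rho> j < 1"
    and maps: "\<And>j x. j \<in> {1..m} \<Longrightarrow> f j x = \<rho> j *\<^sub>R x + c j"
    and attractor: "ifs_attractor m f J"
    and sosc: "strong_open_set_condition m f J W"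
    and full_dim: "aff_dim (convex hull J) = int DIM('a)"
    and V: "V = W \<inter> interior (convex hull J)"
    and Jt: "Jt = regular_part m f V J"
    and gt: "gt = induced_map m f V"
  shows "limit_averages Jt gt = convex hull J
    \<and> closure (asymptotic_fixed_points Jt gt) = J
    \<and> hausdorff_dim (asymptotic_fixed_points Jt gt) = (SUP \<alpha>\<in>J. dim_spectrum Jt gt \<alpha>)
    \<and> ((\<exists>\<alpha>\<in>J. \<alpha> \<in> limit_averages Jt gt \<and>
            (\<forall>\<beta>\<in>limit_averages Jt gt. dim_spectrum Jt gt \<beta> \<le> dim_spectrum Jt gt \<alpha>))
          \<longrightarrow> hausdorff_dim (asymptotic_fixed_points Jt gt) = hausdorff_dim J)"
proof -
  have J: "compact J" "J = (\<Union>j\<in>{1..m}. f j ` J)" using attractor by (auto simp: ifs_attractor_def)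
  have W: "open W" "\<And>i. i \<in> {1..m} \<Longrightarrow> f i ` W \<subseteq> W" "W \<inter> J \<noteq> {}"
    "\<And>i j. i \<in> {1..m} \<Longrightarrow> j \<in> {1..m} \<Longrightarrow> i \<noteq> j \<Longrightarrow> f i ` W \<inter> f j ` W = {}"
    using sosc by (auto simp: strong_open_set_condition_def)
  have shrink: "strong_open_set_condition m f J (W \<inter> U)"
    if "open U" "\<And>i. i \<in> {1..m} \<Longrightarrow> f i ` U \<subseteq> U" "W \<inter> U \<inter> J \<noteq> {}" for U
    unfolding strong_open_set_condition_def
  proof (intro conjI ballI impI)
    show "f i ` (W \<inter> U) \<subseteq> W \<inter> U" if "i \<in> {1..m}" for i using W(2) that \<open>\<And>i. i \<in> {1..m} \<Longrightarrow> f i ` U \<subseteq> U\<close> by blast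
    show "f i ` (W \<inter> U) \<inter> f j ` (W \<inter> U) = {}" if "i \<in> {1..m}" "j \<in> {1..m}" "i \<noteq> j" for i j
      using W(4)[OF that] by blast
  qed (use that W in auto)
  define U where "U = (\<Union>y\<in>J. ball y 1)"
  obtain y B where "\<forall>x\<in>J. dist y x \<le> B" using compact_imp_bounded[OF J(1)] by (auto simp: bounded_def)
  have "U \<subseteq> ball y (B + 1)"
  proof
    fix x assume "x \<in> U"
    then obtain y' where "y' \<in> J" "dist y' x < 1" by (auto simp: U_def)
    moreover from this have "dist y y' \<le> B" using \<open>\<forall>x\<in>J. dist y x \<le> B\<close> by blast
    ultimately show "x \<in> ball y (B + 1)" using dist_triangle[of y x y'] by simp
  qed
  then have "bounded U" using bounded_ball bounded_subset by blast
  have U_inv: "f i ` U \<subseteq> U" if i: "i \<in> {1..m}" for i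
  proof
    fix z assume "z \<in> f i ` U"
    then obtain x y where xy: "z = f i x" "y \<in> J" "dist y x < 1" by (auto simp: U_def)
    have "dist (f i y) (f i x) = \<rho> i * dist y x"
      using ratio[OF i] by (simp add: maps[OF i] dist_norm flip: scaleR_diff_right)
    also have "\<dots> \<le> 1 * dist y x" using ratio[OF i] by (intro mult_right_mono) auto
    finally have "z \<in> ball (f i y) 1" using xy by simp
    moreover have "f i y \<in> J" using i xy J(2) by blast
    ultimately show "z \<in> U" by (auto simp: U_def)
  qed
  have "J \<subseteq> U" by (auto simp: U_def)
  then have "strong_open_set_condition m f J (W \<inter> U)"
    using W(3) U_inv by (intro shrink) (auto simp: U_def)
  then interpret W: homothetic_ifs m \<rho> c f J "W \<inter> U"
    using ratio maps attractor \<open>bounded U\<close> by unfold_locales (auto intro: bounded_subset)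
  have "f i ` interior (convex hull J) \<subseteq> interior (convex hull J)" if i: "i \<in> {1..m}" for i
    using W.convex_hull_F[of "[i]"] W.open_F[of "[i]" "interior (convex hull J)"] i
      interior_subset[of "convex hull J"] by (intro interior_maximal) auto
  then have "strong_open_set_condition m f J V"
    unfolding V using W.attractor_meets_interior[OF full_dim] by (intro shrink) auto
  moreover have "bounded V"
    unfolding V using compact_imp_bounded[OF W.compact_hull] interior_subset[of "convex hull J"]
    by (blast intro: bounded_subset)
  ultimately interpret homothetic_ifs m \<rho> c f J V
    using ratio maps attractor by unfold_locales auto
  show ?thesis
    unfolding Jt gt
    using limit_averages_eq asymptotic_fixed_points_dense dim_asymptotic_fixed_points full_dimension by auto
qed

end
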